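(* There exists a constant $C>0$ depending only on $p$ such that for all $v_h,w_h,z_h\in V_h$, $$|a_h(w_h,v_h)-a_h(z_h,v_h)|\le C\left(|||w_h|||_h^{p'}+|||z_h|||_h^{p'}\right)^{\frac{p'-\underline{p}'}{p'}}\,|||w_h-z_h|||_h^{\underline{p}'-1}\,|||v_h|||_h ,$$ where $\underline{p}'=\min\{p',2\}$ (a factor with exponent $0$ is read as $1$).
   Context: Setting. $\Omega\subset\mathbb R^2$ is an open, bounded, connected polygonal domain with Lipschitz boundary; $p\in(1,\infty)$ and the integer $k\ge0$ are fixed; $p'=p/(p-1)$. $\Omega_h$ (a member of a family of meshes) is a decomposition of $\Omega$ into nonoverlapping polygonal elements $E$; $h_E$, $|E|$, $x_E$, $\mathcal E_E$ are the diameter, area, barycenter and set of edges of $E$; $h_e$, $x_e$, $n_e$ are the length, midpoint and a fixed unit normal of an edge $e$. Mesh regularity: there is $\rho>0$ (uniform over the family) such that every $E$ is star-shaped with respect to a disk of radius $\ge\rho h_E$ and $h_e\ge\rho h_E$ for all $e\in\mathcal E_E$. $\mathcal P^\ell(Y)$: polynomials of total degree $\le\ell$ on $Y$ ($\mathcal P^{-1}=\{0\}$); $\pi_E$: $L^2(E)$-orthogonal projector of vector fields onto $\mathcal P^k(E)^2$. $\operatorname{rot}w=\partial_1w_2-\partial_2w_1$; $(a_1,a_2)^\perp=(-a_2,a_1)$. Spaces. $V_h(E)=\{v\in H(\mathrm{div};E)\cap H(\mathrm{rot};E): v\cdot n_e\in\mathcal P^k(e)\ \forall e\in\mathcal E_E,\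 \nabla\cdot v\in\mathcal P^k(E),\ \operatorname{rot}v\in\mathcal P^{k-1}(E)\}$. $\mathrm{dof}_E(v)\in\mathbb R^{N_E}$, $N_E=\dim V_h(E)$, is the vector of degrees of freedom: (i) $\frac1{h_e}\int_e (v\cdot n_e)m$ for each $e\in\mathcal E_E$, $m=((x-x_e)/h_e)^\alpha$, $0\le\alpha\le k$ ($x$ a length coordinate on $e$); (ii) $\frac{h_E}{|E|}\int_E v\cdot\nabla m$, $m=((x-x_E)/h_E)^{\alpha}$, $1\le|\alpha|\le k$; (iii) $\frac1{|E|}\int_E v\cdot\left(\frac{x-x_E}{h_E}\right)^\perp m$, $m=((x-x_E)/h_E)^{\alpha}$, $|\alpha|\le k-1$. $V_h=\{v\in H(\mathrm{div};\Omega): v|_E\in V_h(E)\ \forall E\in\Omega_h\}$. Forms and norm. $a_E(w,v)=\int_E|w|^{p'-2}w\cdot v$; $s_E(w,v)=h_E^2|\mathrm{dof}_E(w)|^{p'-2}\mathrm{dof}_E(w)\cdot\mathrm{dof}_E(v)$ (with $|A|^{p'-2}A:=0$ at $A=0$); $$a_h(w,v)=\sum_{E\in\Omega_h}\big[a_E(\pi_Ew,\pi_Ev)+s_E(w-\pi_Ew,v-\pi_Ev)\big].$$ $|||w|||_h^{p'}=a_h(w,w)+\sum_{E\in\Omega_h}h_E^{p'}\|\nabla\cdot w\|_{L^{p'}(E)}^{p'}$. *)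

theory Defs
  imports "HOL-Analysis.Analysis" "HOL-Computational_Algebra.Polynomial"
begin

type_synonym pt = "real^2"

definition perp :: "pt \<Rightarrow> pt" where
  "perp a = vector [- a$2, a$1]"

section \<open>Polynomials of bounded total degree\<close>

definition monom2 :: "nat \<times> nat \<Rightarrow> pt \<Rightarrow> real" where
  "monom2 \<alpha> x = (x$1) ^ fst \<alpha> * (x$2) ^ snd \<alpha>"

text \<open>The degree bound is an integer, so that \<open>Polys (-1) = {0}\<close>.\<close>

definition midx :: "int \<Rightarrow> (nat \<times> nat) set" where
  "midx l = {\<alpha>. int (fst \<alpha> + snd \<alpha>) \<le> l}"

definition Polys :: "int \<Rightarrow> (pt \<Rightarrow> real) set" where
  "Polys l = {f. \<exists>c :: nat \<times> nat \<Rightarrow> real. \<forall>x. f x = (\<Sum>\<alpha>\<in>midx l. c \<alpha> * monom2 \<alpha> x)}"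

definition vPolys :: "int \<Rightarrow> (pt \<Rightarrow> pt) set" where
  "vPolys l = {q. \<forall>i. (\<lambda>x. q x $ i) \<in> Polys l}"

section \<open>Square integrability, weak divergence and weak rotation\<close>

definition square_integrable :: "pt set \<Rightarrow> (pt \<Rightarrow> 'b::euclidean_space) \<Rightarrow> bool" where
  "square_integrable E f \<longleftrightarrow>
     set_borel_measurable lebesgue E f \<and> set_integrable lebesgue E (\<lambda>x. (norm (f x))\<^sup>2)"

definition grad :: "(pt \<Rightarrow> real) \<Rightarrow> pt \<Rightarrow> pt" where
  "grad f x = (THE D. GDERIV f x :> D)"

text \<open>Test functions: \<open>C\<^sup>1\<close> on the plane with compact support contained in \<open>U\<close>. By mollification
  they define the same weak derivatives (and traces, below) as \<open>C\<^sup>\<infinity>\<close> test functions.\<close>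

definition C1c :: "pt set \<Rightarrow> (pt \<Rightarrow> real) set" where
  "C1c U = {\<phi>. (\<forall>x. \<exists>D. GDERIV \<phi> x :> D) \<and> continuous_on UNIV (grad \<phi>) \<and>
              compact (closure {x. \<phi> x \<noteq> 0}) \<and> closure {x. \<phi> x \<noteq> 0} \<subseteq> U}"

definition weak_div :: "pt set \<Rightarrow> (pt \<Rightarrow> pt) \<Rightarrow> (pt \<Rightarrow> real) \<Rightarrow> bool" where
  "weak_div E v d \<longleftrightarrow> square_integrable E d \<and>
     (\<forall>\<phi>\<in>C1c E. (LINT x:E|lebesgue. v x \<bullet> grad \<phi> x) = - (LINT x:E|lebesgue. d x * \<phi> x))"

text \<open>\<open>\<integral> (\<partial>\<^sub>1 v\<^sub>2 - \<partial>\<^sub>2 v\<^sub>1) \<phi> = - \<integral> v \<bullet> (\<nabla>\<phi>)\<^sup>\<bottom>\<close> for smooth \<open>v\<close>.\<close>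

definition weak_rot :: "pt set \<Rightarrow> (pt \<Rightarrow> pt) \<Rightarrow> (pt \<Rightarrow> real) \<Rightarrow> bool" where
  "weak_rot E v r \<longleftrightarrow> square_integrable E r \<and>
     (\<forall>\<phi>\<in>C1c E. (LINT x:E|lebesgue. v x \<bullet> perp (grad \<phi> x)) = - (LINT x:E|lebesgue. r x * \<phi> x))"

definition Hdiv :: "pt set \<Rightarrow> (pt \<Rightarrow> pt) set" where
  "Hdiv E = {v. square_integrable E v \<and> (\<exists>d. weak_div E v d)}"

definition Hrot :: "pt set \<Rightarrow> (pt \<Rightarrow> pt) set" where
  "Hrot E = {v. square_integrable E v \<and> (\<exists>r. weak_rot E v r)}"

text \<open>A representative of the weak divergence, which is unique up to null sets.\<close>

definition divg :: "pt set \<Rightarrow> (pt \<Rightarrow> pt) \<Rightarrow> pt \<Rightarrow> real" where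
  "divg E v = (SOME d. weak_div E v d)"

section \<open>Polygonal domains and meshes\<close>

definition lipschitz_boundary :: "pt set \<Rightarrow> bool" where
  "lipschitz_boundary \<Omega> \<longleftrightarrow>
     (\<forall>x\<in>frontier \<Omega>. \<exists>r>0. \<exists>\<nu>. \<exists>L. \<exists>\<gamma> :: real \<Rightarrow> real. norm \<nu> = 1 \<and> L-lipschitz_on UNIV \<gamma> \<and>
        (\<forall>y\<in>ball x r. y \<in> \<Omega> \<longleftrightarrow> (y - x) \<bullet> \<nu> > \<gamma> ((y - x) \<bullet> perp \<nu>)))"

definition polygonal_domain :: "pt set \<Rightarrow> bool" where
  "polygonal_domain \<Omega> \<longleftrightarrow> open \<Omega> \<and> bounded \<Omega> \<and> connected \<Omega> \<and> \<Omega> \<noteq> {} \<and>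
     (\<exists>S. finite S \<and> frontier \<Omega> = (\<Union>(a, b)\<in>S. closed_segment a b)) \<and> lipschitz_boundary \<Omega>"

text \<open>A polygonal element is given by the cyclic list of its vertices. Consecutive edges may be
  collinear, so that hanging nodes count as vertices.\<close>

type_synonym polygon = "pt list"

fun polyline :: "pt list \<Rightarrow> real \<Rightarrow> pt" where
  "polyline [] = linepath 0 0"
| "polyline [a] = linepath a a"
| "polyline [a, b] = linepath a b"
| "polyline (a # b # c # xs) = linepath a b +++ polyline (b # c # xs)"

definition bdry_path :: "polygon \<Rightarrow> real \<Rightarrow> pt" where
  "bdry_path P = polyline (P @ [hd P])"

definition is_polygon :: "polygon \<Rightarrow> bool" where
  "is_polygon P \<longleftrightarrow> length P \<ge> 3 \<and> simple_path (bdry_path P)"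

definition elem :: "polygon \<Rightarrow> pt set" where
  "elem P = inside (path_image (bdry_path P))"

definition edges :: "polygon \<Rightarrow> (pt \<times> pt) set" where
  "edges P = set (zip P (rotate1 P))"

definition diam :: "polygon \<Rightarrow> real" where
  "diam P = diameter (elem P)"

definition area :: "polygon \<Rightarrow> real" where
  "area P = measure lebesgue (elem P)"

definition barycenter :: "polygon \<Rightarrow> pt" where
  "barycenter P = (1 / area P) *\<^sub>R (LINT x:elem P|lebesgue. x)"

definition is_mesh :: "pt set \<Rightarrow> polygon set \<Rightarrow> bool" where
  "is_mesh \<Omega> M \<longleftrightarrow> finite M \<and> (\<forall>P\<in>M. is_polygon P) \<and>
     (\<forall>P\<in>M. \<forall>Q\<in>M. P \<noteq> Q \<longrightarrow> elem P \<inter> elem Q = {}) \<and>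
     (\<Union>P\<in>M. closure (elem P)) = closure \<Omega>"

definition star_shaped_wrt_disk :: "pt set \<Rightarrow> pt \<Rightarrow> real \<Rightarrow> bool" where
  "star_shaped_wrt_disk E c r \<longleftrightarrow>
     ball c r \<subseteq> E \<and> (\<forall>y\<in>ball c r. \<forall>x\<in>E. closed_segment y x \<subseteq> E)"

definition mesh_regular :: "real \<Rightarrow> polygon set \<Rightarrow> bool" where
  "mesh_regular \<rho> M \<longleftrightarrow> (\<forall>P\<in>M.
     (\<exists>c r. r \<ge> \<rho> * diam P \<and> star_shaped_wrt_disk (elem P) c r) \<and>
     (\<forall>(a, b)\<in>edges P. dist a b \<ge> \<rho> * diam P))"

text \<open>A choice \<open>nrm\<close> of unit normals. It depends only on the edge as a segment, so the two elements
  sharing an edge use the same normal.\<close>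

definition edge_normals :: "polygon set \<Rightarrow> (pt set \<Rightarrow> pt) \<Rightarrow> bool" where
  "edge_normals M nrm \<longleftrightarrow> (\<forall>P\<in>M. \<forall>(a, b)\<in>edges P.
     norm (nrm (closed_segment a b)) = 1 \<and> nrm (closed_segment a b) \<bullet> (b - a) = 0)"

section \<open>Normal traces on edges\<close>

text \<open>Parametrization of an edge with unit normal \<open>n\<close> by its length coordinate
  \<open>s \<in> [- h\<^sub>e / 2, h\<^sub>e / 2]\<close>, with \<open>s = 0\<close> at the midpoint.\<close>

definition edge_point :: "pt \<times> pt \<Rightarrow> pt \<Rightarrow> real \<Rightarrow> pt" where
  "edge_point e n s = midpoint (fst e) (snd e) + s *\<^sub>R perp n"

definition edge_len :: "pt \<times> pt \<Rightarrow> real" where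
  "edge_len e = dist (fst e) (snd e)"

definition edge_interval :: "pt \<times> pt \<Rightarrow> real set" where
  "edge_interval e = {- edge_len e / 2 .. edge_len e / 2}"

text \<open>The sign relating \<open>n\<close> to the outward normal of \<open>E\<close> on \<open>e\<close>.\<close>

definition outward_sign :: "pt set \<Rightarrow> pt \<times> pt \<Rightarrow> pt \<Rightarrow> real" where
  "outward_sign E e n =
     (if eventually (\<lambda>t. midpoint (fst e) (snd e) + t *\<^sub>R n \<in> E) (at_right 0) then -1 else 1)"

text \<open>\<open>g\<close>, a function of the length coordinate, is the normal trace of \<open>v \<in> H(div; E)\<close> on \<open>e\<close>:
  Green's formula, tested with functions whose support meets the boundary of \<open>E\<close> only inside the
  relatively open edge.\<close>

definition normal_trace ::
    "pt set \<Rightarrow> pt \<times> pt \<Rightarrow> pt \<Rightarrow> (pt \<Rightarrow> pt) \<Rightarrow> (real \<Rightarrow> real) \<Rightarrow> bool" where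
  "normal_trace E e n v g \<longleftrightarrow> set_integrable lebesgue (edge_interval e) g \<and>
     (\<forall>\<phi>\<in>C1c (- (frontier E - open_segment (fst e) (snd e))).
        (LINT x:E|lebesgue. v x \<bullet> grad \<phi> x + divg E v x * \<phi> x) =
        outward_sign E e n * (LINT s:edge_interval e|lebesgue. g s * \<phi> (edge_point e n s)))"

text \<open>A representative of the normal trace \<open>v \<bullet> n\<close> on \<open>e\<close>, unique up to null sets.\<close>

definition ntrace :: "pt set \<Rightarrow> pt \<times> pt \<Rightarrow> pt \<Rightarrow> (pt \<Rightarrow> pt) \<Rightarrow> real \<Rightarrow> real" where
  "ntrace E e n v = (SOME g. normal_trace E e n v g)"

section \<open>Discrete spaces\<close>

definition edge_normal :: "(pt set \<Rightarrow> pt) \<Rightarrow> pt \<times> pt \<Rightarrow> pt" where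
  "edge_normal nrm e = nrm (closed_segment (fst e) (snd e))"

definition Vh_loc :: "nat \<Rightarrow> (pt set \<Rightarrow> pt) \<Rightarrow> polygon \<Rightarrow> (pt \<Rightarrow> pt) set" where
  "Vh_loc k nrm P = {v \<in> Hdiv (elem P) \<inter> Hrot (elem P).
     (\<forall>e\<in>edges P. \<exists>q :: real poly. degree q \<le> k \<and>
        normal_trace (elem P) e (edge_normal nrm e) v (poly q)) \<and>
     (\<exists>q\<in>Polys (int k). weak_div (elem P) v q) \<and>
     (\<exists>q\<in>Polys (int k - 1). weak_rot (elem P) v q)}"

definition Vh :: "nat \<Rightarrow> (pt set \<Rightarrow> pt) \<Rightarrow> pt set \<Rightarrow> polygon set \<Rightarrow> (pt \<Rightarrow> pt) set" where
  "Vh k nrm \<Omega> M = {v \<in> Hdiv \<Omega>. \<forall>P\<in>M. v \<in> Vh_loc k nrm P}"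

text \<open>The \<open>L\<^sup>2\<close>-orthogonal projection onto \<open>vPolys k\<close>. A polynomial field on the plane is
  determined by its restriction to an element.\<close>

definition proj :: "nat \<Rightarrow> polygon \<Rightarrow> (pt \<Rightarrow> pt) \<Rightarrow> pt \<Rightarrow> pt" where
  "proj k P v = (THE q. q \<in> vPolys (int k) \<and>
     (\<forall>r\<in>vPolys (int k). (LINT x:elem P|lebesgue. (v x - q x) \<bullet> r x) = 0))"

section \<open>Degrees of freedom\<close>

datatype dof_ix = Edge_Dof "pt \<times> pt" nat | Grad_Dof "nat \<times> nat" | Perp_Dof "nat \<times> nat"

definition dof_index :: "nat \<Rightarrow> polygon \<Rightarrow> dof_ix set" where
  "dof_index k P =
     {Edge_Dof e j | e j. e \<in> edges P \<and> j \<le> k} \<union>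
     Grad_Dof ` (midx (int k) - {(0, 0)}) \<union>
     Perp_Dof ` midx (int k - 1)"

definition scaled :: "polygon \<Rightarrow> pt \<Rightarrow> pt" where
  "scaled P x = (1 / diam P) *\<^sub>R (x - barycenter P)"

primrec dof :: "(pt set \<Rightarrow> pt) \<Rightarrow> polygon \<Rightarrow> (pt \<Rightarrow> pt) \<Rightarrow> dof_ix \<Rightarrow> real" where
  "dof nrm P v (Edge_Dof e j) =
     1 / edge_len e * (LINT s:edge_interval e|lebesgue.
        ntrace (elem P) e (edge_normal nrm e) v s * (s / edge_len e) ^ j)"
| "dof nrm P v (Grad_Dof \<alpha>) =
     diam P / area P * (LINT x:elem P|lebesgue. v x \<bullet> grad (\<lambda>y. monom2 \<alpha> (scaled P y)) x)"
| "dof nrm P v (Perp_Dof \<alpha>) =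
     1 / area P * (LINT x:elem P|lebesgue. v x \<bullet> perp (scaled P x) * monom2 \<alpha> (scaled P x))"

section \<open>Forms and norm\<close>

definition conj_exp :: "real \<Rightarrow> real" where
  "conj_exp p = p / (p - 1)"

text \<open>In the two forms below \<open>0 powr _ = 0\<close>, and the remaining factor also vanishes at zero.\<close>

definition a_loc :: "real \<Rightarrow> polygon \<Rightarrow> (pt \<Rightarrow> pt) \<Rightarrow> (pt \<Rightarrow> pt) \<Rightarrow> real" where
  "a_loc p P w v = (LINT x:elem P|lebesgue. norm (w x) powr (conj_exp p - 2) * (w x \<bullet> v x))"

definition s_loc ::
    "real \<Rightarrow> nat \<Rightarrow> (pt set \<Rightarrow> pt) \<Rightarrow> polygon \<Rightarrow> (pt \<Rightarrow> pt) \<Rightarrow> (pt \<Rightarrow> pt) \<Rightarrow> real" where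
  "s_loc p k nrm P w v = (diam P)\<^sup>2 *
     L2_set (dof nrm P w) (dof_index k P) powr (conj_exp p - 2) *
     (\<Sum>i\<in>dof_index k P. dof nrm P w i * dof nrm P v i)"

definition a_h ::
    "real \<Rightarrow> nat \<Rightarrow> (pt set \<Rightarrow> pt) \<Rightarrow> polygon set \<Rightarrow> (pt \<Rightarrow> pt) \<Rightarrow> (pt \<Rightarrow> pt) \<Rightarrow> real" where
  "a_h p k nrm M w v = (\<Sum>P\<in>M.
     a_loc p P (proj k P w) (proj k P v) +
     s_loc p k nrm P (\<lambda>x. w x - proj k P w x) (\<lambda>x. v x - proj k P v x))"

definition Lq_norm :: "real \<Rightarrow> pt set \<Rightarrow> (pt \<Rightarrow> real) \<Rightarrow> real" where
  "Lq_norm q E f = (LINT x:E|lebesgue. \<bar>f x\<bar> powr q) powr (1 / q)"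

definition norm_h ::
    "real \<Rightarrow> nat \<Rightarrow> (pt set \<Rightarrow> pt) \<Rightarrow> polygon set \<Rightarrow> (pt \<Rightarrow> pt) \<Rightarrow> real" where
  "norm_h p k nrm M w =
     (a_h p k nrm M w w +
      (\<Sum>P\<in>M. diam P powr conj_exp p * Lq_norm (conj_exp p) (elem P) (divg (elem P) w) powr conj_exp p))
     powr (1 / conj_exp p)"

text \<open>Real power with \<open>x\<^sup>0 = 1\<close> also at \<open>x = 0\<close>, where \<open>0 powr 0 = 0\<close>.\<close>

definition rpow :: "real \<Rightarrow> real \<Rightarrow> real" where
  "rpow x a = (if a = 0 then 1 else x powr a)"

end

theory Submission
  imports Defs
begin

text \<open>Write \<open>q = p'\<close> and \<open>r = min q 2\<close>. In Euclidean space the map \<open>A x = |x|\<^sup>q\<^sup>-\<^sup>2 x\<close> satisfies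
  \<open>|A x - A y| \<le> C (|x|\<^sup>q + |y|\<^sup>q)\<^sup>a |x - y|\<^sup>r\<^sup>-\<^sup>1\<close> with \<open>a = (q - r) / q\<close>. Since
  \<open>a + (r - 1) / q + 1 / q = 1\<close>, Hoelder's inequality for integrals and sums gives the estimate
  for \<open>a\<^sub>h\<close>, and the divergence terms of the norm are nonnegative. This uses that the projection
  and the degrees of freedom are linear. The degrees of freedom are applied to \<open>w - \<pi>w\<close>, so
  polynomial fields must have a normal trace on each edge (Green's formula, obtained by slicing the
  element parallel and orthogonal to the edge), and moments of normal traces must be unique
  (tested with smooth cutoffs).\<close>

section \<open>Hoelder inequality and the power map\<close>

text \<open>The obstacle is less the inequality than the choice operators in the definitions.
  \<open>proj\<close>, \<open>divg\<close> and \<open>ntrace\<close> are picked by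
  \<open>THE\<close> and \<open>SOME\<close>, so none of them is additive by definition. For
  \<open>proj\<close> additivity comes from uniqueness; for the edge moments it comes from the fact
  that two normal traces of one field have equal moments, even though the chosen representatives
  need not agree pointwise. The power map estimate is proved for families of reals measured by
  \<open>L2_set\<close>, so that one inequality with one constant serves both the vectors of the
  plane and the vectors of degrees of freedom. Its constant \<open>1 + max 1 (q - 2)\<close> is
  never enlarged: the three exponents add up to 1, so the weight h^2 of the stabilisation and the
  two contributions of each element pass through Hoelder's inequality without a further factor.
  \<open>rpow\<close> takes care of q \<le> 2, where a = 0 and the growth factor has to be 1 even
  for zero fields.\<close>

lemma rpow_nonneg [simp]: "0 \<le> rpow x a"
  by (simp add: rpow_def)

lemma rpow_mono: "0 \<le> a \<Longrightarrow> 0 \<le> x \<Longrightarrow> x \<le> y \<Longrightarrow> rpow x a \<le> rpow y a"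
  by (simp add: rpow_def powr_mono2)

lemma rpow_eq_powr: "0 < x \<Longrightarrow> rpow x a = x powr a"
  by (simp add: rpow_def)

lemma rpow_mult: "0 \<le> x \<Longrightarrow> 0 \<le> y \<Longrightarrow> rpow (x * y) a = rpow x a * rpow y a"
  by (simp add: rpow_def powr_mult)

lemma borel_measurable_rpow [measurable]:
  assumes [measurable]: "f \<in> borel_measurable M"
  shows "(\<lambda>x. rpow (f x) a) \<in> borel_measurable M"
  by (cases "a = 0") (simp_all add: rpow_def)

text \<open>Young's inequality for two factors, used twice: first to merge Y and Z with the weights
  b / (b + c) and c / (b + c), then to combine the merged factor with X. For a = 0 the second use
  drops out, and \<open>rpow X 0\<close> is 1 even if X vanishes.\<close>

lemma young_three:
  fixes X Y Z :: real
  assumes "0 \<le> a" "0 < b" "0 < c" "a + b + c = 1" "0 \<le> X" "0 \<le> Y" "0 \<le> Z"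
  shows "rpow X a * Y powr b * Z powr c \<le> a * X + b * Y + c * Z"
proof (cases "(X = 0 \<and> a \<noteq> 0) \<or> Y = 0 \<or> Z = 0")
  case True
  have "0 \<le> a * X + b * Y + c * Z" using assms by simp
  with True show ?thesis by (auto simp: rpow_def)
next
  case False
  with assms have pos: "0 < Y" "0 < Z" by auto
  define d where "d = b + c"
  have d: "0 < d" "a + d = 1" "b / d + c / d = 1"
    using assms by (auto simp: d_def simp flip: add_divide_distrib)
  define W where "W = Y powr (b / d) * Z powr (c / d)"
  have W: "W > 0" using pos by (simp add: W_def)
  have WY: "W \<le> b / d * Y + c / d * Z"
    unfolding W_def by (rule Youngs_inequality_0) (use assms pos d in auto)
  have Wd: "W powr d = Y powr b * Z powr c"
    using d pos by (simp add: W_def powr_mult powr_powr)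
  have dW: "d * W \<le> b * Y + c * Z"
    using mult_left_mono[OF WY, of d] d(1) by (simp add: distrib_left)
  show ?thesis
  proof (cases "a = 0")
    case True
    then have "d = 1" using d by simp
    then show ?thesis using Wd dW W True by (simp add: rpow_def)
  next
    case False
    with assms \<open>\<not> ((X = 0 \<and> a \<noteq> 0) \<or> Y = 0 \<or> Z = 0)\<close> have "X > 0" by auto
    have "X powr a * W powr d \<le> a * X + d * W"
      by (rule Youngs_inequality_0) (use assms W d \<open>X > 0\<close> in auto)
    then show ?thesis using Wd dW \<open>X > 0\<close> by (simp add: rpow_def False mult.assoc)
  qed
qed

text \<open>The classical normalisation: divide each function by its integral, apply
  \<open>young_three\<close> pointwise and integrate. The weights then sum to 1, so no constant
  appears.\<close>

lemma rpow_Hoelder: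
  fixes X Y Z :: "'a \<Rightarrow> real"
  assumes abc: "0 \<le> a" "0 < b" "0 < c" "a + b + c = 1"
    and int: "integrable M X" "integrable M Y" "integrable M Z"
    and nonneg: "\<And>x. 0 \<le> X x" "\<And>x. 0 \<le> Y x" "\<And>x. 0 \<le> Z x"
  shows "integrable M (\<lambda>x. rpow (X x) a * Y x powr b * Z x powr c)" (is "integrable M ?F")
    and "(\<integral>x. rpow (X x) a * Y x powr b * Z x powr c \<partial>M)
          \<le> rpow (\<integral>x. X x \<partial>M) a * (\<integral>x. Y x \<partial>M) powr b * (\<integral>x. Z x \<partial>M) powr c"
proof -
  have [measurable]: "X \<in> borel_measurable M" "Y \<in> borel_measurable M" "Z \<in> borel_measurable M"
    using int by auto
  show F: "integrable M ?F"
  proof (rule Bochner_Integration.integrable_bound)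
    show "integrable M (\<lambda>x. a * X x + b * Y x + c * Z x)" using int by simp
    show "AE x in M. norm (?F x) \<le> norm (a * X x + b * Y x + c * Z x)"
      using young_three[OF abc] nonneg abc by (auto simp: abs_mult)
  qed measurable
  define A B C where "A = (\<integral>x. X x \<partial>M)" and "B = (\<integral>x. Y x \<partial>M)" and "C = (\<integral>x. Z x \<partial>M)"
  have ABC: "0 \<le> A" "0 \<le> B" "0 \<le> C"
    unfolding A_def B_def C_def by (auto intro!: Bochner_Integration.integral_nonneg nonneg)
  \<comment> \<open>The shift e keeps the divisors positive when an integral is zero; it is sent to
    0 at the end.\<close>
  have eps: "(\<integral>x. ?F x \<partial>M) \<le> rpow (A + e) a * (B + e) powr b * (C + e) powr c" if "e > 0" for e
  proof -
    define K where "K = rpow (A + e) a * (B + e) powr b * (C + e) powr c"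
    have pos: "A + e > 0" "B + e > 0" "C + e > 0" using ABC that by auto
    have F_le: "?F x \<le> K * (a * (X x / (A + e)) + b * (Y x / (B + e)) + c * (Z x / (C + e)))" for x
    proof -
      have "rpow (X x) a = rpow (A + e) a * rpow (X x / (A + e)) a"
           "Y x powr b = (B + e) powr b * (Y x / (B + e)) powr b"
           "Z x powr c = (C + e) powr c * (Z x / (C + e)) powr c"
        using pos nonneg by (simp_all flip: rpow_mult powr_mult)
      then have "?F x = K * (rpow (X x / (A + e)) a * (Y x / (B + e)) powr b * (Z x / (C + e)) powr c)"
        by (simp add: K_def)
      also have "\<dots> \<le> K * (a * (X x / (A + e)) + b * (Y x / (B + e)) + c * (Z x / (C + e)))"
        by (intro mult_left_mono young_three) (use abc nonneg pos in \<open>auto simp: K_def\<close>)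
      finally show ?thesis .
    qed
    have "(\<integral>x. ?F x \<partial>M) \<le>
        (\<integral>x. K * (a * (X x / (A + e)) + b * (Y x / (B + e)) + c * (Z x / (C + e))) \<partial>M)"
      by (intro integral_mono F F_le) (use int in auto)
    also have "\<dots> = K * (a * (A / (A + e)) + b * (B / (B + e)) + c * (C / (C + e)))"
      using int by (simp add: A_def B_def C_def)
    also have "\<dots> \<le> K * (a * 1 + b * 1 + c * 1)"
      by (intro mult_left_mono add_mono) (use abc pos ABC that in \<open>auto simp: K_def field_simps\<close>)
    also have "\<dots> = K" using abc by simp
    finally show ?thesis by (simp add: K_def)
  qed
  \<comment> \<open>The base may be 0 here; the power is continuous there because d is
    positive.\<close>
  have lim_powr: "((\<lambda>e. (D + e) powr d) \<longlongrightarrow> D powr d) (at_right 0)" if "0 \<le> D" "0 < d" for D d :: real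
  proof -
    have "((\<lambda>e. (D + e) powr d) \<longlongrightarrow> (D + 0) powr d) (at_right 0)"
      by (rule tendsto_powr')
        (use that in \<open>auto intro!: tendsto_add tendsto_const tendsto_ident_at simp: eventually_at_filter simp del: add_0_right\<close>)
    then show ?thesis by simp
  qed
  have "((\<lambda>e. rpow (A + e) a * (B + e) powr b * (C + e) powr c)
      \<longlongrightarrow> rpow A a * B powr b * C powr c) (at_right 0)"
    by (intro tendsto_mult lim_powr ABC abc)
      (use lim_powr[OF ABC(1), of a] abc in \<open>auto simp: rpow_def\<close>)
  then have "(\<integral>x. ?F x \<partial>M) \<le> rpow A a * B powr b * C powr c"
    by (rule tendsto_lowerbound) (auto simp: eventually_at_filter eps)
  then show "(\<integral>x. ?F x \<partial>M)
          \<le> rpow (\<integral>x. X x \<partial>M) a * (\<integral>x. Y x \<partial>M) powr b * (\<integral>x. Z x \<partial>M) powr c"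
    by (simp add: A_def B_def C_def)
qed

lemma rpow_Hoelder_sum:
  fixes X Y Z :: "'a \<Rightarrow> real"
  assumes abc: "0 \<le> a" "0 < b" "0 < c" "a + b + c = 1" and "finite I"
    and nonneg: "\<And>x. 0 \<le> X x" "\<And>x. 0 \<le> Y x" "\<And>x. 0 \<le> Z x"
  shows "(\<Sum>x\<in>I. rpow (X x) a * Y x powr b * Z x powr c)
          \<le> rpow (\<Sum>x\<in>I. X x) a * (\<Sum>x\<in>I. Y x) powr b * (\<Sum>x\<in>I. Z x) powr c"
  using rpow_Hoelder(2)[OF abc, of "count_space I" X Y Z] assms
  by (simp add: lebesgue_integral_count_space_finite integrable_count_space)

text \<open>By homogeneity only x = \<beta> / \<alpha> in (0, 1] matters. There 1 - x^s is at most
  max 1 s times 1 - x: for s \<le> 1 because x \<le> x^s, otherwise by Bernoulli's inequality. The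
  factor \<beta> is finally enlarged to \<alpha>.\<close>

lemma powr_diff_mult_le:
  fixes \<alpha> \<beta> s :: real
  assumes "0 < s" "0 \<le> \<beta>" "\<beta> \<le> \<alpha>"
  shows "(\<alpha> powr s - \<beta> powr s) * \<beta> \<le> max 1 s * \<alpha> powr s * (\<alpha> - \<beta>)"
proof (cases "\<beta> = 0")
  case False
  define x where "x = \<beta> / \<alpha>"
  have \<alpha>: "\<alpha> > 0" and x: "0 < x" "x \<le> 1" "\<beta> = x * \<alpha>"
    using False assms by (auto simp: x_def)
  have key: "1 - x powr s \<le> max 1 s * (1 - x)"
  proof (cases "s \<le> 1")
    case True
    have "x powr 1 \<le> x powr s" using x True by (intro powr_mono') auto
    then show ?thesis using x True by simp
  next
    case False
    \<comment> \<open>Bernoulli's inequality x^s \<ge> 1 + s (x - 1), obtained from Young's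
      inequality for x^s and 1 with the weights 1 / s and 1 - 1 / s.\<close>
    have "(x powr s) powr (1 / s) * 1 powr (1 - 1 / s) \<le> (1 / s) * x powr s + (1 - 1 / s) * 1"
      by (rule Youngs_inequality_0) (use False x in auto)
    then have "x \<le> (1 / s) * x powr s + (1 - 1 / s)"
      using False x by (simp add: powr_powr)
    from mult_left_mono[OF this, of s] have "s * x \<le> x powr s + s - 1"
      using False by (simp add: distrib_left right_diff_distrib)
    then show ?thesis using False by (simp add: algebra_simps)
  qed
  have "(\<alpha> powr s - \<beta> powr s) * \<beta> = \<alpha> powr s * (1 - x powr s) * \<beta>"
    using x \<alpha> by (simp add: powr_mult algebra_simps)
  also have "\<dots> \<le> \<alpha> powr s * (max 1 s * (1 - x)) * \<beta>"
    by (intro mult_right_mono mult_left_mono key) (use assms in auto)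
  also have "\<dots> \<le> \<alpha> powr s * (max 1 s * (1 - x)) * \<alpha>"
    by (intro mult_left_mono) (use assms x in auto)
  finally show ?thesis using x by (simp add: algebra_simps)
qed (use assms in auto)

text \<open>Scalar core of the continuity of \<open>x \<mapsto> |x|\<^sup>q\<^sup>-\<^sup>2 x\<close>: \<open>\<alpha>, \<beta>, \<delta>, \<kappa>\<close> stand for
  \<open>|x|, |y|, |x - y|, |z|\<close> and \<open>F, G\<close> for \<open>x \<bullet> z, y \<bullet> z\<close>.\<close>

lemma power_map_diff_scalar_le:
  fixes q \<alpha> \<beta> \<delta> \<kappa> F G :: real
  defines "pm \<equiv> min q 2"
  assumes q: "1 < q" and nonneg: "0 \<le> \<beta>" "0 \<le> \<delta>" "0 \<le> \<kappa>" and le: "\<beta> \<le> \<alpha>"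
    and tri: "\<alpha> - \<beta> \<le> \<delta>"
    and CS: "\<bar>F - G\<bar> \<le> \<delta> * \<kappa>" "\<bar>F\<bar> \<le> \<alpha> * \<kappa>" "\<bar>G\<bar> \<le> \<beta> * \<kappa>"
  shows "\<bar>\<alpha> powr (q - 2) * F - \<beta> powr (q - 2) * G\<bar>
    \<le> (1 + max 1 (q - 2)) * rpow (\<alpha> powr q + \<beta> powr q) ((q - pm) / q) * \<delta> powr (pm - 1) * \<kappa>"
proof -
  define s where "s = q - 2"
  have \<alpha>: "0 \<le> \<alpha>" using nonneg le by linarith
  have pw: "x powr s * x = x powr (q - 1)" if "0 \<le> x" for x :: real
    using that powr_mult_base[of x s] by (simp add: s_def mult.commute)
  \<comment> \<open>The larger length \<alpha> weights the difference F - G, and the change of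
    weight is charged to the shorter vector. This leaves a factor \<beta>, which compensates the
    singularity of \<beta>^s at 0 when s < 0.\<close>
  have split: "\<bar>\<alpha> powr s * F - \<beta> powr s * G\<bar> \<le> (\<alpha> powr s * \<delta> + \<bar>\<alpha> powr s - \<beta> powr s\<bar> * \<beta>) * \<kappa>"
  proof -
    have "\<alpha> powr s * F - \<beta> powr s * G = \<alpha> powr s * (F - G) + (\<alpha> powr s - \<beta> powr s) * G"
      by (simp add: algebra_simps)
    then have "\<bar>\<alpha> powr s * F - \<beta> powr s * G\<bar> \<le> \<alpha> powr s * \<bar>F - G\<bar> + \<bar>\<alpha> powr s - \<beta> powr s\<bar> * \<bar>G\<bar>"
      using abs_triangle_ineq[of "\<alpha> powr s * (F - G)" "(\<alpha> powr s - \<beta> powr s) * G"]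
      by (simp add: abs_mult)
    also have "\<dots> \<le> \<alpha> powr s * (\<delta> * \<kappa>) + \<bar>\<alpha> powr s - \<beta> powr s\<bar> * (\<beta> * \<kappa>)"
      by (intro add_mono mult_left_mono CS) auto
    finally show ?thesis by (simp add: algebra_simps)
  qed
  show ?thesis
  proof (cases "q \<le> 2")
    case True
    then have s: "s \<le> 0" "s > -1" using q by (auto simp: s_def)
    have "\<bar>\<alpha> powr s * F - \<beta> powr s * G\<bar> \<le> 2 * \<delta> powr (q - 1) * \<kappa>"
    \<comment> \<open>For \<delta> \<le> \<alpha> the exponent s \<le> 0 gives \<alpha>^s \<le>
      \<delta>^s. Otherwise \<beta> \<le> \<alpha> < \<delta>, and each of the two terms is bounded
      by itself without cancellation. Both cases give the constant 2.\<close>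
    proof (cases "\<delta> \<le> \<alpha>")
      case True
      have 1: "\<alpha> powr s * \<delta> \<le> \<delta> powr (q - 1)"
      proof (cases "\<delta> = 0")
        case False
        have "\<alpha> powr s * \<delta> \<le> \<delta> powr s * \<delta>"
          by (intro mult_right_mono powr_mono2') (use False True s nonneg in auto)
        then show ?thesis using pw nonneg by simp
      qed auto
      \<comment> \<open>Multiplying by \<beta> turns the singular powers into t^(q - 1), which is
        increasing because q > 1.\<close>
      have 2: "\<bar>\<alpha> powr s - \<beta> powr s\<bar> * \<beta> \<le> \<alpha> powr s * \<delta>"
      proof (cases "\<beta> = 0")
        case False
        have "\<alpha> powr s \<le> \<beta> powr s"
          by (intro powr_mono2') (use False s nonneg le in auto)
        then have "\<bar>\<alpha> powr s - \<beta> powr s\<bar> * \<beta> = \<beta> powr (q - 1) - \<alpha> powr s * \<beta>"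
          using pw[of \<beta>] nonneg by (simp add: algebra_simps)
        also have "\<dots> \<le> \<alpha> powr (q - 1) - \<alpha> powr s * \<beta>"
          using le nonneg q by (auto intro!: powr_mono2)
        also have "\<dots> = \<alpha> powr s * (\<alpha> - \<beta>)" using pw[of \<alpha>] \<alpha> by (simp add: algebra_simps)
        also have "\<dots> \<le> \<alpha> powr s * \<delta>" using tri by (intro mult_left_mono) auto
        finally show ?thesis .
      qed (use nonneg in auto)
      from 1 2 have "(\<alpha> powr s * \<delta> + \<bar>\<alpha> powr s - \<beta> powr s\<bar> * \<beta>) * \<kappa> \<le> (2 * \<delta> powr (q - 1)) * \<kappa>"
        by (intro mult_right_mono) (use nonneg in auto)
      with split show ?thesis by linarith
    next
      case False
      have bd: "\<bar>x powr s * H\<bar> \<le> \<delta> powr (q - 1) * \<kappa>" if "0 \<le> x" "x \<le> \<delta>" "\<bar>H\<bar> \<le> x * \<kappa>" for x H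
      proof -
        have "\<bar>x powr s * H\<bar> \<le> x powr s * (x * \<kappa>)" using that by (simp add: abs_mult mult_left_mono)
        also have "\<dots> = x powr (q - 1) * \<kappa>" using pw[OF that(1)] by (simp flip: mult.assoc)
        also have "\<dots> \<le> \<delta> powr (q - 1) * \<kappa>"
          using that q nonneg by (intro mult_right_mono powr_mono2) auto
        finally show ?thesis .
      qed
      have "\<bar>\<alpha> powr s * F\<bar> \<le> \<delta> powr (q - 1) * \<kappa>" "\<bar>\<beta> powr s * G\<bar> \<le> \<delta> powr (q - 1) * \<kappa>"
        by (rule bd; use False \<alpha> le nonneg CS in auto)+
      then show ?thesis by linarith
    qed
    \<comment> \<open>For q \<le> 2, \<open>pm\<close> is q, so the growth factor has exponent 0 and
      the constant is 1 + 1.\<close>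
    then show ?thesis using True q by (simp add: pm_def s_def rpow_def max_def)
  next
    case False
    then have s: "s > 0" by (simp add: s_def)
    have "\<beta> powr s \<le> \<alpha> powr s" using s nonneg le by (intro powr_mono2) auto
    then have "\<bar>\<alpha> powr s - \<beta> powr s\<bar> * \<beta> \<le> max 1 s * \<alpha> powr s * (\<alpha> - \<beta>)"
      using powr_diff_mult_le[OF s nonneg(1) le] by simp
    also have "\<dots> \<le> max 1 s * \<alpha> powr s * \<delta>" using tri by (intro mult_left_mono) auto
    finally have "(\<alpha> powr s * \<delta> + \<bar>\<alpha> powr s - \<beta> powr s\<bar> * \<beta>) * \<kappa> \<le> ((1 + max 1 s) * \<alpha> powr s * \<delta>) * \<kappa>"
      by (intro mult_right_mono) (use nonneg in \<open>auto simp: algebra_simps\<close>)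
    also have "\<dots> \<le> ((1 + max 1 s) * (\<alpha> powr q + \<beta> powr q) powr (s / q) * \<delta>) * \<kappa>"
    proof -
      have "\<alpha> powr s = (\<alpha> powr q) powr (s / q)" using q by (simp add: powr_powr)
      also have "\<dots> \<le> (\<alpha> powr q + \<beta> powr q) powr (s / q)"
        using s q by (intro powr_mono2) auto
      finally show ?thesis
        using nonneg by (intro mult_right_mono mult_left_mono) auto
    qed
    finally show ?thesis using split False s nonneg by (simp add: pm_def s_def rpow_def)
  qed
qed

text \<open>Both sides are symmetric in f and g, so the longer of the two may be called f; this
  supplies the ordering that the scalar version assumes.\<close>

lemma power_map_diff_le:
  fixes f g h :: "'i \<Rightarrow> real" and q :: real
  defines "pm \<equiv> min q 2"
  assumes q: "1 < q"
  shows "\<bar>L2_set f I powr (q - 2) * (\<Sum>i\<in>I. f i * h i) - L2_set g I powr (q - 2) * (\<Sum>i\<in>I. g i * h i)\<bar>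
    \<le> (1 + max 1 (q - 2)) * rpow (L2_set f I powr q + L2_set g I powr q) ((q - pm) / q)
        * L2_set (\<lambda>i. f i - g i) I powr (pm - 1) * L2_set h I"
proof -
  have CS: "\<bar>\<Sum>i\<in>I. u i * h i\<bar> \<le> L2_set u I * L2_set h I" for u :: "'i \<Rightarrow> real"
    by (rule order_trans[OF sum_abs]) (simp add: abs_mult L2_set_mult_ineq)
  have tri: "L2_set u I - L2_set v I \<le> L2_set (\<lambda>i. u i - v i) I" for u v :: "'i \<Rightarrow> real"
    using L2_set_triangle_ineq[of "\<lambda>i. u i - v i" v I] by simp
  have main: "\<bar>L2_set f I powr (q - 2) * (\<Sum>i\<in>I. f i * h i) - L2_set g I powr (q - 2) * (\<Sum>i\<in>I. g i * h i)\<bar>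
    \<le> (1 + max 1 (q - 2)) * rpow (L2_set f I powr q + L2_set g I powr q) ((q - pm) / q)
        * L2_set (\<lambda>i. f i - g i) I powr (pm - 1) * L2_set h I"
    if "L2_set g I \<le> L2_set f I" for f g
    unfolding pm_def
  proof (rule power_map_diff_scalar_le[OF q _ _ _ that tri _ CS CS])
    show "\<bar>(\<Sum>i\<in>I. f i * h i) - (\<Sum>i\<in>I. g i * h i)\<bar> \<le> L2_set (\<lambda>i. f i - g i) I * L2_set h I"
      using CS[of "\<lambda>i. f i - g i"] by (simp add: left_diff_distrib sum_subtractf)
  qed auto
  have "L2_set (\<lambda>i. g i - f i) I = L2_set (\<lambda>i. f i - g i) I"
    by (simp add: L2_set_def power2_commute)
  then show ?thesis
    using main[of g f] main[of f g] linear[of "L2_set g I" "L2_set f I"]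
    by (auto simp: abs_minus_commute add.commute)
qed

section \<open>Continuously differentiable functions and cutoffs\<close>

text \<open>Like \<open>C1c\<close> but without a condition on the support: these functions, for
  instance polynomials, serve as multipliers of test functions.\<close>

definition C1 :: "(pt \<Rightarrow> real) set" where
  "C1 = {f. (\<forall>x. \<exists>D. GDERIV f x :> D) \<and> continuous_on UNIV (grad f)}"

lemma grad_eqI: "GDERIV f x :> D \<Longrightarrow> grad f x = D"
  unfolding grad_def gderiv_def
proof (rule the_equality)
  fix D' assume "(f has_derivative (\<lambda>h. h \<bullet> D)) (at x)" "(f has_derivative (\<lambda>h. h \<bullet> D')) (at x)"
  then have "(\<lambda>h. h \<bullet> D) = (\<lambda>h. h \<bullet> D')" by (rule has_derivative_unique)
  then have "(D' - D) \<bullet> D = (D' - D) \<bullet> D'" by metis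
  then have "(D' - D) \<bullet> (D' - D) = 0" by (simp add: inner_diff_right)
  then show "D' = D" by simp
qed

lemma C1I:
  assumes "\<And>x. GDERIV f x :> g x" "continuous_on UNIV g"
  shows "f \<in> C1" "grad f = g"
proof -
  show "grad f = g" using grad_eqI[OF assms(1)] by auto
  then show "f \<in> C1" using assms by (auto simp: C1_def)
qed

lemma C1D:
  assumes "f \<in> C1"
  shows "GDERIV f x :> grad f x" "continuous_on UNIV (grad f)" "continuous_on UNIV f"
proof -
  show D: "GDERIV f x :> grad f x" for x
    using assms grad_eqI[of f x] by (auto simp: C1_def)
  show "continuous_on UNIV (grad f)" using assms by (simp add: C1_def)
  show "continuous_on UNIV f"
    using D by (intro has_derivative_continuous_on) (auto simp: gderiv_def)
qed

lemma C1_const [intro, simp]: "(\<lambda>x. c) \<in> C1"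
  by (rule C1I(1)[where g = "\<lambda>x. 0"]) (auto intro: GDERIV_const)

lemma C1_inner: "(\<lambda>x. (x - c) \<bullet> a) \<in> C1"
  by (rule C1I(1)[where g = "\<lambda>x. a"])
    (auto simp: gderiv_def intro!: derivative_eq_intros)

lemma C1_component: "(\<lambda>x. x $ i) \<in> C1"
  using C1_inner[of 0 "axis i 1"] by (simp add: inner_axis)

lemma C1_add: "f \<in> C1 \<Longrightarrow> g \<in> C1 \<Longrightarrow> (\<lambda>x. f x + g x) \<in> C1"
  by (rule C1I(1)[where g = "\<lambda>x. grad f x + grad g x"])
    (auto intro!: GDERIV_add C1D continuous_intros)

lemma C1_mult: 
  assumes "f \<in> C1" "g \<in> C1" shows "(\<lambda>x. f x * g x) \<in> C1"
    and grad_mult: "grad (\<lambda>x. f x * g x) = (\<lambda>x. f x *\<^sub>R grad g x + g x *\<^sub>R grad f x)"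
  by (rule C1I[where g = "\<lambda>x. f x *\<^sub>R grad g x + g x *\<^sub>R grad f x"];
    use assms in \<open>auto intro!: GDERIV_mult C1D continuous_intros\<close>)+

lemma C1_sum: "(\<And>i. i \<in> I \<Longrightarrow> f i \<in> C1) \<Longrightarrow> (\<lambda>x. \<Sum>i\<in>I. f i x) \<in> C1"
  by (induction I rule: infinite_finite_induct) (auto intro: C1_add)

lemma C1_prod: "(\<And>i. i \<in> I \<Longrightarrow> f i \<in> C1) \<Longrightarrow> (\<lambda>x. \<Prod>i\<in>I. f i x) \<in> C1"
  by (induction I rule: infinite_finite_induct) (auto intro: C1_mult)

lemma C1_power: "f \<in> C1 \<Longrightarrow> (\<lambda>x. f x ^ n) \<in> C1"
  by (induction n) (auto intro: C1_mult)

lemma C1_diff: "f \<in> C1 \<Longrightarrow> g \<in> C1 \<Longrightarrow> (\<lambda>x. f x - g x) \<in> C1"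
  using C1_add[OF _ C1_mult(1)[of "\<lambda>x. -1" g], of f] by simp

lemma C1_compose:
  assumes f: "f \<in> C1" and h: "\<And>y. (h has_real_derivative h' y) (at y)" "continuous_on UNIV h'"
  shows "(\<lambda>x. h (f x)) \<in> C1"
proof (rule C1I(1)[where g = "\<lambda>x. h' (f x) *\<^sub>R grad f x"])
  show "GDERIV (\<lambda>x. h (f x)) x :> h' (f x) *\<^sub>R grad f x" for x
    by (rule GDERIV_DERIV_compose[OF C1D(1)[OF f] h(1)])
  have "continuous_on UNIV (\<lambda>x. h' (f x))"
    by (rule continuous_on_compose2[OF h(2)]) (auto intro: C1D f)
  then show "continuous_on UNIV (\<lambda>x. h' (f x) *\<^sub>R grad f x)"
    by (intro continuous_intros C1D(2) f)
qed

text \<open>The source of all cutoffs: this function is zero on a half line and continuously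
  differentiable everywhere, and composed with a quadratic it gives a bump supported in a
  ball.\<close>

lemma has_real_derivative_max_0_power2:
  "((\<lambda>y. (max 0 y)\<^sup>2) has_real_derivative 2 * max 0 y) (at (y::real))"
proof -
  consider "y < 0" | "y = 0" | "y > 0" by linarith
  then show ?thesis
  proof cases
    case 1
    have "((\<lambda>y. 0) has_real_derivative 0) (at y)" by simp
    then have "((\<lambda>y. (max 0 y)\<^sup>2) has_real_derivative 0) (at y)"
      by (rule has_field_derivative_transform_within_open[where S = "{..<0}"]) (use 1 in auto)
    with 1 show ?thesis by simp
  next
    case 2
    have "(\<lambda>h::real. (max 0 h)\<^sup>2 / h) \<midarrow>0\<rightarrow> 0"
    proof (rule Lim_null_comparison[where g = "\<lambda>h. \<bar>h\<bar>"])
      show "\<forall>\<^sub>F h in at 0. norm ((max 0 h)\<^sup>2 / h) \<le> \<bar>h :: real\<bar>"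
        by (intro always_eventually) (auto simp: max_def power2_eq_square)
      show "((\<lambda>h. \<bar>h :: real\<bar>) \<longlongrightarrow> 0) (at 0)"
        using tendsto_rabs[OF tendsto_ident_at[of "0::real" UNIV]] by simp
    qed
    then show ?thesis using 2 by (simp add: DERIV_def)
  next
    case 3
    have "((\<lambda>y. y\<^sup>2) has_real_derivative 2 * y) (at y)"
      by (auto intro!: derivative_eq_intros)
    then have "((\<lambda>y. (max 0 y)\<^sup>2) has_real_derivative 2 * y) (at y)"
      by (rule has_field_derivative_transform_within_open[where S = "{0<..}"]) (use 3 in auto)
    with 3 show ?thesis by simp
  qed
qed

lemma C1_max_0_power2: "f \<in> C1 \<Longrightarrow> (\<lambda>x. (max 0 (f x))\<^sup>2) \<in> C1"
  by (rule C1_compose[OF _ has_real_derivative_max_0_power2]) (auto intro!: continuous_intros)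

section \<open>Compactly supported functions and cutoffs\<close>

lemma C1c_iff: "\<phi> \<in> C1c U \<longleftrightarrow>
    \<phi> \<in> C1 \<and> compact (closure {x. \<phi> x \<noteq> 0}) \<and> closure {x. \<phi> x \<noteq> 0} \<subseteq> U"
  by (auto simp: C1c_def C1_def)

lemma C1cI:
  assumes "\<phi> \<in> C1" "compact K" "K \<subseteq> U" "\<And>x. x \<notin> K \<Longrightarrow> \<phi> x = 0"
  shows "\<phi> \<in> C1c U"
proof -
  have "closure {x. \<phi> x \<noteq> 0} \<subseteq> K"
    using assms by (intro closure_minimal compact_imp_closed) auto
  then show ?thesis
    using assms closed_Int_compact[OF closed_closure, of K "{x. \<phi> x \<noteq> 0}"]
    by (auto simp: C1c_iff Int_absorb2)
qed

lemma C1c_mult: "\<phi> \<in> C1c U \<Longrightarrow> f \<in> C1 \<Longrightarrow> (\<lambda>x. \<phi> x * f x) \<in> C1c U"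
  using closure_subset[of "{x. \<phi> x \<noteq> 0}"]
  by (intro C1cI[where K = "closure {x. \<phi> x \<noteq> 0}"]) (auto simp: C1c_iff intro: C1_mult)

text \<open>U is a countable union of balls whose closures lie in U. Each ball carries a bump that
  is positive on it and zero outside its closure. The n-th cutoff involves the first n bumps only,
  so its support lies in a finite union of closed balls.\<close>

lemma C1c_cutoff:
  assumes "open U"
  obtains \<psi> :: "nat \<Rightarrow> pt \<Rightarrow> real" where "\<And>n. \<psi> n \<in> C1c U"
    "\<And>n x. 0 \<le> \<psi> n x" "\<And>n x. \<psi> n x \<le> 1" "\<And>x. x \<in> U \<Longrightarrow> (\<lambda>n. \<psi> n x) \<longlonglongrightarrow> 1"
proof (cases "U = {}")
  case True
  show ?thesis by (rule that[of "\<lambda>_ _. 0"]) (auto simp: True C1c_iff)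
next
  case False
  define \<F> where "\<F> = {ball c r | c r. 0 < r \<and> cball c r \<subseteq> U}"
  have "U = \<Union>\<F>"
  proof
    show "U \<subseteq> \<Union>\<F>"
    proof
      fix x assume "x \<in> U"
      with assms obtain r where "r > 0" "cball x r \<subseteq> U" by (meson open_contains_cball)
      then show "x \<in> \<Union>\<F>" by (auto simp: \<F>_def intro!: exI[of _ "ball x r"])
    qed
    show "\<Union>\<F> \<subseteq> U" using ball_subset_cball by (fastforce simp: \<F>_def)
  qed
  have "open S" if "S \<in> \<F>" for S using that by (auto simp: \<F>_def)
  from Lindelof[OF this] obtain \<F>' where \<F>': "\<F>' \<subseteq> \<F>" "countable \<F>'" "\<Union>\<F>' = U"
    unfolding \<open>U = \<Union>\<F>\<close> by metis
  then have ne: "\<F>' \<noteq> {}" using False by auto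
  have "\<exists>c r. from_nat_into \<F>' n = ball c r \<and> 0 < r \<and> cball c r \<subseteq> U" for n
    using subsetD[OF \<F>'(1) from_nat_into[OF ne, of n]] unfolding \<F>_def by blast
  then obtain c r where cr: "\<And>n. from_nat_into \<F>' n = ball (c n) (r n)" "\<And>n. 0 < r n"
      "\<And>n. cball (c n) (r n) \<subseteq> U"
    by metis
  define b where "b n x = (max 0 (1 - (\<Sum>i\<in>UNIV. ((x - c n) $ i)\<^sup>2) / (r n)\<^sup>2))\<^sup>2" for n x
  have sq: "(\<Sum>i\<in>UNIV. (y $ i)\<^sup>2) = (norm y)\<^sup>2" for y :: pt
    by (simp add: norm_vec_def L2_set_def sum_nonneg)
  have b_C1: "b n \<in> C1" for n
  proof -
    have "(\<lambda>x. 1 - (\<Sum>i\<in>UNIV. (x $ i - c n $ i)\<^sup>2) * (1 / (r n)\<^sup>2)) \<in> C1"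
      by (intro C1_diff C1_mult C1_sum C1_power C1_const C1_component)
    then show ?thesis unfolding b_def using C1_max_0_power2 by auto
  qed
  have b01: "0 \<le> b n x" "b n x \<le> 1" for n x
    by (auto simp: b_def sum_nonneg intro!: power_le_one)
  have b_out: "b n x = 0" if "x \<notin> cball (c n) (r n)" for n x
  proof -
    have "(r n)\<^sup>2 \<le> (norm (x - c n))\<^sup>2"
      using that cr(2)[of n] by (intro power_mono) (auto simp: dist_norm norm_minus_commute)
    then have "1 - (norm (x - c n))\<^sup>2 / (r n)\<^sup>2 \<le> 0" using cr(2)[of n] by simp
    then show ?thesis unfolding b_def sq by simp
  qed
  have b_in: "0 < b n x" if "x \<in> ball (c n) (r n)" for n x
  proof -
    have "(norm (x - c n))\<^sup>2 < (r n)\<^sup>2"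
      using that cr(2)[of n] by (intro power_strict_mono) (auto simp: dist_norm norm_minus_commute)
    then have "1 - (norm (x - c n))\<^sup>2 / (r n)\<^sup>2 > 0" using cr(2)[of n] by simp
    then show ?thesis unfolding b_def sq by (intro zero_less_power) simp
  qed
  \<comment> \<open>The product drops below 1 as soon as one bump is positive, but it need not tend
    to 0; the power n forces this. At a point of the k-th ball the power is dominated by (1 -
    b_k)^n.\<close>
  define \<psi> where "\<psi> n x = 1 - (\<Prod>i<n. 1 - b i x) ^ n" for n x
  have pr01: "0 \<le> (\<Prod>i<n. 1 - b i x)" "(\<Prod>i<n. 1 - b i x) \<le> 1" for n x
    using b01 by (auto intro!: prod_nonneg prod_le_1)
  show ?thesis
  proof (rule that[of \<psi>])
    show "\<psi> n \<in> C1c U" for n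
    proof (rule C1cI)
      show "\<psi> n \<in> C1"
        unfolding \<psi>_def using b_C1 by (intro C1_diff C1_power C1_prod C1_const) auto
      show "compact (\<Union>i<n. cball (c i) (r i))" by auto
      show "(\<Union>i<n. cball (c i) (r i)) \<subseteq> U" using cr(3) by blast
      show "\<psi> n x = 0" if "x \<notin> (\<Union>i<n. cball (c i) (r i))" for x
        using that b_out by (auto simp: \<psi>_def)
    qed
    show "0 \<le> \<psi> n x" "\<psi> n x \<le> 1" for n x
      using pr01[where n=n and x=x] by (auto simp: \<psi>_def power_le_one)
    show "(\<lambda>n. \<psi> n x) \<longlonglongrightarrow> 1" if "x \<in> U" for x
    proof -
      obtain B where "B \<in> \<F>'" "x \<in> B" using \<open>x \<in> U\<close> \<F>'(3) by blast
      then obtain k where k: "x \<in> ball (c k) (r k)"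
        using from_nat_into_surj[OF \<F>'(2)] cr(1) by metis
      have "(\<lambda>n. (\<Prod>i<n. 1 - b i x) ^ n) \<longlonglongrightarrow> 0"
      proof (rule real_tendsto_sandwich)
        show "\<forall>\<^sub>F n in sequentially. 0 \<le> (\<Prod>i<n. 1 - b i x) ^ n" using pr01 by simp
        show "\<forall>\<^sub>F n in sequentially. (\<Prod>i<n. 1 - b i x) ^ n \<le> (1 - b k x) ^ n"
        proof (rule eventually_mono[OF eventually_gt_at_top[of k]])
          fix n assume "k < n"
          then have "(\<Prod>i<n. 1 - b i x) = (1 - b k x) * (\<Prod>i\<in>{..<n} - {k}. 1 - b i x)"
            by (intro prod.remove) auto
          also have "\<dots> \<le> (1 - b k x) * 1"
            using b01 by (intro mult_left_mono prod_le_1) auto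
          finally show "(\<Prod>i<n. 1 - b i x) ^ n \<le> (1 - b k x) ^ n"
            using pr01 by (intro power_mono) auto
        qed
        show "(\<lambda>n. (1 - b k x) ^ n) \<longlonglongrightarrow> 0"
          using b01[of k x] b_in[OF k] by (intro LIMSEQ_realpow_zero) auto
      qed auto
      then show ?thesis
        unfolding \<psi>_def using tendsto_diff[OF tendsto_const[of 1]] by fastforce
    qed
  qed
qed

section \<open>Square integrable functions and weak divergences\<close>

text \<open>Dominated convergence with bound |f|; this is how cutoffs are removed from integrals
  over an element.\<close>

lemma integral_mult_tendsto:
  fixes f :: "'a \<Rightarrow> real"
  assumes "integrable M f" "\<And>n. \<eta> n \<in> borel_measurable M" "\<And>n x. \<bar>\<eta> n x\<bar> \<le> 1"
    and "AE x in M. (\<lambda>n. \<eta> n x) \<longlonglongrightarrow> 1"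
  shows "(\<lambda>n. \<integral>x. f x * \<eta> n x \<partial>M) \<longlonglongrightarrow> (\<integral>x. f x \<partial>M)"
proof (rule integral_dominated_convergence[where w = "\<lambda>x. norm (f x)"])
  show "AE x in M. (\<lambda>n. f x * \<eta> n x) \<longlonglongrightarrow> f x"
    using assms(4)
  proof eventually_elim
    case (elim x)
    from tendsto_mult[OF tendsto_const[of "f x"] elim] show ?case by simp
  qed
  show "AE x in M. norm (f x * \<eta> n x) \<le> norm (f x)" for n
    using assms(3) by (auto simp: abs_mult mult_left_le)
qed (use assms in auto)

lemma continuous_measurable_lebesgue:
  "continuous_on UNIV f \<Longrightarrow> f \<in> borel_measurable lebesgue"
  by (intro measurable_completion) (simp add: borel_measurable_continuous_onI)

lemma set_integrable_mult_continuous: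
  assumes "set_integrable lebesgue (edge_interval e) g" "continuous_on UNIV h"
  shows "set_integrable lebesgue (edge_interval e) (\<lambda>s. g s * h s :: real)"
proof -
  have "compact (h ` edge_interval e)"
    using assms(2) unfolding edge_interval_def
    by (intro compact_continuous_image) (auto intro: continuous_on_subset)
  from compact_imp_bounded[OF this] obtain B where B: "\<And>s. s \<in> edge_interval e \<Longrightarrow> \<bar>h s\<bar> \<le> B"
    by (auto simp: bounded_iff)
  have [measurable]: "h \<in> borel_measurable lebesgue"
    by (rule continuous_measurable_lebesgue[OF assms(2)])
  have "integrable lebesgue (\<lambda>s. h s * (indicator (edge_interval e) s *\<^sub>R g s))"
  proof (rule Bochner_Integration.integrable_bound)
    show "integrable lebesgue (\<lambda>s. B * (indicator (edge_interval e) s *\<^sub>R g s))"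
      using assms(1) by (simp add: set_integrable_def)
    show "AE s in lebesgue. norm (h s * (indicator (edge_interval e) s *\<^sub>R g s))
        \<le> norm (B * (indicator (edge_interval e) s *\<^sub>R g s))"
    proof (rule AE_I2)
      fix s
      show "norm (h s * (indicator (edge_interval e) s *\<^sub>R g s))
        \<le> norm (B * (indicator (edge_interval e) s *\<^sub>R g s))"
        using order_trans[OF B[of s] abs_ge_self]
        by (auto simp: indicator_def abs_mult intro!: mult_right_mono)
    qed
    show "(\<lambda>s. h s * (indicator (edge_interval e) s *\<^sub>R g s)) \<in> borel_measurable lebesgue"
      using assms(1) unfolding set_integrable_def by measurable
  qed
  then show ?thesis by (simp add: set_integrable_def mult_ac)
qed

section \<open>Integration over a bounded open set\<close>

locale bounded_open_set =
  fixes E :: "pt set"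
  assumes open_E: "open E" and bounded_E: "bounded E"
begin

lemma E_sets [measurable, simp]: "E \<in> sets lebesgue"
  using lmeasurable_open[OF bounded_E open_E] by (rule fmeasurableD)

lemma set_lint_eq:
  fixes f :: "pt \<Rightarrow> 'b::euclidean_space"
  shows "set_lebesgue_integral lebesgue E f = integral\<^sup>L (lebesgue_on E) f"
  by (simp add: set_lebesgue_integral_def integral_restrict_space)

lemma set_integrable_iff: 
  fixes f :: "pt \<Rightarrow> 'b::euclidean_space"
  shows "set_integrable lebesgue E f \<longleftrightarrow> integrable (lebesgue_on E) f"
  by (simp add: set_integrable_def integrable_restrict_space)

lemma square_integrable_iff:
  "square_integrable E f \<longleftrightarrow> f \<in> borel_measurable (lebesgue_on E) \<and>
     integrable (lebesgue_on E) (\<lambda>x. (norm (f x))\<^sup>2)"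
  unfolding square_integrable_def set_integrable_iff set_borel_measurable_def
  by (subst borel_measurable_restrict_space_iff) (auto simp: mult.commute)

lemma finite_measure_E: "finite_measure (lebesgue_on E)"
  by (rule finite_measure_lebesgue_on) (simp add: bounded_E lmeasurable_open open_E)

lemma continuous_measurable:
  assumes "continuous_on UNIV f" shows "f \<in> borel_measurable (lebesgue_on E)"
  by (intro continuous_imp_measurable_on_sets_lebesgue continuous_on_subset[OF assms]) auto

lemma continuous_bound:
  fixes f :: "pt \<Rightarrow> 'b::euclidean_space"
  assumes "continuous_on UNIV f"
  obtains B where "\<And>x. x \<in> E \<Longrightarrow> norm (f x) \<le> B"
proof -
  have "compact (f ` closure E)"
    using assms bounded_E by (intro compact_continuous_image) (auto intro: continuous_on_subset)
  from compact_imp_bounded[OF this] obtain B where "\<forall>y\<in>f ` closure E. norm y \<le> B"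
    by (auto simp: bounded_iff)
  then show ?thesis using closure_subset[of E] by (intro that[of B]) blast
qed

lemma integrable_bounded_measurable:
  fixes f :: "pt \<Rightarrow> 'b::euclidean_space"
  assumes "f \<in> borel_measurable (lebesgue_on E)" "\<And>x. x \<in> E \<Longrightarrow> norm (f x) \<le> B"
  shows "integrable (lebesgue_on E) f"
proof -
  interpret finite_measure "lebesgue_on E" by (rule finite_measure_E)
  show ?thesis
    by (rule integrable_const_bound[where B = B]) (use assms in \<open>auto intro!: AE_I2\<close>)
qed

lemma integrable_continuous:
  fixes f :: "pt \<Rightarrow> 'b::euclidean_space"
  assumes "continuous_on UNIV f" shows "integrable (lebesgue_on E) f"
proof -
  obtain B where "\<And>x. x \<in> E \<Longrightarrow> norm (f x) \<le> B" using continuous_bound[OF assms] by metis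
  then show ?thesis by (intro integrable_bounded_measurable continuous_measurable assms)
qed

lemma square_integrable_continuous:
  fixes f :: "pt \<Rightarrow> 'b::euclidean_space"
  assumes "continuous_on UNIV f" shows "square_integrable E f"
  unfolding square_integrable_iff
  by (intro conjI continuous_measurable integrable_continuous continuous_intros assms)

lemma square_integrable_inner:
  fixes f g :: "pt \<Rightarrow> 'b::euclidean_space"
  assumes "square_integrable E f" "square_integrable E g"
  shows "integrable (lebesgue_on E) (\<lambda>x. f x \<bullet> g x)"
proof (rule Bochner_Integration.integrable_bound)
  show "integrable (lebesgue_on E) (\<lambda>x. (norm (f x))\<^sup>2 + (norm (g x))\<^sup>2)"
    using assms by (auto simp: square_integrable_iff)
  have "\<bar>f x \<bullet> g x\<bar> \<le> (norm (f x))\<^sup>2 + (norm (g x))\<^sup>2" for x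
  proof -
    have "\<bar>f x \<bullet> g x\<bar> \<le> norm (f x) * norm (g x)" by (rule Cauchy_Schwarz_ineq2)
    also have "\<dots> \<le> (norm (f x))\<^sup>2 + (norm (g x))\<^sup>2"
      using sum_squares_bound[of "norm (f x)" "norm (g x)"] mult_nonneg_nonneg[OF norm_ge_zero[of "f x"] norm_ge_zero[of "g x"]]
      by linarith
    finally show ?thesis .
  qed
  then show "AE x in lebesgue_on E. norm (f x \<bullet> g x) \<le> norm ((norm (f x))\<^sup>2 + (norm (g x))\<^sup>2)"
    by auto
qed (use assms in \<open>auto simp: square_integrable_iff\<close>)

lemma square_integrable_mult:
  fixes f g :: "pt \<Rightarrow> real"
  assumes "square_integrable E f" "square_integrable E g"
  shows "integrable (lebesgue_on E) (\<lambda>x. f x * g x)"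
  using square_integrable_inner[OF assms] by simp

lemma square_integrable_diff:
  fixes f g :: "pt \<Rightarrow> 'b::euclidean_space"
  assumes "square_integrable E f" "square_integrable E g"
  shows "square_integrable E (\<lambda>x. f x - g x)"
proof -
  have "(norm (f x - g x))\<^sup>2 = (norm (f x))\<^sup>2 + (norm (g x))\<^sup>2 - 2 * (f x \<bullet> g x)" for x
    by (simp add: power2_norm_eq_inner inner_diff_left inner_diff_right inner_commute)
  then show ?thesis
    using assms square_integrable_inner[OF assms] by (auto simp: square_integrable_iff)
qed

lemma square_integrable_component:
  fixes f :: "pt \<Rightarrow> pt"
  assumes "square_integrable E f" shows "square_integrable E (\<lambda>x. f x $ i)"
proof -
  have [measurable]: "f \<in> borel_measurable (lebesgue_on E)" using assms by (simp add: square_integrable_iff)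
  have m: "(\<lambda>x. f x $ i) \<in> borel_measurable (lebesgue_on E)"
    using borel_measurable_inner[of f "lebesgue_on E" "\<lambda>_. axis i 1"] by (simp add: inner_axis)
  moreover have "integrable (lebesgue_on E) (\<lambda>x. (norm (f x $ i))\<^sup>2)"
  proof (rule Bochner_Integration.integrable_bound)
    show "integrable (lebesgue_on E) (\<lambda>x. (norm (f x))\<^sup>2)" using assms by (simp add: square_integrable_iff)
    show "AE x in lebesgue_on E. norm ((norm (f x $ i))\<^sup>2) \<le> norm ((norm (f x))\<^sup>2)"
    proof (rule AE_I2)
      fix x
      have "\<bar>f x $ i\<bar> \<le> norm (f x)" by (rule component_le_norm_cart)
      then have "\<bar>f x $ i\<bar>\<^sup>2 \<le> (norm (f x))\<^sup>2" by (rule power_mono) simp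
      then show "norm ((norm (f x $ i))\<^sup>2) \<le> norm ((norm (f x))\<^sup>2)" by simp
    qed
  qed (use m in measurable)
  ultimately show ?thesis by (simp add: square_integrable_iff)
qed

text \<open>Weak divergences are only determined by test functions with support in \<open>E\<close>; cutoffs extend
  this to test functions that do not vanish on the boundary.\<close>

lemma weak_div_unique_tested:
  assumes d: "weak_div E v d\<^sub>1" "weak_div E v d\<^sub>2" and \<phi>: "\<phi> \<in> C1"
  shows "(LINT x:E|lebesgue. d\<^sub>1 x * \<phi> x) = (LINT x:E|lebesgue. d\<^sub>2 x * \<phi> x)"
proof -
  obtain \<psi> :: "nat \<Rightarrow> pt \<Rightarrow> real" where \<psi>: "\<And>n. \<psi> n \<in> C1c E"
    "\<And>n x. 0 \<le> \<psi> n x" "\<And>n x. \<psi> n x \<le> 1" "\<And>x. x \<in> E \<Longrightarrow> (\<lambda>n. \<psi> n x) \<longlonglongrightarrow> 1"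
    using C1c_cutoff[OF open_E] by metis
  have lim: "(\<lambda>n. LINT x:E|lebesgue. d x * (\<psi> n x * \<phi> x)) \<longlonglongrightarrow> (LINT x:E|lebesgue. d x * \<phi> x)"
    if "weak_div E v d" for d
  proof -
    have "(\<lambda>n. \<integral>x. d x * \<phi> x * \<psi> n x \<partial>lebesgue_on E) \<longlonglongrightarrow> (\<integral>x. d x * \<phi> x \<partial>lebesgue_on E)"
    proof (rule integral_mult_tendsto)
      show "integrable (lebesgue_on E) (\<lambda>x. d x * \<phi> x)"
        using that square_integrable_continuous[OF C1D(3)[OF \<phi>]]
        by (intro square_integrable_mult) (simp_all add: weak_div_def)
      show "\<psi> n \<in> borel_measurable (lebesgue_on E)" for n
        using \<psi>(1) by (intro continuous_measurable C1D(3)) (simp add: C1c_iff)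
      show "AE x in lebesgue_on E. (\<lambda>n. \<psi> n x) \<longlonglongrightarrow> 1"
        using \<psi>(4) by (intro AE_I2) simp
      show "\<bar>\<psi> n x\<bar> \<le> 1" for n x using \<psi>(2,3)[of n x] by simp
    qed
    then show ?thesis by (simp add: set_lint_eq mult_ac)
  qed
  have eq: "(LINT x:E|lebesgue. d\<^sub>1 x * (\<psi> n x * \<phi> x)) = (LINT x:E|lebesgue. d\<^sub>2 x * (\<psi> n x * \<phi> x))" for n
  proof -
    have test: "(\<lambda>x. \<psi> n x * \<phi> x) \<in> C1c E" by (intro C1c_mult \<psi> \<phi>)
    have "(LINT x:E|lebesgue. v x \<bullet> grad (\<lambda>x. \<psi> n x * \<phi> x) x) = - (LINT x:E|lebesgue. d x * (\<psi> n x * \<phi> x))"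
      if "weak_div E v d" for d
      using that test unfolding weak_div_def by blast
    from this[OF d(1)] this[OF d(2)] show ?thesis by linarith
  qed
  show ?thesis
    by (rule LIMSEQ_unique[OF lim[OF d(1), unfolded eq] lim[OF d(2)]])
qed

lemma weak_div_divg: "weak_div E v d \<Longrightarrow> weak_div E v (divg E v)"
  unfolding divg_def by (rule someI[where P = "weak_div E v"])

lemma weak_div_diff:
  assumes "square_integrable E v" "square_integrable E w" "weak_div E v d" "weak_div E w d'"
  shows "weak_div E (\<lambda>x. v x - w x) (\<lambda>x. d x - d' x)"
  unfolding weak_div_def
proof (intro conjI ballI)
  show "square_integrable E (\<lambda>x. d x - d' x)"
    using assms by (intro square_integrable_diff) (auto simp: weak_div_def)
  fix \<phi> assume "\<phi> \<in> C1c E"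
  then have \<phi>: "\<phi> \<in> C1" and
    eq: "(LINT x:E|lebesgue. v x \<bullet> grad \<phi> x) = - (LINT x:E|lebesgue. d x * \<phi> x)"
        "(LINT x:E|lebesgue. w x \<bullet> grad \<phi> x) = - (LINT x:E|lebesgue. d' x * \<phi> x)"
    using assms by (auto simp: weak_div_def C1c_iff)
  have "square_integrable E \<phi>" "square_integrable E (grad \<phi>)"
    by (intro square_integrable_continuous C1D \<phi>)+
  then have "integrable (lebesgue_on E) (\<lambda>x. v x \<bullet> grad \<phi> x)" "integrable (lebesgue_on E) (\<lambda>x. w x \<bullet> grad \<phi> x)"
    "integrable (lebesgue_on E) (\<lambda>x. d x * \<phi> x)" "integrable (lebesgue_on E) (\<lambda>x. d' x * \<phi> x)"
    using assms by (auto intro!: square_integrable_inner square_integrable_mult simp: weak_div_def)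
  then show "(LINT x:E|lebesgue. (v x - w x) \<bullet> grad \<phi> x) = - (LINT x:E|lebesgue. (d x - d' x) * \<phi> x)"
    using eq by (simp add: set_lint_eq inner_diff_left left_diff_distrib)
qed

text \<open>\<open>normal_trace\<close> refers to the chosen representative \<open>divg E v\<close>.
  Two weak divergences have the same integral against every function in \<open>C1\<close>, not only
  against those supported in E, so d may take its place in Green's formula.\<close>

lemma normal_trace_divg_cong:
  assumes "square_integrable E v" "weak_div E v d" "\<phi> \<in> C1"
  shows "(LINT x:E|lebesgue. v x \<bullet> grad \<phi> x + divg E v x * \<phi> x) =
         (LINT x:E|lebesgue. v x \<bullet> grad \<phi> x) + (LINT x:E|lebesgue. d x * \<phi> x)"
proof -
  have "square_integrable E \<phi>" "square_integrable E (grad \<phi>)"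
    by (intro square_integrable_continuous C1D assms)+
  moreover have "square_integrable E (divg E v)"
    using weak_div_divg[OF assms(2)] by (simp add: weak_div_def)
  ultimately have "integrable (lebesgue_on E) (\<lambda>x. v x \<bullet> grad \<phi> x)"
    "integrable (lebesgue_on E) (\<lambda>x. divg E v x * \<phi> x)"
    using assms by (auto intro!: square_integrable_inner square_integrable_mult)
  then have "(LINT x:E|lebesgue. v x \<bullet> grad \<phi> x + divg E v x * \<phi> x) =
     (LINT x:E|lebesgue. v x \<bullet> grad \<phi> x) + (LINT x:E|lebesgue. divg E v x * \<phi> x)"
    by (simp add: set_lint_eq)
  with weak_div_unique_tested[OF weak_div_divg[OF assms(2)] assms(2,3)] show ?thesis by simp
qed

text \<open>\<open>divg\<close> of a difference is a fresh choice and not the difference of the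
  choices; \<open>normal_trace_divg_cong\<close> replaces it by d - d', after which Green's formula
  is additive in the field.\<close>

lemma normal_trace_diff:
  assumes v: "square_integrable E v" "weak_div E v d" "normal_trace E e n v g"
    and w: "square_integrable E w" "weak_div E w d'" "normal_trace E e n w g'"
    and cont: "continuous_on UNIV (edge_point e n)"
  shows "normal_trace E e n (\<lambda>x. v x - w x) (\<lambda>s. g s - g' s)"
  unfolding normal_trace_def
proof (intro conjI ballI)
  have int: "set_integrable lebesgue (edge_interval e) g" "set_integrable lebesgue (edge_interval e) g'"
    using v w by (auto simp: normal_trace_def)
  then show "set_integrable lebesgue (edge_interval e) (\<lambda>s. g s - g' s)" by (rule set_integral_diff)
  fix \<phi> assume "\<phi> \<in> C1c (- (frontier E - open_segment (fst e) (snd e)))"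
  moreover from this have \<phi>: "\<phi> \<in> C1" by (simp add: C1c_iff)
  ultimately have
    "(LINT x:E|lebesgue. v x \<bullet> grad \<phi> x) + (LINT x:E|lebesgue. d x * \<phi> x) =
        outward_sign E e n * (LINT s:edge_interval e|lebesgue. g s * \<phi> (edge_point e n s))"
    "(LINT x:E|lebesgue. w x \<bullet> grad \<phi> x) + (LINT x:E|lebesgue. d' x * \<phi> x) =
        outward_sign E e n * (LINT s:edge_interval e|lebesgue. g' s * \<phi> (edge_point e n s))"
    using v w by (simp_all add: normal_trace_def flip: normal_trace_divg_cong)
  moreover have "(LINT x:E|lebesgue. (v x - w x) \<bullet> grad \<phi> x) =
     (LINT x:E|lebesgue. v x \<bullet> grad \<phi> x) - (LINT x:E|lebesgue. w x \<bullet> grad \<phi> x)"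
    unfolding set_lint_eq inner_diff_left
    by (intro Bochner_Integration.integral_diff square_integrable_inner v w
        square_integrable_continuous C1D \<phi>)
  moreover have "(LINT x:E|lebesgue. (d x - d' x) * \<phi> x) =
     (LINT x:E|lebesgue. d x * \<phi> x) - (LINT x:E|lebesgue. d' x * \<phi> x)"
    unfolding set_lint_eq left_diff_distrib
    using v w square_integrable_continuous[OF C1D(3)[OF \<phi>]]
    by (intro Bochner_Integration.integral_diff square_integrable_mult) (simp_all add: weak_div_def)
  moreover have "(LINT s:edge_interval e|lebesgue. (g s - g' s) * \<phi> (edge_point e n s)) =
     (LINT s:edge_interval e|lebesgue. g s * \<phi> (edge_point e n s)) -
     (LINT s:edge_interval e|lebesgue. g' s * \<phi> (edge_point e n s))"
  proof -
    have "continuous_on UNIV (\<lambda>s. \<phi> (edge_point e n s))"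
      by (rule continuous_on_compose2[OF C1D(3)[OF \<phi>] cont]) auto
    from int[THEN set_integrable_mult_continuous[OF _ this]] show ?thesis
      unfolding left_diff_distrib by (rule set_integral_diff(2))
  qed
  ultimately show "(LINT x:E|lebesgue. (v x - w x) \<bullet> grad \<phi> x + divg E (\<lambda>x. v x - w x) x * \<phi> x) =
        outward_sign E e n * (LINT s:edge_interval e|lebesgue. (g s - g' s) * \<phi> (edge_point e n s))"
    unfolding normal_trace_divg_cong[OF square_integrable_diff[OF v(1) w(1)] weak_div_diff[OF v(1) w(1) v(2) w(2)] \<phi>]
    by (simp add: right_diff_distrib)
qed

end

section \<open>Normal traces on an edge\<close>

lemma perp_nth [simp]: "perp a $ 1 = - a $ 2" "perp a $ 2 = a $ 1"
  by (simp_all add: perp_def)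

lemma inner_2: "x \<bullet> (y :: pt) = x $ 1 * y $ 1 + x $ 2 * y $ 2"
  by (simp add: inner_vec_def sum_2)

lemma norm_perp [simp]: "norm (perp n) = norm n"
  by (simp add: norm_eq_sqrt_inner inner_2 add.commute)

lemma inner_perp_self [simp]: "perp n \<bullet> n = 0" "n \<bullet> perp n = 0"
  by (simp_all add: inner_2)

lemma unit_frame:
  assumes "norm n = 1"
  shows "x = (x \<bullet> perp n) *\<^sub>R perp n + (x \<bullet> n) *\<^sub>R n"
proof -
  have "n $ 1 * n $ 1 + n $ 2 * n $ 2 = 1"
    using assms by (simp add: norm_eq_1 inner_2)
  then show ?thesis
    by (auto simp: vec_eq_iff forall_2 inner_2) (algebra+)
qed

lemma continuous_edge_point [continuous_intros]: "continuous_on A (edge_point e n)"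
  unfolding edge_point_def by (intro continuous_intros)

lemma open_segment_edge_point:
  assumes n: "norm n = 1" and orth: "n \<bullet> (snd e - fst e) = 0" and nondeg: "fst e \<noteq> snd e"
  shows "open_segment (fst e) (snd e) = edge_point e n ` {- edge_len e / 2 <..< edge_len e / 2}"
proof -
  \<comment> \<open>The sign of c is unknown, because the normal may point to either side of the
    edge. Only |c| = \<open>edge_len e\<close> matters, since the parameter interval is
    symmetric.\<close>
  define c where "c = (snd e - fst e) \<bullet> perp n"
  have d: "snd e - fst e = c *\<^sub>R perp n"
    using unit_frame[OF n, of "snd e - fst e"] orth by (simp add: c_def inner_commute)
  have len: "edge_len e = \<bar>c\<bar>"
    using arg_cong[OF d, of norm] n by (simp add: edge_len_def dist_norm norm_minus_commute)
  have c: "c \<noteq> 0" using d nondeg by auto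
  have pt: "(1 - u) *\<^sub>R fst e + u *\<^sub>R snd e = edge_point e n ((u - 1 / 2) * c)" for u
  proof -
    have "(1 - u) *\<^sub>R fst e + u *\<^sub>R snd e = midpoint (fst e) (snd e) + (u - 1 / 2) *\<^sub>R (snd e - fst e)"
      by (simp add: midpoint_def vec_eq_iff algebra_simps)
    then show ?thesis unfolding d edge_point_def by simp
  qed
  show ?thesis
  proof (intro equalityI subsetI)
    fix x assume "x \<in> open_segment (fst e) (snd e)"
    then obtain u where u: "0 < u" "u < 1" "x = (1 - u) *\<^sub>R fst e + u *\<^sub>R snd e"
      by (auto simp: in_segment)
    have "\<bar>u - 1 / 2\<bar> < 1 / 2" using u by linarith
    then have "\<bar>(u - 1 / 2) * c\<bar> < 1 / 2 * \<bar>c\<bar>"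
      unfolding abs_mult using c by (intro mult_strict_right_mono) auto
    then have "(u - 1 / 2) * c \<in> {- edge_len e / 2 <..< edge_len e / 2}"
      by (simp only: len abs_less_iff) auto
    then show "x \<in> edge_point e n ` {- edge_len e / 2 <..< edge_len e / 2}"
      unfolding u(3) pt by (rule imageI)
  next
    fix x assume "x \<in> edge_point e n ` {- edge_len e / 2 <..< edge_len e / 2}"
    then obtain s where "- edge_len e / 2 < s" "s < edge_len e / 2" "x = edge_point e n s"
      by auto
    then have s: "\<bar>s\<bar> < \<bar>c\<bar> / 2" "x = edge_point e n s" by (auto simp: len)
    define u where "u = s / c + 1 / 2"
    have "\<bar>s / c\<bar> < 1 / 2" using s c by (simp add: abs_divide field_simps)
    then have "0 < u" "u < 1" unfolding u_def by linarith+
    moreover have "x = (1 - u) *\<^sub>R fst e + u *\<^sub>R snd e"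
      using pt[of u] s c by (simp add: u_def)
    ultimately show "x \<in> open_segment (fst e) (snd e)" using nondeg unfolding in_segment by blast
  qed
qed

text \<open>\<open>\<sigma> n\<close> is the normal pointing into \<open>E\<close>.\<close>

locale element_edge = bounded_open_set +
  fixes e :: "pt \<times> pt" and n :: pt and \<sigma> :: real
  assumes nondeg: "fst e \<noteq> snd e" and unit_normal: "norm n = 1"
    and orth: "n \<bullet> (snd e - fst e) = 0"
    and edge_frontier: "open_segment (fst e) (snd e) \<subseteq> frontier E"
    and closed_rest: "closed (frontier E - open_segment (fst e) (snd e))"
    and \<sigma>: "\<sigma> = 1 \<or> \<sigma> = -1"
    and inner_side: "\<bar>s\<bar> < edge_len e / 2 \<Longrightarrow>
      eventually (\<lambda>t. edge_point e n s + t *\<^sub>R (\<sigma> *\<^sub>R n) \<in> E) (at_right 0)"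
    and outer_side: "\<bar>s\<bar> < edge_len e / 2 \<Longrightarrow>
      eventually (\<lambda>t. edge_point e n s - t *\<^sub>R (\<sigma> *\<^sub>R n) \<notin> E) (at_right 0)"
begin

lemma edge_len_pos: "edge_len e > 0"
  using nondeg by (simp add: edge_len_def)

lemma outward_sign_eq: "outward_sign E e n = - \<sigma>"
proof -
  have in0: "eventually (\<lambda>t. midpoint (fst e) (snd e) + t *\<^sub>R (\<sigma> *\<^sub>R n) \<in> E) (at_right 0)"
    and out0: "eventually (\<lambda>t. midpoint (fst e) (snd e) - t *\<^sub>R (\<sigma> *\<^sub>R n) \<notin> E) (at_right 0)"
    using inner_side[of 0] outer_side[of 0] edge_len_pos by (auto simp: edge_point_def)
  show ?thesis
  proof (cases "\<sigma> = 1")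
    case True
    then show ?thesis using in0 by (simp add: outward_sign_def)
  next
    case False
    with \<sigma> have "\<sigma> = -1" by auto
    then have "eventually (\<lambda>t. midpoint (fst e) (snd e) + t *\<^sub>R n \<notin> E) (at_right 0)"
      using out0 by simp
    then have "\<not> eventually (\<lambda>t. midpoint (fst e) (snd e) + t *\<^sub>R n \<in> E) (at_right 0)"
      by (auto dest: eventually_conj)
    then show ?thesis using \<open>\<sigma> = -1\<close> by (simp add: outward_sign_def)
  qed
qed

text \<open>Green's formula determines the integrals of a trace against test functions only. The
  weight is therefore extended to the plane and multiplied by cutoffs that tend to 1 on the open
  edge, and the cutoffs are removed by dominated convergence. The factor \<open>outward_sign\<close>
  is 1 or -1 and cancels.\<close>

lemma normal_trace_moment_unique:
  assumes "normal_trace E e n v g\<^sub>1" "normal_trace E e n v g\<^sub>2"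
  shows "(LINT s:edge_interval e|lebesgue. g\<^sub>1 s * (s / edge_len e) ^ j) =
         (LINT s:edge_interval e|lebesgue. g\<^sub>2 s * (s / edge_len e) ^ j)"
proof -
  define U where "U = - (frontier E - open_segment (fst e) (snd e))"
  have "open U" unfolding U_def using closed_rest by (rule open_Compl)
  then obtain \<psi> :: "nat \<Rightarrow> pt \<Rightarrow> real" where \<psi>: "\<And>n. \<psi> n \<in> C1c U"
    "\<And>n x. 0 \<le> \<psi> n x" "\<And>n x. \<psi> n x \<le> 1" "\<And>x. x \<in> U \<Longrightarrow> (\<lambda>n. \<psi> n x) \<longlonglongrightarrow> 1"
    using C1c_cutoff by metis
  \<comment> \<open>The scaled length coordinate is the restriction to the edge of an affine
    function on the plane, so its power is an admissible multiplier.\<close>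
  define m where "m x = (((x - midpoint (fst e) (snd e)) \<bullet> perp n) * (1 / edge_len e)) ^ j" for x
  have m: "m \<in> C1" unfolding m_def by (intro C1_power C1_mult C1_inner C1_const)
  have m_edge: "m (edge_point e n s) = (s / edge_len e) ^ j" for s
  proof -
    have "perp n \<bullet> perp n = 1" using unit_normal by (simp flip: norm_eq_1)
    then show ?thesis by (simp add: m_def edge_point_def)
  qed
  have \<psi>_cont: "continuous_on UNIV (\<lambda>s. \<psi> i (edge_point e n s))" for i
    using \<psi>(1)[of i] by (intro continuous_on_compose2[OF C1D(3) continuous_edge_point]) (auto simp: C1c_iff)
  have lim: "(\<lambda>i. LINT s:edge_interval e|lebesgue. g s * (\<psi> i (edge_point e n s) * m (edge_point e n s)))
      \<longlonglongrightarrow> (LINT s:edge_interval e|lebesgue. g s * (s / edge_len e) ^ j)"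
    if g: "normal_trace E e n v g" for g
  proof -
    let ?I = "indicator (edge_interval e) :: real \<Rightarrow> real"
    have "(\<lambda>i. \<integral>s. (?I s *\<^sub>R (g s * (s / edge_len e) ^ j)) * \<psi> i (edge_point e n s) \<partial>lebesgue)
        \<longlonglongrightarrow> (\<integral>s. ?I s *\<^sub>R (g s * (s / edge_len e) ^ j) \<partial>lebesgue)"
    proof (rule integral_dominated_convergence[where w = "\<lambda>s. norm (?I s *\<^sub>R (g s * (s / edge_len e) ^ j))"])
      have int: "integrable lebesgue (\<lambda>s. ?I s *\<^sub>R (g s * (s / edge_len e) ^ j))"
      proof -
        have "continuous_on UNIV (\<lambda>s. (s / edge_len e) ^ j)"
          unfolding divide_inverse by (intro continuous_intros)
        moreover have "set_integrable lebesgue (edge_interval e) g"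
          using g by (simp add: normal_trace_def)
        ultimately show ?thesis
          using set_integrable_mult_continuous[of e g] by (simp add: set_integrable_def)
      qed
      then show "integrable lebesgue (\<lambda>s. norm (?I s *\<^sub>R (g s * (s / edge_len e) ^ j)))"
        by (rule integrable_norm)
      show "(\<lambda>s. ?I s *\<^sub>R (g s * (s / edge_len e) ^ j)) \<in> borel_measurable lebesgue"
        using int by (rule borel_measurable_integrable)
      have "(\<lambda>s. \<psi> i (edge_point e n s)) \<in> borel_measurable lebesgue" for i
        by (rule continuous_measurable_lebesgue[OF \<psi>_cont])
      then show "(\<lambda>s. (?I s *\<^sub>R (g s * (s / edge_len e) ^ j)) * \<psi> i (edge_point e n s)) \<in> borel_measurable lebesgue" for i
        by (intro borel_measurable_times borel_measurable_integrable[OF int])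
      show "AE s in lebesgue. norm ((?I s *\<^sub>R (g s * (s / edge_len e) ^ j)) * \<psi> i (edge_point e n s))
          \<le> norm (?I s *\<^sub>R (g s * (s / edge_len e) ^ j))" for i
        using \<psi>(2,3) by (intro AE_I2) (auto simp: abs_mult intro!: mult_left_le)
      \<comment> \<open>The cutoffs are known to converge to 1 on the open edge only; its two
        endpoints are a null set.\<close>
      have "AE s in lebesgue. s \<notin> {- edge_len e / 2, edge_len e / 2}"
        by (rule AE_not_in) auto
      then show "AE s in lebesgue. (\<lambda>i. (?I s *\<^sub>R (g s * (s / edge_len e) ^ j)) * \<psi> i (edge_point e n s))
          \<longlonglongrightarrow> ?I s *\<^sub>R (g s * (s / edge_len e) ^ j)"
      proof eventually_elim
        case (elim s)
        show ?case
        proof (cases "s \<in> edge_interval e")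
          case True
          with elim have "s \<in> {- edge_len e / 2 <..< edge_len e / 2}"
            by (auto simp: edge_interval_def)
          then have "edge_point e n s \<in> U"
            using open_segment_edge_point[OF unit_normal orth nondeg] by (auto simp: U_def)
          from tendsto_mult[OF tendsto_const \<psi>(4)[OF this], of "?I s *\<^sub>R (g s * (s / edge_len e) ^ j)"]
          show ?thesis by simp
        qed simp
      qed
    qed
    then show ?thesis by (simp add: set_lebesgue_integral_def m_edge mult_ac)
  qed
  have test: "(\<lambda>x. \<psi> i x * m x) \<in> C1c U" for i by (intro C1c_mult \<psi> m)
  have green: "(LINT x:E|lebesgue. v x \<bullet> grad (\<lambda>x. \<psi> i x * m x) x + divg E v x * (\<psi> i x * m x))
    = outward_sign E e n * (LINT s:edge_interval e|lebesgue. g s * (\<psi> i (edge_point e n s) * m (edge_point e n s)))"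
    if "normal_trace E e n v g" for g i
    using that test unfolding normal_trace_def U_def by blast
  have eq: "(LINT s:edge_interval e|lebesgue. g\<^sub>1 s * (\<psi> i (edge_point e n s) * m (edge_point e n s)))
    = (LINT s:edge_interval e|lebesgue. g\<^sub>2 s * (\<psi> i (edge_point e n s) * m (edge_point e n s)))" for i
    using \<sigma> trans[OF green[OF assms(1), symmetric] green[OF assms(2)]] by (auto simp: outward_sign_eq)
  show ?thesis
    by (rule LIMSEQ_unique[OF lim[OF assms(1), unfolded eq] lim[OF assms(2)]])
qed

lemma normal_trace_ntrace: "normal_trace E e n v g \<Longrightarrow> normal_trace E e n v (ntrace E e n v)"
  unfolding ntrace_def by (rule someI[where P = "normal_trace E e n v"])

end

section \<open>Green's formula next to an edge\<close>

lemma vector_2_eq: "vector [a, b] = a *\<^sub>R axis 1 1 + b *\<^sub>R (axis 2 1 :: pt)"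
  by (simp add: vec_eq_iff forall_2 axis_def)

lemma borel_measurable_vector_2 [measurable]:
  "(\<lambda>(s, t). vector [s, t] :: pt) \<in> borel_measurable (lborel \<Otimes>\<^sub>M lborel)"
  unfolding vector_2_eq by measurable

text \<open>Agreement on boxes determines the measure. Identifying vectors with pairs gives access
  to Fubini's theorem for the product measure.\<close>

lemma lborel_distr_vector:
  "distr (lborel \<Otimes>\<^sub>M lborel) borel (\<lambda>(s, t). vector [s, t] :: pt) = lborel" (is "?M = _")
proof (rule lborel_eqI[symmetric])
  fix l u :: pt assume le: "\<And>b. b \<in> Basis \<Longrightarrow> l \<bullet> b \<le> u \<bullet> b"
  have le': "l $ i \<le> u $ i" for i
    using le[of "axis i 1"] by (simp add: inner_axis axis_in_Basis_iff)
  have "(\<lambda>(s, t). vector [s, t] :: pt) -` box l u = {l $ 1 <..< u $ 1} \<times> {l $ 2 <..< u $ 2}"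
    by (auto simp: mem_box_cart forall_2)
  then have "emeasure ?M (box l u) = emeasure (lborel \<Otimes>\<^sub>M lborel) ({l $ 1 <..< u $ 1} \<times> {l $ 2 <..< u $ 2})"
    by (subst emeasure_distr) (auto simp: space_pair_measure)
  also have "\<dots> = ennreal (u $ 1 - l $ 1) * ennreal (u $ 2 - l $ 2)"
    using le' by (subst lborel.emeasure_pair_measure_Times) auto
  also have "\<dots> = ennreal ((u $ 1 - l $ 1) * (u $ 2 - l $ 2))"
    using le' by (simp add: ennreal_mult)
  also have "(u $ 1 - l $ 1) * (u $ 2 - l $ 2) = (\<Prod>b\<in>Basis. (u - l) \<bullet> b)"
    by (simp add: Basis_vec_def UNIV_2 inner_axis axis_eq_axis)
  finally show "emeasure ?M (box l u) = (\<Prod>b\<in>Basis. (u - l) \<bullet> b)" .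
qed simp

lemma lborel_distr_orthogonal:
  fixes L :: "real^'n::{finite,wellorder} \<Rightarrow> real^'n::_"
  assumes L: "orthogonal_transformation L"
  shows "distr lborel borel L = lborel"
proof (rule lborel_eqI[symmetric])
  have [measurable]: "L \<in> borel_measurable borel"
    using orthogonal_transformation_linear[OF L] unfolding linear_conv_bounded_linear
    by (intro borel_measurable_continuous_onI linear_continuous_on)
  fix l u :: "real^'n::_" assume le: "\<And>b. b \<in> Basis \<Longrightarrow> l \<bullet> b \<le> u \<bullet> b"
  have inv: "orthogonal_transformation (inv L)" by (rule orthogonal_transformation_inv[OF L])
  have vim: "L -` box l u = inv L ` box l u"
    using L by (simp add: bij_vimage_eq_inv_image orthogonal_transformation_bij)
  have lm: "box l u \<in> lmeasurable" by simp
  have bm: "L -` box l u \<in> sets borel" using measurable_sets[of L borel borel "box l u"] by simp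
  have "emeasure (distr lborel borel L) (box l u) = emeasure lborel (L -` box l u)"
    by (subst emeasure_distr) auto
  also have "\<dots> = emeasure lebesgue (L -` box l u)" using bm by simp
  also have "\<dots> = measure lebesgue (box l u)"
    using measurable_orthogonal_image[OF inv lm] measure_orthogonal_image[OF inv lm]
    by (simp add: vim emeasure_eq_measure2)
  also have "\<dots> = (\<Prod>b\<in>Basis. (u - l) \<bullet> b)"
    using le by (simp add: measure_def prod_nonneg inner_diff_left)
  finally show "emeasure (distr lborel borel L) (box l u) = (\<Prod>b\<in>Basis. (u - l) \<bullet> b)" .
qed simp

text \<open>The map is a composition of three measure preserving ones: pairs to vectors, the
  isometry taking the unit vectors to a and b, and the translation by m.\<close>

lemma lborel_distr_frame:
  fixes m a b :: pt
  assumes ab: "norm a = 1" "norm b = 1" "a \<bullet> b = 0"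
  shows "distr (lborel \<Otimes>\<^sub>M lborel) borel (\<lambda>(s, t). m + s *\<^sub>R a + t *\<^sub>R b) = lborel"
proof -
  define L where "L x = x $ 1 *\<^sub>R a + x $ 2 *\<^sub>R b" for x :: pt
  have "linear L" by (intro linearI) (simp_all add: L_def algebra_simps)
  moreover have "norm (L x) = norm x" for x
  proof -
    have "a \<bullet> a = 1" "b \<bullet> b = 1" "b \<bullet> a = 0" using ab by (auto simp: norm_eq_1 inner_commute)
    then have "L x \<bullet> L x = x $ 1 * x $ 1 + x $ 2 * x $ 2"
      using ab(3) by (simp add: L_def inner_add_left inner_add_right)
    then have "L x \<bullet> L x = x \<bullet> x" by (simp add: inner_2)
    then show ?thesis by (simp add: norm_eq_sqrt_inner)
  qed
  ultimately have L: "orthogonal_transformation L" by (simp add: orthogonal_transformation)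
  have [measurable]: "L \<in> borel_measurable borel"
    using \<open>linear L\<close> unfolding linear_conv_bounded_linear
    by (intro borel_measurable_continuous_onI linear_continuous_on)
  have "distr (distr (distr (lborel \<Otimes>\<^sub>M lborel) borel (\<lambda>(s, t). vector [s, t])) borel L) borel ((+) m) = lborel"
    by (simp only: lborel_distr_vector lborel_distr_orthogonal[OF L] lborel_distr_plus)
  also have "distr (distr (distr (lborel \<Otimes>\<^sub>M lborel) borel (\<lambda>(s, t). vector [s, t])) borel L) borel ((+) m)
    = distr (lborel \<Otimes>\<^sub>M lborel) borel (\<lambda>(s, t). m + s *\<^sub>R a + t *\<^sub>R b)"
    by (simp add: distr_distr comp_def case_prod_beta' L_def add.assoc)
  finally show ?thesis .
qed

text \<open>Fubini's theorem along the lines in direction b. Integrability is obtained on almost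
  every line only, so the later statements about a single line carry it as a hypothesis.\<close>

lemma integral_lborel_frame:
  fixes f :: "pt \<Rightarrow> real" and m a b :: pt
  assumes ab: "norm a = 1" "norm b = 1" "a \<bullet> b = 0" and f: "integrable lborel f"
  shows "AE s in lborel. integrable lborel (\<lambda>t. f (m + s *\<^sub>R a + t *\<^sub>R b))"
    and "integral\<^sup>L lborel f = (\<integral>s. (\<integral>t. f (m + s *\<^sub>R a + t *\<^sub>R b) \<partial>lborel) \<partial>lborel)"
    and "(\<lambda>s. \<integral>t. f (m + s *\<^sub>R a + t *\<^sub>R b) \<partial>lborel) \<in> borel_measurable lborel"
proof -
  let ?T = "\<lambda>(s, t). m + s *\<^sub>R a + t *\<^sub>R b"
  have T: "?T \<in> borel_measurable (lborel \<Otimes>\<^sub>M lborel)" by measurable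
  have [measurable]: "f \<in> borel_measurable borel" using f by auto
  have "integrable (distr (lborel \<Otimes>\<^sub>M lborel) borel ?T) f"
    unfolding lborel_distr_frame[OF ab] by (rule f)
  then have int: "integrable (lborel \<Otimes>\<^sub>M lborel) (\<lambda>p. f (?T p))"
    by (subst (asm) integrable_distr_eq[OF T]) auto
  show "AE s in lborel. integrable lborel (\<lambda>t. f (m + s *\<^sub>R a + t *\<^sub>R b))"
    using lborel_pair.AE_integrable_fst'[OF int] by simp
  have "integral\<^sup>L lborel f = integral\<^sup>L (distr (lborel \<Otimes>\<^sub>M lborel) borel ?T) f"
    unfolding lborel_distr_frame[OF ab] ..
  also have "\<dots> = (\<integral>p. f (?T p) \<partial>(lborel \<Otimes>\<^sub>M lborel))"
    by (rule integral_distr[OF T]) auto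
  also have "\<dots> = (\<integral>s. (\<integral>t. f (m + s *\<^sub>R a + t *\<^sub>R b) \<partial>lborel) \<partial>lborel)"
    using lborel_pair.integral_fst'[OF int] by simp
  finally show "integral\<^sup>L lborel f = (\<integral>s. (\<integral>t. f (m + s *\<^sub>R a + t *\<^sub>R b) \<partial>lborel) \<partial>lborel)" .
  show "(\<lambda>s. \<integral>t. f (m + s *\<^sub>R a + t *\<^sub>R b) \<partial>lborel) \<in> borel_measurable lborel"
    by measurable
qed

text \<open>The fundamental theorem on [-T, 0] and [0, T] separately: G is zero at the far ends, so
  only the one-sided limits at the jump survive. The model is the zero extension of a test function
  along a line that crosses the edge.\<close>

lemma integral_deriv_jump:
  fixes G G' :: "real \<Rightarrow> real"
  assumes deriv: "\<And>t. t \<noteq> 0 \<Longrightarrow> (G has_real_derivative G' t) (at t)"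
    and jump: "(G \<longlongrightarrow> c) (at_right 0)" "(G \<longlongrightarrow> d) (at_left 0)"
    and supp: "\<And>t. \<bar>t\<bar> \<ge> T \<Longrightarrow> G t = 0" "\<And>t. \<bar>t\<bar> \<ge> T \<Longrightarrow> G' t = 0" and T: "T > 0"
    and int: "integrable lborel G'"
  shows "integral\<^sup>L lborel G' = d - c"
proof -
  \<comment> \<open>With k equal to a one-sided limit of G, the modified function is continuous up
    to 0 from that side; a derivative is required in the interior only.\<close>
  define H where "H k t = (if t = 0 then k else G t)" for k :: real and t :: real
  have H_deriv: "(H k has_vector_derivative G' t) (at t)" if "t \<noteq> 0" for t k
  proof -
    have "(H k has_real_derivative G' t) (at t)"
      by (rule has_field_derivative_transform_within_open[OF deriv[OF that], where S = "- {0}"])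
        (use that in \<open>auto simp: H_def\<close>)
    then show ?thesis by (simp add: has_real_derivative_iff_has_vector_derivative)
  qed
  have H_cont: "continuous (at t within A) (H k)" if "t \<noteq> 0" for t k A
    using has_vector_derivative_continuous[OF H_deriv[OF that]] continuous_at_imp_continuous_within by blast
  have right: "continuous (at 0 within {0..T}) (H c)"
  proof -
    have "(H c \<longlongrightarrow> c) (at_right 0)"
      by (rule Lim_transform_eventually[OF jump(1)]) (auto simp: H_def eventually_at_filter)
    moreover have "(at 0 within {0..T}) = at_right 0"
      by (rule at_within_Icc_at_right[OF T])
    ultimately show ?thesis by (simp add: continuous_within H_def)
  qed
  have left: "continuous (at 0 within {-T..0}) (H d)"
  proof -
    have "(H d \<longlongrightarrow> d) (at_left 0)"
      by (rule Lim_transform_eventually[OF jump(2)]) (auto simp: H_def eventually_at_filter)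
    moreover have "(at 0 within {-T..0}) = at_left 0"
      using T by (intro at_within_Icc_at_left) simp
    ultimately show ?thesis by (simp add: continuous_within H_def)
  qed
  have "(G' has_integral H c T - H c 0) {0..T}"
    using T right H_cont by (intro fundamental_theorem_of_calculus_interior H_deriv)
      (auto simp: continuous_on_eq_continuous_within, metis)
  moreover have "(G' has_integral H d 0 - H d (-T)) {-T..0}"
    using T left H_cont by (intro fundamental_theorem_of_calculus_interior H_deriv)
      (auto simp: continuous_on_eq_continuous_within, metis)
  ultimately have "(G' has_integral (H d 0 - H d (-T)) + (H c T - H c 0)) {-T..T}"
    using T by (intro has_integral_combine) auto
  moreover have "H d (-T) = 0" "H c T = 0" using T supp by (auto simp: H_def)
  ultimately have "(G' has_integral d - c) {-T..T}" by (simp add: H_def)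
  then have "(G' has_integral d - c) UNIV"
    by (rule has_integral_on_superset) (use supp in auto)
  with has_integral_integral_lborel[OF int] show ?thesis by (metis has_integral_unique)
qed

context bounded_open_set
begin

lemma set_lint_lborel:
  fixes f :: "pt \<Rightarrow> real"
  assumes "continuous_on UNIV f"
  shows "(LINT x:E|lebesgue. f x) = (\<integral>x. indicator E x * f x \<partial>lborel)"
    and "integrable lborel (\<lambda>x. indicator E x * f x)"
proof -
  have [measurable]: "f \<in> borel_measurable borel" by (rule borel_measurable_continuous_onI[OF assms])
  have [measurable]: "E \<in> sets borel" using open_E by simp
  show "(LINT x:E|lebesgue. f x) = (\<integral>x. indicator E x * f x \<partial>lborel)"
    by (simp add: set_lebesgue_integral_def integral_completion)
  have "integrable lebesgue (\<lambda>x. indicator E x * f x)"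
    using integrable_continuous[OF assms] by (simp flip: set_integrable_iff add: set_integrable_def)
  then show "integrable lborel (\<lambda>x. indicator E x * f x)"
    by (simp add: integrable_completion)
qed

end

section \<open>Zero extensions of test functions along lines\<close>

context element_edge
begin

text \<open>\<open>C1c U\<close> is the class of test functions in \<open>normal_trace\<close>:
  their supports may meet the frontier of E only in the open edge.\<close>

definition U where "U = - (frontier E - open_segment (fst e) (snd e))"

lemma E_frontier: "frontier E \<inter> E = {}"
  using open_E by (simp add: frontier_disjoint_eq)

lemma edge_Int_E: "open_segment (fst e) (snd e) \<inter> E = {}"
  using edge_frontier E_frontier by blast

lemma open_segmentE:
  assumes "x \<in> open_segment (fst e) (snd e)"
  obtains s where "\<bar>s\<bar> < edge_len e / 2" "x = midpoint (fst e) (snd e) + s *\<^sub>R perp n"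
proof -
  obtain s where "- edge_len e / 2 < s" "s < edge_len e / 2" "x = edge_point e n s"
    using assms unfolding open_segment_edge_point[OF unit_normal orth nondeg] by auto
  then show ?thesis by (intro that[of s]) (auto simp: edge_point_def)
qed

lemma E_subset_U: "E \<subseteq> U"
  using E_frontier by (auto simp: U_def)

text \<open>Inside E the zero extension coincides with u. At any other point off the open edge it
  vanishes nearby, because the support of u meets the frontier of E only in the open edge.\<close>

lemma has_derivative_cutoff_line:
  fixes u :: "pt \<Rightarrow> real"
  assumes u: "u \<in> C1c U" and y: "p + t\<^sub>0 *\<^sub>R d \<notin> open_segment (fst e) (snd e)"
  shows "((\<lambda>t. indicator E (p + t *\<^sub>R d) * u (p + t *\<^sub>R d)) has_real_derivative
     indicator E (p + t\<^sub>0 *\<^sub>R d) * (grad u (p + t\<^sub>0 *\<^sub>R d) \<bullet> d)) (at t\<^sub>0)"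
proof -
  have cont: "continuous_on UNIV (\<lambda>t. p + t *\<^sub>R d)" by (intro continuous_intros)
  show ?thesis
  proof (cases "p + t\<^sub>0 *\<^sub>R d \<in> E")
    case True
    have "(u has_derivative (\<lambda>h. h \<bullet> grad u (p + t\<^sub>0 *\<^sub>R d))) (at (p + t\<^sub>0 *\<^sub>R d))"
      using C1D(1)[of u] u by (simp add: C1c_iff gderiv_def)
    moreover have "((\<lambda>t. p + t *\<^sub>R d) has_derivative (\<lambda>h. h *\<^sub>R d)) (at t\<^sub>0)"
      by (auto intro!: derivative_eq_intros)
    ultimately have "((\<lambda>t. u (p + t *\<^sub>R d)) has_derivative (\<lambda>h. (h *\<^sub>R d) \<bullet> grad u (p + t\<^sub>0 *\<^sub>R d))) (at t\<^sub>0)"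
      by (rule has_derivative_compose[rotated])
    then have "((\<lambda>t. u (p + t *\<^sub>R d)) has_real_derivative (grad u (p + t\<^sub>0 *\<^sub>R d) \<bullet> d)) (at t\<^sub>0)"
      by (simp add: has_field_derivative_def inner_commute mult_commute_abs)
    then have "((\<lambda>t. indicator E (p + t *\<^sub>R d) * u (p + t *\<^sub>R d)) has_real_derivative
        (grad u (p + t\<^sub>0 *\<^sub>R d) \<bullet> d)) (at t\<^sub>0)"
      by (rule has_field_derivative_transform_within_open[where S = "(\<lambda>t. p + t *\<^sub>R d) -` E"])
        (use True open_vimage[OF open_E cont] in auto)
    then show ?thesis using True by simp
  next
    case False
    \<comment> \<open>A neighbourhood that misses either E or the points where u is nonzero makes
      the zero extension identically 0.\<close>
    define W where "W = - (closure E \<inter> closure {x. u x \<noteq> 0})"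
    have "open W" unfolding W_def by (intro open_Compl closed_Int closed_closure)
    have "p + t\<^sub>0 *\<^sub>R d \<in> W"
      using False y u open_E by (auto simp: W_def C1c_iff U_def frontier_def interior_open)
    have "((\<lambda>t. 0) has_real_derivative 0) (at t\<^sub>0)" by simp
    then have "((\<lambda>t. indicator E (p + t *\<^sub>R d) * u (p + t *\<^sub>R d)) has_real_derivative 0) (at t\<^sub>0)"
    proof (rule has_field_derivative_transform_within_open[where S = "(\<lambda>t. p + t *\<^sub>R d) -` W"])
      show "open ((\<lambda>t. p + t *\<^sub>R d) -` W)" by (rule open_vimage[OF \<open>open W\<close> cont])
      fix t assume "t \<in> (\<lambda>t. p + t *\<^sub>R d) -` W"
      then show "0 = indicator E (p + t *\<^sub>R d) * u (p + t *\<^sub>R d)"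
        using closure_subset[of E] closure_subset[of "{x. u x \<noteq> 0}"]
        by (auto simp: W_def indicator_def)
    qed (use \<open>p + t\<^sub>0 *\<^sub>R d \<in> W\<close> in auto)
    then show ?thesis using False by simp
  qed
qed

lemma line_leaves_E:
  assumes "norm d = 1"
  obtains T where "T > 0" "\<And>t. \<bar>t\<bar> \<ge> T \<Longrightarrow> p + t *\<^sub>R d \<notin> E"
proof -
  obtain B where B: "\<And>x. x \<in> E \<Longrightarrow> norm x \<le> B" using bounded_E by (auto simp: bounded_iff)
  show ?thesis
  proof (rule that[of "\<bar>B\<bar> + norm p + 1"])
    fix t assume t: "\<bar>B\<bar> + norm p + 1 \<le> \<bar>t\<bar>"
    have "\<bar>t\<bar> \<le> norm (p + t *\<^sub>R d) + norm p"
      using norm_triangle_ineq4[of "p + t *\<^sub>R d" p] assms by simp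
    with t show "p + t *\<^sub>R d \<notin> E" using B[of "p + t *\<^sub>R d"] by linarith
  qed (simp add: add_pos_nonneg add_nonneg_pos)
qed

text \<open>On such a line the zero extension has no jump and vanishes far out.
  \<open>integral_deriv_jump\<close> is applied at the ordinary parameter 0, where both one-sided
  limits agree.\<close>

lemma integral_line_avoiding_edge:
  fixes u :: "pt \<Rightarrow> real"
  assumes u: "u \<in> C1c U" and d: "norm d = 1"
    and y: "\<And>t. p + t *\<^sub>R d \<notin> open_segment (fst e) (snd e)"
    and int: "integrable lborel (\<lambda>t. indicator E (p + t *\<^sub>R d) * (grad u (p + t *\<^sub>R d) \<bullet> d))"
  shows "(\<integral>t. indicator E (p + t *\<^sub>R d) * (grad u (p + t *\<^sub>R d) \<bullet> d) \<partial>lborel) = 0"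
proof -
  obtain T where T: "T > 0" "\<And>t. \<bar>t\<bar> \<ge> T \<Longrightarrow> p + t *\<^sub>R d \<notin> E"
    using line_leaves_E[OF d] by metis
  let ?G = "\<lambda>t. indicator E (p + t *\<^sub>R d) * u (p + t *\<^sub>R d)"
  have "isCont ?G 0" by (rule DERIV_isCont[OF has_derivative_cutoff_line[OF u y]])
  then have "(?G \<longlongrightarrow> ?G 0) (at_right 0)" "(?G \<longlongrightarrow> ?G 0) (at_left 0)"
    by (auto simp: isCont_def intro: tendsto_within_subset)
  from integral_deriv_jump[OF has_derivative_cutoff_line[OF u y] this _ _ T(1) int] T(2)
  show ?thesis by simp
qed

text \<open>N points into E, so at t = 0 the zero extension jumps from 0 to the value of u on the
  edge. A normal line meets the edge only once, hence there is no other jump.\<close>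

lemma integral_line_crossing_edge:
  fixes u :: "pt \<Rightarrow> real"
  defines "N \<equiv> \<sigma> *\<^sub>R n"
  assumes u: "u \<in> C1c U" and s: "\<bar>s\<bar> < edge_len e / 2"
    and int: "integrable lborel (\<lambda>t. indicator E (edge_point e n s + t *\<^sub>R N) * (grad u (edge_point e n s + t *\<^sub>R N) \<bullet> N))"
  shows "(\<integral>t. indicator E (edge_point e n s + t *\<^sub>R N) * (grad u (edge_point e n s + t *\<^sub>R N) \<bullet> N) \<partial>lborel)
     = - u (edge_point e n s)"
proof -
  have N: "norm N = 1" using \<sigma> unit_normal by (auto simp: N_def)
  let ?p = "edge_point e n s"
  obtain T where T: "T > 0" "\<And>t. \<bar>t\<bar> \<ge> T \<Longrightarrow> ?p + t *\<^sub>R N \<notin> E"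
    using line_leaves_E[OF N] by metis
  let ?G = "\<lambda>t. indicator E (?p + t *\<^sub>R N) * u (?p + t *\<^sub>R N)"
  have avoid: "?p + t *\<^sub>R N \<notin> open_segment (fst e) (snd e)" if "t \<noteq> 0" for t
  proof
    assume "?p + t *\<^sub>R N \<in> open_segment (fst e) (snd e)"
    then obtain s' where "?p + t *\<^sub>R N = midpoint (fst e) (snd e) + s' *\<^sub>R perp n"
      by (rule open_segmentE)
    then have "(s - s') *\<^sub>R perp n + (t * \<sigma>) *\<^sub>R n = 0"
      by (simp add: edge_point_def N_def algebra_simps)
    then have "((s - s') *\<^sub>R perp n + (t * \<sigma>) *\<^sub>R n) \<bullet> n = 0" by simp
    then show False using that \<sigma> unit_normal by (auto simp: inner_add_left norm_eq_1)
  qed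
  have "isCont (\<lambda>t. u (?p + t *\<^sub>R N)) 0"
    using u by (intro continuous_at_compose[unfolded comp_def, of _ "\<lambda>t. ?p + t *\<^sub>R N" u] continuous_intros)
      (simp add: C1D(3) C1c_iff continuous_on_eq_continuous_at[THEN iffD1, OF open_UNIV])
  then have lim: "((\<lambda>t. u (?p + t *\<^sub>R N)) \<longlongrightarrow> u ?p) (at_right 0)"
    by (auto simp: isCont_def intro: tendsto_within_subset)
  have right: "(?G \<longlongrightarrow> u ?p) (at_right 0)"
    by (rule Lim_transform_eventually[OF lim])
      (use inner_side[OF s] in \<open>auto simp: N_def elim!: eventually_mono\<close>)
  have ev: "eventually (\<lambda>t. ?p + t *\<^sub>R N \<notin> E) (at_left 0)"
    using outer_side[OF s] by (simp add: eventually_at_left_to_right N_def)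
  have left: "(?G \<longlongrightarrow> 0) (at_left 0)"
    by (rule Lim_transform_eventually[OF tendsto_const]) (use ev in \<open>auto elim!: eventually_mono\<close>)
  from integral_deriv_jump[OF has_derivative_cutoff_line[OF u avoid] right left _ _ T(1) int] T(2)
  show ?thesis by simp
qed

text \<open>Slices parallel to the edge: every line except the one that carries the edge avoids it,
  and that one corresponds to a single parameter.\<close>

lemma green_tangential:
  assumes u: "u \<in> C1c U"
  shows "(LINT x:E|lebesgue. grad u x \<bullet> perp n) = 0"
proof -
  have cont: "continuous_on UNIV (\<lambda>x. grad u x \<bullet> perp n)"
    using u by (intro continuous_intros C1D) (simp add: C1c_iff)
  let ?m = "midpoint (fst e) (snd e)"
  let ?f = "\<lambda>x. indicator E x * (grad u x \<bullet> perp n)"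
  have frame: "norm n = 1" "norm (perp n) = 1" "n \<bullet> perp n = 0" using unit_normal by auto
  note I = integral_lborel_frame[OF frame set_lint_lborel(2)[OF cont], of ?m]
  have "(LINT x:E|lebesgue. grad u x \<bullet> perp n)
      = (\<integral>t. (\<integral>s. ?f (?m + t *\<^sub>R n + s *\<^sub>R perp n) \<partial>lborel) \<partial>lborel)"
    by (simp only: set_lint_lborel(1)[OF cont] I(2))
  also have "\<dots> = (\<integral>(t::real). (0::real) \<partial>lborel)"
  proof (rule integral_cong_AE)
    have "AE t in lborel. t \<noteq> (0::real)" by (rule AE_lborel_singleton)
    then show "AE t in lborel. (\<integral>s. ?f (?m + t *\<^sub>R n + s *\<^sub>R perp n) \<partial>lborel) = 0"
      using I(1)
    proof eventually_elim
      case (elim t)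
      have avoid: "?m + t *\<^sub>R n + s *\<^sub>R perp n \<notin> open_segment (fst e) (snd e)" for s
      proof
        assume "?m + t *\<^sub>R n + s *\<^sub>R perp n \<in> open_segment (fst e) (snd e)"
        then obtain s' where "?m + t *\<^sub>R n + s *\<^sub>R perp n = ?m + s' *\<^sub>R perp n"
          by (rule open_segmentE)
        then have "(?m + t *\<^sub>R n + s *\<^sub>R perp n) \<bullet> n = (?m + s' *\<^sub>R perp n) \<bullet> n" by (rule arg_cong)
        then show False using elim(1) unit_normal by (auto simp: inner_add_left norm_eq_1)
      qed
      show ?case
        by (rule integral_line_avoiding_edge[OF u frame(2) avoid elim(2)])
    qed
  qed (use I(3) in auto)
  finally show ?thesis by simp
qed

text \<open>Slices normal to the edge: a line through the open edge contributes its jump, every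
  other line nothing. Along the inward normal N the contribution is negative, in accordance with
  \<open>outward_sign_eq\<close>.\<close>

lemma green_normal:
  assumes u: "u \<in> C1c U"
  shows "(LINT x:E|lebesgue. grad u x \<bullet> n) = 
    outward_sign E e n * (LINT s:edge_interval e|lebesgue. u (edge_point e n s))"
proof -
  define N where "N = \<sigma> *\<^sub>R n"
  have cont: "continuous_on UNIV (\<lambda>x. grad u x \<bullet> N)"
    using u by (intro continuous_intros C1D) (simp add: C1c_iff)
  let ?m = "midpoint (fst e) (snd e)" and ?J = "{- edge_len e / 2 <..< edge_len e / 2}"
  let ?f = "\<lambda>x. indicator E x * (grad u x \<bullet> N)"
  have frame: "norm (perp n) = 1" "norm N = 1" "perp n \<bullet> N = 0"
    using unit_normal \<sigma> by (auto simp: N_def)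
  have u_cont: "continuous_on UNIV (\<lambda>s. u (edge_point e n s))"
    using u by (intro continuous_on_compose2[OF C1D(3) continuous_edge_point]) (auto simp: C1c_iff)
  have [measurable]: "(\<lambda>s. u (edge_point e n s)) \<in> borel_measurable borel"
    by (rule borel_measurable_continuous_onI[OF u_cont])
  note I = integral_lborel_frame[OF frame set_lint_lborel(2)[OF cont], of ?m]
  have "(LINT x:E|lebesgue. grad u x \<bullet> N)
      = (\<integral>s. (\<integral>t. ?f (edge_point e n s + t *\<^sub>R N) \<partial>lborel) \<partial>lborel)"
    by (simp only: set_lint_lborel(1)[OF cont] I(2) edge_point_def)
  also have "\<dots> = (\<integral>s. - (indicator (edge_interval e) s * u (edge_point e n s)) \<partial>lborel)"
  proof (rule integral_cong_AE)
    \<comment> \<open>The lines through the endpoints are discarded: the parameter interval is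
      closed while the edge is open.\<close>
    have "AE s in lborel. s \<notin> {- edge_len e / 2, edge_len e / 2}"
      by (rule AE_not_in, rule finite_imp_null_set_lborel) simp
    then show "AE s in lborel. (\<integral>t. ?f (edge_point e n s + t *\<^sub>R N) \<partial>lborel)
        = - (indicator (edge_interval e) s * u (edge_point e n s))"
      using I(1)
    proof eventually_elim
      case (elim s)
      show ?case
      proof (cases "\<bar>s\<bar> < edge_len e / 2")
        case True
        then have "s \<in> edge_interval e" by (auto simp: edge_interval_def)
        with integral_line_crossing_edge[OF u True] elim(2) show ?thesis
          by (simp add: N_def edge_point_def)
      next
        case False
        with elim(1) have "s \<notin> edge_interval e" by (auto simp: edge_interval_def)
        have avoid: "?m + s *\<^sub>R perp n + t *\<^sub>R N \<notin> open_segment (fst e) (snd e)" for t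
        proof
          assume "?m + s *\<^sub>R perp n + t *\<^sub>R N \<in> open_segment (fst e) (snd e)"
          then obtain s' where s': "\<bar>s'\<bar> < edge_len e / 2"
              "?m + s *\<^sub>R perp n + t *\<^sub>R N = ?m + s' *\<^sub>R perp n"
            by (rule open_segmentE)
          then have "(?m + s *\<^sub>R perp n + t *\<^sub>R N) \<bullet> perp n = (?m + s' *\<^sub>R perp n) \<bullet> perp n" by (simp only:)
          moreover have "perp n \<bullet> perp n = 1" "N \<bullet> perp n = 0"
            using frame by (simp_all add: inner_commute flip: norm_eq_1)
          ultimately have "s = s'" by (simp add: inner_add_left)
          with s' False show False by simp
        qed
        show ?thesis
          using integral_line_avoiding_edge[OF u frame(2) avoid elim(2)] \<open>s \<notin> edge_interval e\<close>
          by (simp add: edge_point_def)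
      qed
    qed
    show "(\<lambda>s. \<integral>t. ?f (edge_point e n s + t *\<^sub>R N) \<partial>lborel) \<in> borel_measurable lborel"
      using I(3) by (simp add: edge_point_def)
  qed (simp add: edge_interval_def)
  also have "\<dots> = - (LINT s:edge_interval e|lebesgue. u (edge_point e n s))"
    by (simp add: set_lebesgue_integral_def integral_completion edge_interval_def)
  finally have "(LINT x:E|lebesgue. grad u x \<bullet> N) = - (LINT s:edge_interval e|lebesgue. u (edge_point e n s))" .
  moreover have "grad u x \<bullet> N = \<sigma> * (grad u x \<bullet> n)" for x by (simp add: N_def)
  ultimately show ?thesis using \<sigma> by (auto simp: outward_sign_eq set_lebesgue_integral_def)
qed

end

section \<open>Polynomial fields and the projection\<close>

lemma finite_midx: "finite (midx l)"
proof (rule finite_subset)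
  show "midx l \<subseteq> {..nat l} \<times> {..nat l}" by (auto simp: midx_def)
qed auto

lemma monom2_C1: "monom2 \<alpha> \<in> C1"
proof -
  have "(\<lambda>x. (x $ 1) ^ fst \<alpha> * (x $ 2) ^ snd \<alpha>) \<in> C1"
    by (intro C1_mult C1_power C1_component)
  then show ?thesis by (simp add: monom2_def[abs_def])
qed

lemma PolysE:
  assumes "f \<in> Polys l"
  obtains c where "f = (\<lambda>x. \<Sum>\<alpha>\<in>midx l. c \<alpha> * monom2 \<alpha> x)"
proof -
  obtain c where "\<forall>x. f x = (\<Sum>\<alpha>\<in>midx l. c \<alpha> * monom2 \<alpha> x)"
    using assms unfolding Polys_def by blast
  then show ?thesis by (intro that[of c]) (simp add: fun_eq_iff)
qed

lemma Polys_C1: "f \<in> Polys l \<Longrightarrow> f \<in> C1"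
  by (elim PolysE) (auto intro!: C1_sum C1_mult monom2_C1 C1_const)

lemma Polys_diff:
  assumes "f \<in> Polys l" "g \<in> Polys l" shows "(\<lambda>x. f x - g x) \<in> Polys l"
proof -
  obtain c where c: "f = (\<lambda>x. \<Sum>\<alpha>\<in>midx l. c \<alpha> * monom2 \<alpha> x)" using assms(1) by (rule PolysE)
  obtain d where d: "g = (\<lambda>x. \<Sum>\<alpha>\<in>midx l. d \<alpha> * monom2 \<alpha> x)" using assms(2) by (rule PolysE)
  show ?thesis
    unfolding Polys_def c d
    by (auto intro!: exI[of _ "\<lambda>\<alpha>. c \<alpha> - d \<alpha>"] simp: left_diff_distrib sum_subtractf)
qed

lemma vPolys_diff: "q \<in> vPolys l \<Longrightarrow> r \<in> vPolys l \<Longrightarrow> (\<lambda>x. q x - r x) \<in> vPolys l"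
  by (simp add: vPolys_def Polys_diff)

lemma vPolys_C1: "q \<in> vPolys l \<Longrightarrow> (\<lambda>x. q x $ i) \<in> C1"
  by (auto simp: vPolys_def intro: Polys_C1)

lemma continuous_on_vecI:
  fixes q :: "pt \<Rightarrow> pt"
  assumes "\<And>i. continuous_on A (\<lambda>x. q x $ i)"
  shows "continuous_on A q"
proof -
  have "continuous_on A (\<lambda>x. vec_lambda (\<lambda>i. q x $ i))" by (intro continuous_on_vec_lambda assms)
  then show ?thesis by simp
qed

lemma vPolys_continuous: "q \<in> vPolys l \<Longrightarrow> continuous_on UNIV q"
  by (intro continuous_on_vecI C1D(3) vPolys_C1)

text \<open>On the line from a point of S to x the polynomial becomes one in a single variable with
  infinitely many zeros, so it also vanishes at the parameter 1.\<close>

lemma Polys_zero_on_open: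
  assumes f: "f \<in> Polys l" and S: "open S" "S \<noteq> {}" and zero: "\<And>x. x \<in> S \<Longrightarrow> f x = 0"
  shows "f x = 0"
proof -
  obtain a where a: "a \<in> S" using S by auto
  obtain c where c: "f = (\<lambda>x. \<Sum>\<alpha>\<in>midx l. c \<alpha> * monom2 \<alpha> x)" using f by (rule PolysE)
  define p where "p = (\<Sum>\<alpha>\<in>midx l. smult (c \<alpha>) ([:a $ 1, (x - a) $ 1:] ^ fst \<alpha> * [:a $ 2, (x - a) $ 2:] ^ snd \<alpha>))"
  have p: "f (a + t *\<^sub>R (x - a)) = poly p t" for t
    by (simp add: c p_def poly_sum monom2_def)
  define T where "T = (\<lambda>t. a + t *\<^sub>R (x - a)) -` S"
  have "open T" unfolding T_def by (intro open_vimage S continuous_intros)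
  moreover have "0 \<in> T" using a by (simp add: T_def)
  ultimately have "infinite T"
    using finite_imp_not_open by blast
  moreover have "T \<subseteq> {t. poly p t = 0}" using zero by (auto simp: T_def simp flip: p)
  ultimately have "p = 0" using poly_roots_finite finite_subset by blast
  then show ?thesis using p[of 1] by simp
qed

context element_edge
begin

text \<open>The components of q along \<open>perp n\<close> and n are moved into the test function,
  which reduces the formula to \<open>green_tangential\<close> and
  \<open>green_normal\<close>.\<close>

lemma green_field:
  fixes q :: "pt \<Rightarrow> pt"
  assumes q: "\<And>i. (\<lambda>x. q x $ i) \<in> C1"
  shows "\<exists>d. continuous_on UNIV d \<and> (\<forall>\<phi>\<in>C1c U.
    (LINT x:E|lebesgue. q x \<bullet> grad \<phi> x) + (LINT x:E|lebesgue. d x * \<phi> x) =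
      outward_sign E e n * (LINT s:edge_interval e|lebesgue. (q (edge_point e n s) \<bullet> n) * \<phi> (edge_point e n s)))"
proof -
  have q_inner: "(\<lambda>x. q x \<bullet> a) \<in> C1" for a
    unfolding inner_2 by (intro C1_add C1_mult q C1_const)
  define q\<^sub>1 where "q\<^sub>1 x = q x \<bullet> perp n" for x
  define q\<^sub>2 where "q\<^sub>2 x = q x \<bullet> n" for x
  have C1q: "q\<^sub>1 \<in> C1" "q\<^sub>2 \<in> C1" using q_inner by (simp_all add: q\<^sub>1_def[abs_def] q\<^sub>2_def[abs_def])
  have q_cont: "continuous_on UNIV q"
    by (intro continuous_on_vecI C1D(3) q)
  \<comment> \<open>The divergence of q, computed in the orthonormal frame of the edge.\<close>
  define d where "d x = grad q\<^sub>1 x \<bullet> perp n + grad q\<^sub>2 x \<bullet> n" for x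
  have d_cont: "continuous_on UNIV d"
    unfolding d_def using C1D(2)[OF C1q(1)] C1D(2)[OF C1q(2)] by (intro continuous_intros)
  show ?thesis
  proof (intro exI[of _ d] conjI ballI d_cont)
    fix \<phi> assume \<phi>: "\<phi> \<in> C1c U"
    then have C1\<phi>: "\<phi> \<in> C1" by (simp add: C1c_iff)
    have test: "(\<lambda>x. \<phi> x * q\<^sub>1 x) \<in> C1c U" "(\<lambda>x. \<phi> x * q\<^sub>2 x) \<in> C1c U" by (intro C1c_mult \<phi> C1q)+
    then have C1test: "(\<lambda>x. \<phi> x * q\<^sub>1 x) \<in> C1" "(\<lambda>x. \<phi> x * q\<^sub>2 x) \<in> C1" by (simp_all add: C1c_iff)
    have pointwise: "q x \<bullet> grad \<phi> x + d x * \<phi> x =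
        grad (\<lambda>x. \<phi> x * q\<^sub>1 x) x \<bullet> perp n + grad (\<lambda>x. \<phi> x * q\<^sub>2 x) x \<bullet> n" for x
    proof -
      have "q x \<bullet> grad \<phi> x = (q\<^sub>1 x *\<^sub>R perp n + q\<^sub>2 x *\<^sub>R n) \<bullet> grad \<phi> x"
        using unit_frame[OF unit_normal, of "q x"] by (simp add: q\<^sub>1_def q\<^sub>2_def)
      then show ?thesis
        unfolding grad_mult[OF C1\<phi> C1q(1)] grad_mult[OF C1\<phi> C1q(2)] d_def
        by (simp add: inner_add_left inner_commute algebra_simps)
    qed
    have int: "integrable (lebesgue_on E) (\<lambda>x. q x \<bullet> grad \<phi> x)"
      "integrable (lebesgue_on E) (\<lambda>x. d x * \<phi> x)"
      "integrable (lebesgue_on E) (\<lambda>x. grad (\<lambda>x. \<phi> x * q\<^sub>1 x) x \<bullet> perp n)"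
      "integrable (lebesgue_on E) (\<lambda>x. grad (\<lambda>x. \<phi> x * q\<^sub>2 x) x \<bullet> n)"
      by (intro integrable_continuous continuous_intros q_cont d_cont
          C1D(2)[OF C1\<phi>] C1D(3)[OF C1\<phi>] C1D(2)[OF C1test(1)] C1D(2)[OF C1test(2)])+
    have "(LINT x:E|lebesgue. q x \<bullet> grad \<phi> x) + (LINT x:E|lebesgue. d x * \<phi> x) =
        (\<integral>x. q x \<bullet> grad \<phi> x + d x * \<phi> x \<partial>lebesgue_on E)"
      using int(1,2) by (simp add: set_lint_eq)
    also have "\<dots> = (LINT x:E|lebesgue. grad (\<lambda>x. \<phi> x * q\<^sub>1 x) x \<bullet> perp n) +
        (LINT x:E|lebesgue. grad (\<lambda>x. \<phi> x * q\<^sub>2 x) x \<bullet> n)"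
      unfolding pointwise using int(3,4) by (simp add: set_lint_eq)
    also have "\<dots> = outward_sign E e n * (LINT s:edge_interval e|lebesgue. \<phi> (edge_point e n s) * q\<^sub>2 (edge_point e n s))"
      using green_tangential[OF test(1)] green_normal[OF test(2)] by simp
    finally show "(LINT x:E|lebesgue. q x \<bullet> grad \<phi> x) + (LINT x:E|lebesgue. d x * \<phi> x) =
      outward_sign E e n * (LINT s:edge_interval e|lebesgue. (q (edge_point e n s) \<bullet> n) * \<phi> (edge_point e n s))"
      by (simp add: q\<^sub>2_def mult.commute)
  qed
qed

text \<open>The support lies in E, which is disjoint from the open edge; the endpoints follow by
  continuity.\<close>

lemma test_function_vanishes_on_edge:
  assumes "\<phi> \<in> C1c E" "s \<in> edge_interval e"
  shows "\<phi> (edge_point e n s) = 0"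
proof -
  let ?J = "{- edge_len e / 2 <..< edge_len e / 2}"
  have "\<phi> \<in> C1" using assms by (simp add: C1c_iff)
  then have "continuous_on UNIV (\<lambda>s. \<phi> (edge_point e n s))"
    by (intro continuous_on_compose2[OF C1D(3) continuous_edge_point]) auto
  then have "closed ((\<lambda>s. \<phi> (edge_point e n s)) -` {0})"
    by (intro closed_vimage) auto
  moreover have "?J \<subseteq> (\<lambda>s. \<phi> (edge_point e n s)) -` {0}"
  proof
    fix s assume "s \<in> ?J"
    then have "edge_point e n s \<in> open_segment (fst e) (snd e)"
      unfolding open_segment_edge_point[OF unit_normal orth nondeg] by (rule imageI)
    then have "edge_point e n s \<notin> E" using edge_Int_E by blast
    then show "s \<in> (\<lambda>s. \<phi> (edge_point e n s)) -` {0}"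
      using assms(1) closure_subset[of "{x. \<phi> x \<noteq> 0}"] by (auto simp: C1c_iff)
  qed
  ultimately have "closure ?J \<subseteq> (\<lambda>s. \<phi> (edge_point e n s)) -` {0}" by (rule closure_minimal[rotated])
  moreover have "closure ?J = edge_interval e"
    unfolding edge_interval_def using edge_len_pos by (intro closure_greaterThanLessThan) simp
  ultimately show ?thesis using assms(2) by auto
qed

text \<open>Test functions supported in E are admissible in the Green formula of the edge and vanish
  on it, so the function d obtained at one edge is a weak divergence on all of E.\<close>

lemma normal_trace_C1_field:
  fixes q :: "pt \<Rightarrow> pt"
  assumes q: "\<And>i. (\<lambda>x. q x $ i) \<in> C1"
  shows "\<exists>d. weak_div E q d" and "normal_trace E e n q (\<lambda>s. q (edge_point e n s) \<bullet> n)"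
proof -
  obtain d where d: "continuous_on UNIV d"
    "\<And>\<phi>. \<phi> \<in> C1c U \<Longrightarrow> (LINT x:E|lebesgue. q x \<bullet> grad \<phi> x) + (LINT x:E|lebesgue. d x * \<phi> x) =
      outward_sign E e n * (LINT s:edge_interval e|lebesgue. (q (edge_point e n s) \<bullet> n) * \<phi> (edge_point e n s))"
    using green_field[OF q] by blast
  have wd: "weak_div E q d"
    unfolding weak_div_def
  proof (intro conjI ballI)
    show "square_integrable E d" by (rule square_integrable_continuous[OF d(1)])
    fix \<phi> assume \<phi>: "\<phi> \<in> C1c E"
    then have "\<phi> \<in> C1c U" using E_subset_U by (auto simp: C1c_iff)
    moreover have "(LINT s:edge_interval e|lebesgue. (q (edge_point e n s) \<bullet> n) * \<phi> (edge_point e n s)) = 0"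
      unfolding set_lebesgue_integral_def
      using test_function_vanishes_on_edge[OF \<phi>] by (intro integral_eq_zero_AE AE_I2) (auto simp: indicator_def)
    ultimately show "(LINT x:E|lebesgue. q x \<bullet> grad \<phi> x) = - (LINT x:E|lebesgue. d x * \<phi> x)"
      using d(2)[of \<phi>] by simp
  qed
  then show "\<exists>d. weak_div E q d" by blast
  have q_cont: "continuous_on UNIV q" by (intro continuous_on_vecI C1D(3) q)
  then have "continuous_on (edge_interval e) (\<lambda>s. q (edge_point e n s) \<bullet> n)"
    by (intro continuous_intros continuous_on_compose2[OF q_cont continuous_edge_point]) auto
  then have "set_integrable lborel (edge_interval e) (\<lambda>s. q (edge_point e n s) \<bullet> n)"
    unfolding set_integrable_def edge_interval_def by (intro borel_integrable_compact) auto
  then have si: "set_integrable lebesgue (edge_interval e) (\<lambda>s. q (edge_point e n s) \<bullet> n)"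
    unfolding set_integrable_def by (subst integrable_completion) auto
  show "normal_trace E e n q (\<lambda>s. q (edge_point e n s) \<bullet> n)"
    unfolding normal_trace_def
  proof (intro conjI ballI si)
    fix \<phi> assume \<phi>: "\<phi> \<in> C1c (- (frontier E - open_segment (fst e) (snd e)))"
    then have "\<phi> \<in> C1" "\<phi> \<in> C1c U" by (simp_all add: C1c_iff U_def)
    then show "(LINT x:E|lebesgue. q x \<bullet> grad \<phi> x + divg E q x * \<phi> x) =
        outward_sign E e n * (LINT s:edge_interval e|lebesgue. (q (edge_point e n s) \<bullet> n) * \<phi> (edge_point e n s))"
      using normal_trace_divg_cong[OF square_integrable_continuous[OF q_cont] wd] d(2) by simp
  qed
qed

end

section \<open>The L2 projection onto polynomial fields\<close>

context bounded_open_set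
begin

text \<open>Gram--Schmidt; the functions \<open>b i\<close> need not be linearly independent.\<close>

lemma ex_L2_projection:
  fixes b :: "'i \<Rightarrow> pt \<Rightarrow> real"
  assumes "finite I" "\<And>i. i \<in> I \<Longrightarrow> square_integrable E (b i)" "square_integrable E v"
  shows "\<exists>c. square_integrable E (\<lambda>x. v x - (\<Sum>j\<in>I. c j * b j x)) \<and>
    (\<forall>i\<in>I. (\<integral>x. (v x - (\<Sum>j\<in>I. c j * b j x)) * b i x \<partial>lebesgue_on E) = 0)"
  using assms
proof (induction I arbitrary: v rule: finite_induct)
  case empty
  then show ?case by simp
next
  case (insert k I)
  define B where "B f g = (\<integral>x. f x * g x \<partial>lebesgue_on E)" for f g :: "pt \<Rightarrow> real"
  have bI: "square_integrable E (b i)" if "i \<in> I" for i using insert.prems that by auto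
  have bk: "square_integrable E (b k)" using insert.prems by auto
  obtain c where c: "square_integrable E (\<lambda>x. v x - (\<Sum>j\<in>I. c j * b j x))"
      "\<And>i. i \<in> I \<Longrightarrow> B (\<lambda>x. v x - (\<Sum>j\<in>I. c j * b j x)) (b i) = 0"
    using insert.IH[OF bI insert.prems(2)] unfolding B_def by blast
  obtain d where d: "square_integrable E (\<lambda>x. b k x - (\<Sum>j\<in>I. d j * b j x))"
      "\<And>i. i \<in> I \<Longrightarrow> B (\<lambda>x. b k x - (\<Sum>j\<in>I. d j * b j x)) (b i) = 0"
    using insert.IH[OF bI bk] unfolding B_def by blast
  define w where "w x = v x - (\<Sum>j\<in>I. c j * b j x)" for x
  define b' where "b' x = b k x - (\<Sum>j\<in>I. d j * b j x)" for x
  have w: "square_integrable E w" and b': "square_integrable E b'"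
    and Bw: "\<And>i. i \<in> I \<Longrightarrow> B w (b i) = 0" and Bb': "\<And>i. i \<in> I \<Longrightarrow> B b' (b i) = 0"
    using c d by (simp_all add: w_def[abs_def] b'_def[abs_def])
  \<comment> \<open>The coefficient of the residual w along b', the part of b_k that is orthogonal
    to the earlier functions.\<close>
  define t where "t = B w b' / B b' b'"
  define r where "r x = w x - t * b' x" for x
  have tb': "square_integrable E (\<lambda>x. t * b' x)"
    using b' by (auto simp: square_integrable_iff power_mult_distrib abs_mult)
  then have r: "square_integrable E r"
    unfolding r_def using w by (intro square_integrable_diff)
  have Br: "B r f = B w f - t * B b' f" if "square_integrable E f" for f
    using square_integrable_mult[OF w that] square_integrable_mult[OF b' that]
    by (simp add: B_def r_def left_diff_distrib mult.assoc)
  \<comment> \<open>If b_k depends on the earlier functions, then b' vanishes almost everywhere and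
    the numerator of t is 0 too, so the value 0 that division by zero gives to t is
    admissible.\<close>
  have "B w b' = 0" if "B b' b' = 0"
  proof -
    have "AE x in lebesgue_on E. b' x * b' x = 0"
      using integral_nonneg_eq_0_iff_AE[OF square_integrable_mult[OF b' b']] that by (simp add: B_def)
    then have "AE x in lebesgue_on E. w x * b' x = 0" by eventually_elim simp
    then show ?thesis unfolding B_def by (rule integral_eq_zero_AE)
  qed
  then have Brb': "B r b' = 0" by (auto simp: Br[OF b'] t_def)
  have BrI: "B r (b i) = 0" if "i \<in> I" for i
    using that by (simp add: Br[OF bI] Bw Bb')
  have Brk: "B r (b k) = 0"
  proof -
    have "B r (b k) = (\<integral>x. r x * b' x + (\<Sum>j\<in>I. d j * (r x * b j x)) \<partial>lebesgue_on E)"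
      by (simp add: B_def b'_def algebra_simps sum_distrib_left)
    also have "\<dots> = B r b' + (\<Sum>j\<in>I. d j * B r (b j))"
      unfolding B_def using square_integrable_mult[OF r b'] square_integrable_mult[OF r bI] by simp
    finally show ?thesis by (simp add: Brb' BrI)
  qed
  \<comment> \<open>The coefficients of the final approximation with respect to the original
    functions, after expanding b'.\<close>
  define c' where "c' j = (if j = k then t else c j - t * d j)" for j
  have "(\<Sum>j\<in>insert k I. c' j * b j x) = t * b k x + (\<Sum>j\<in>I. (c j - t * d j) * b j x)" for x
    using insert.hyps by (auto simp: c'_def intro!: sum.cong)
  then have "v x - (\<Sum>j\<in>insert k I. c' j * b j x) = r x" for x
    by (simp add: r_def w_def b'_def algebra_simps sum_distrib_left sum_subtractf)
  then show ?case
    using r BrI Brk by (intro exI[of _ c']) (auto simp: B_def)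
qed

lemma vPolys_square_integrable: "q \<in> vPolys l \<Longrightarrow> square_integrable E q"
  by (intro square_integrable_continuous vPolys_continuous)

text \<open>Each component is projected separately onto the span of the monomials; orthogonality to
  the monomials passes to all polynomial fields by linearity.\<close>

lemma ex_vPolys_projection:
  fixes v :: "pt \<Rightarrow> pt"
  assumes v: "square_integrable E v"
  shows "\<exists>q\<in>vPolys l. \<forall>r\<in>vPolys l. (LINT x:E|lebesgue. (v x - q x) \<bullet> r x) = 0"
proof -
  have mono: "square_integrable E (monom2 \<alpha>)" for \<alpha>
    by (intro square_integrable_continuous C1D(3) monom2_C1)
  have "\<forall>i. \<exists>c. square_integrable E (\<lambda>x. v x $ i - (\<Sum>\<alpha>\<in>midx l. c \<alpha> * monom2 \<alpha> x)) \<and>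
    (\<forall>\<beta>\<in>midx l. (\<integral>x. (v x $ i - (\<Sum>\<alpha>\<in>midx l. c \<alpha> * monom2 \<alpha> x)) * monom2 \<beta> x \<partial>lebesgue_on E) = 0)"
    by (intro allI ex_L2_projection finite_midx mono square_integrable_component v)
  from choice[OF this] obtain c where c': "\<forall>i. square_integrable E (\<lambda>x. v x $ i - (\<Sum>\<alpha>\<in>midx l. c i \<alpha> * monom2 \<alpha> x)) \<and>
    (\<forall>\<beta>\<in>midx l. (\<integral>x. (v x $ i - (\<Sum>\<alpha>\<in>midx l. c i \<alpha> * monom2 \<alpha> x)) * monom2 \<beta> x \<partial>lebesgue_on E) = 0)" ..
  have c: "square_integrable E (\<lambda>x. v x $ i - (\<Sum>\<alpha>\<in>midx l. c i \<alpha> * monom2 \<alpha> x))"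
    "\<And>\<beta>. \<beta> \<in> midx l \<Longrightarrow> (\<integral>x. (v x $ i - (\<Sum>\<alpha>\<in>midx l. c i \<alpha> * monom2 \<alpha> x)) * monom2 \<beta> x \<partial>lebesgue_on E) = 0" for i
    using c' by blast+
  define q :: "pt \<Rightarrow> pt" where "q x = vec_lambda (\<lambda>i. \<Sum>\<alpha>\<in>midx l. c i \<alpha> * monom2 \<alpha> x)" for x
  have "q \<in> vPolys l" by (auto simp: vPolys_def Polys_def q_def)
  moreover have "(LINT x:E|lebesgue. (v x - q x) \<bullet> r x) = 0" if "r \<in> vPolys l" for r
  proof -
    have *: "integrable (lebesgue_on E) (\<lambda>x. (v x - q x) $ i * r x $ i)"
      "(\<integral>x. (v x - q x) $ i * r x $ i \<partial>lebesgue_on E) = 0" for i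
    proof -
      have "(\<lambda>x. r x $ i) \<in> Polys l" using that by (simp add: vPolys_def)
      then obtain a where a: "(\<lambda>x. r x $ i) = (\<lambda>x. \<Sum>\<alpha>\<in>midx l. a \<alpha> * monom2 \<alpha> x)" by (rule PolysE)
      have eq: "(v x - q x) $ i * r x $ i = (\<Sum>\<beta>\<in>midx l. a \<beta> *
          ((v x $ i - (\<Sum>\<alpha>\<in>midx l. c i \<alpha> * monom2 \<alpha> x)) * monom2 \<beta> x))" for x
        using fun_cong[OF a, of x] by (simp add: q_def sum_distrib_left sum_distrib_right mult_ac)
      show "integrable (lebesgue_on E) (\<lambda>x. (v x - q x) $ i * r x $ i)"
        unfolding eq by (intro Bochner_Integration.integrable_sum integrable_mult_right square_integrable_mult c(1) mono)
      show "(\<integral>x. (v x - q x) $ i * r x $ i \<partial>lebesgue_on E) = 0"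
        unfolding eq using square_integrable_mult[OF c(1) mono] c(2) by simp
    qed
    then show ?thesis unfolding set_lint_eq inner_2 by simp
  qed
  ultimately show ?thesis by blast
qed

text \<open>The difference of two candidates is orthogonal to itself, hence zero almost everywhere
  on E, everywhere on the open set E by continuity, and on the plane as a polynomial. The last step
  matters because \<open>proj\<close> selects a field on the whole plane.\<close>

lemma vPolys_projection_unique:
  assumes ne: "E \<noteq> {}" and v: "square_integrable E v" and q: "q \<in> vPolys l" "q' \<in> vPolys l"
    and orth: "\<And>r. r \<in> vPolys l \<Longrightarrow> (LINT x:E|lebesgue. (v x - q x) \<bullet> r x) = 0"
      "\<And>r. r \<in> vPolys l \<Longrightarrow> (LINT x:E|lebesgue. (v x - q' x) \<bullet> r x) = 0"
  shows "q = q'"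
proof -
  define r where "r x = q x - q' x" for x
  have r: "r \<in> vPolys l" unfolding r_def by (rule vPolys_diff[OF q])
  have r_cont: "continuous_on UNIV r" by (rule vPolys_continuous[OF r])
  have int: "integrable (lebesgue_on E) (\<lambda>x. (v x - p x) \<bullet> r x)" if "p \<in> vPolys l" for p
    by (intro square_integrable_inner square_integrable_diff v
        vPolys_square_integrable[OF that] vPolys_square_integrable[OF r])
  have "(\<integral>x. r x \<bullet> r x \<partial>lebesgue_on E) = (\<integral>x. (v x - q' x) \<bullet> r x - (v x - q x) \<bullet> r x \<partial>lebesgue_on E)"
    by (simp add: r_def algebra_simps inner_diff_left)
  also have "\<dots> = 0"
    using int q orth[OF r] by (simp add: set_lint_eq)
  finally have "AE x in lebesgue_on E. r x \<bullet> r x = 0"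
    by (subst (asm) integral_nonneg_eq_0_iff_AE)
      (auto intro!: square_integrable_inner vPolys_square_integrable r)
  then have "AE x in lebesgue. x \<in> E \<longrightarrow> r x = 0"
    by (subst (asm) AE_restrict_space_iff) auto
  then have AE: "AE x in lebesgue. x \<notin> E \<inter> (r -` (- {0}))" by eventually_elim auto
  have op: "open (E \<inter> (r -` (- {0})))"
    using open_E r_cont by (intro open_Int open_vimage) auto
  then have "E \<inter> (r -` (- {0})) \<in> sets lebesgue" by simp
  from AE_iff_null_sets[OF this] AE have "negligible (E \<inter> (r -` (- {0})))"
    by (simp add: negligible_iff_null_sets)
  with op have "E \<inter> (r -` (- {0})) = {}" using open_not_negligible by blast
  then have zero: "r x = 0" if "x \<in> E" for x using that by blast
  have "r x $ i = 0" for x i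
  proof (rule Polys_zero_on_open[OF _ open_E ne, of "\<lambda>x. r x $ i"])
    show "(\<lambda>x. r x $ i) \<in> Polys l" using r by (simp add: vPolys_def)
    show "r x $ i = 0" if "x \<in> E" for x using zero[OF that] by simp
  qed
  then have "r x = 0" for x by (simp add: vec_eq_iff)
  then show ?thesis by (simp add: r_def fun_eq_iff)
qed

end

lemma proj_spec:
  assumes P: "bounded_open_set (elem P)" "elem P \<noteq> {}" and v: "square_integrable (elem P) v"
  shows proj_vPolys: "proj k P v \<in> vPolys (int k)"
    and proj_orthogonal: "r \<in> vPolys (int k) \<Longrightarrow> (LINT x:elem P|lebesgue. (v x - proj k P v x) \<bullet> r x) = 0"
proof -
  interpret bounded_open_set "elem P" by (rule P)
  have "\<exists>!q. q \<in> vPolys (int k) \<and> (\<forall>r\<in>vPolys (int k). (LINT x:elem P|lebesgue. (v x - q x) \<bullet> r x) = 0)"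
    using ex_vPolys_projection[OF v] vPolys_projection_unique[OF P(2) v] by blast
  from theI'[OF this] show "proj k P v \<in> vPolys (int k)"
    "r \<in> vPolys (int k) \<Longrightarrow> (LINT x:elem P|lebesgue. (v x - proj k P v x) \<bullet> r x) = 0"
    unfolding proj_def by blast+
qed

text \<open>The difference of the two projections satisfies the orthogonality that characterises the
  projection of v - w.\<close>

lemma proj_diff:
  assumes P: "bounded_open_set (elem P)" "elem P \<noteq> {}"
    and v: "square_integrable (elem P) v" and w: "square_integrable (elem P) w"
  shows "proj k P (\<lambda>x. v x - w x) x = proj k P v x - proj k P w x"
proof -
  interpret bounded_open_set "elem P" by (rule P)
  have vw: "square_integrable (elem P) (\<lambda>x. v x - w x)" by (rule square_integrable_diff[OF v w])
  note p = proj_spec[OF P]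
  have "proj k P (\<lambda>x. v x - w x) = (\<lambda>x. proj k P v x - proj k P w x)"
  proof (rule vPolys_projection_unique[OF P(2) vw p(1)[OF vw] vPolys_diff[OF p(1)[OF v] p(1)[OF w]] p(2)[OF vw]])
    fix r assume r: "r \<in> vPolys (int k)"
    have int: "integrable (lebesgue_on (elem P)) (\<lambda>x. (u x - proj k P u x) \<bullet> r x)"
      if "square_integrable (elem P) u" for u
      by (intro square_integrable_inner square_integrable_diff vPolys_square_integrable[OF p(1)] vPolys_square_integrable[OF r] that)
    have "(\<integral>x. (v x - w x - (proj k P v x - proj k P w x)) \<bullet> r x \<partial>lebesgue_on (elem P)) =
      (\<integral>x. (v x - proj k P v x) \<bullet> r x - (w x - proj k P w x) \<bullet> r x \<partial>lebesgue_on (elem P))"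
      by (simp add: inner_diff_left algebra_simps)
    also have "\<dots> = 0"
      using int[OF v] int[OF w] p(2)[OF v r] p(2)[OF w r] by (simp add: set_lint_eq)
    finally show "(LINT x:elem P|lebesgue. (v x - w x - (proj k P v x - proj k P w x)) \<bullet> r x) = 0"
      by (simp add: set_lint_eq)
  qed auto
  then show ?thesis by simp
qed

section \<open>Polygons\<close>

text \<open>Recognises the inside after the transport from the complex plane. No point of B is
  inside, since its component contains the unbounded connected set B; the component of a point of A
  cannot leave A, because A and B are open and disjoint.\<close>

lemma inside_unique:
  fixes S :: "'a::real_normed_vector set"
  assumes A: "open A" "bounded A" and B: "open B" "connected B" "\<not> bounded B"
    and AB: "A \<inter> B = {}" "A \<union> B = - S"
  shows "inside S = A"
proof (intro equalityI subsetI)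
  fix x assume "x \<in> inside S"
  then have x: "x \<notin> S" "bounded (connected_component_set (- S) x)" by (auto simp: inside_def)
  have "x \<notin> B"
  proof
    assume "x \<in> B"
    then have "B \<subseteq> connected_component_set (- S) x"
      using AB B by (intro connected_component_maximal) auto
    with x B show False using bounded_subset by blast
  qed
  with x AB show "x \<in> A" by auto
next
  fix x assume x: "x \<in> A"
  have "connected_component_set (- S) x \<subseteq> A"
  proof (rule ccontr)
    assume not: "\<not> connected_component_set (- S) x \<subseteq> A"
    have sub: "connected_component_set (- S) x \<subseteq> A \<union> B"
      using connected_component_subset AB(2) by blast
    have "x \<in> connected_component_set (- S) x"
      using x AB by (auto simp: connected_component_refl_eq)
    then show False
      using connectedD[OF connected_connected_component[of "- S" x] A(1) B(1)] sub not x AB(1) by blast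
  qed
  then show "x \<in> inside S" using x AB A(2) bounded_subset by (auto simp: inside_def)
qed

text \<open>The Jordan curve theorem of the library is stated for paths in the complex plane.\<close>

lemma Jordan_inside_pt:
  fixes c :: "real \<Rightarrow> pt"
  assumes c: "simple_path c" "pathfinish c = pathstart c"
  obtains B where "open (inside (path_image c))" "inside (path_image c) \<noteq> {}"
    "bounded (inside (path_image c))" "open B" "inside (path_image c) \<inter> B = {}"
    "inside (path_image c) \<union> B = - path_image c"
    "path_image c \<subseteq> closure (inside (path_image c))" "path_image c \<subseteq> closure B"
proof -
  define J where "J x = Complex (x $ 1) (x $ 2)" for x :: pt
  define K where "K z = (vector [Re z, Im z] :: pt)" for z
  have linJ: "linear J" by (intro linearI) (simp_all add: J_def complex_eq_iff)
  have linK: "linear K" by (intro linearI) (simp_all add: K_def vec_eq_iff forall_2)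
  have JK: "J (K z) = z" for z by (simp add: J_def K_def)
  have KJ: "K (J x) = x" for x by (simp add: J_def K_def vec_eq_iff forall_2)
  have injJ: "inj J" by (metis KJ injI)
  have injK: "inj K" by (metis JK injI)
  define S where "S = path_image c"
  have img: "path_image (J \<circ> c) = J ` S" by (simp add: path_image_compose S_def)
  \<comment> \<open>Images under K are preimages under J, so openness and the set identities of the
    Jordan theorem are pulled back along a continuous map.\<close>
  have vim: "K ` X = J -` X" for X
    by (auto simp: JK image_iff) (metis KJ)
  have simp': "simple_path (J \<circ> c)"
    using c(1) simple_path_linear_image_eq[OF linJ injJ] by simp
  have loop: "pathfinish (J \<circ> c) = pathstart (J \<circ> c)"
    using c(2) by (simp add: pathfinish_compose pathstart_compose)
  note jordan = Jordan_inside_outside[OF simp' loop, unfolded img]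
  define A where "A = K ` inside (J ` S)"
  define B where "B = K ` outside (J ` S)"
  have contJ: "continuous_on UNIV J" 
    using linJ linear_conv_bounded_linear linear_continuous_on by blast
  have contK: "continuous_on X K" for X
    using linK linear_conv_bounded_linear linear_continuous_on by blast
  have open_img: "open (K ` X)" if "open X" for X
    unfolding vim using that contJ by (rule open_vimage)
  have JS: "J -` (J ` S) = S" using injJ by (rule inj_vimage_image_eq)
  have A: "open A" "bounded A" "A \<noteq> {}" and B: "open B" "connected B"
    using jordan open_img linK
    by (auto simp: A_def B_def linear_conv_bounded_linear
        intro!: bounded_linear_image connected_continuous_image contK)
  have unB: "\<not> bounded B"
  proof
    assume "bounded B"
    then have "bounded (J ` B)" using linJ by (simp add: bounded_linear_image linear_conv_bounded_linear)
    then show False using jordan by (simp add: B_def image_image JK)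
  qed
  have AB: "A \<inter> B = {}" "A \<union> B = - S"
  proof -
    have "J -` (inside (J ` S) \<inter> outside (J ` S)) = {}" "J -` (inside (J ` S) \<union> outside (J ` S)) = J -` (- J ` S)"
      using jordan by simp_all
    then show "A \<inter> B = {}" "A \<union> B = - S"
      unfolding A_def B_def vim vimage_Int vimage_Un vimage_Compl JS by auto
  qed
  have cl: "K ` closure X = closure (K ` X)" for X
    by (rule closure_injective_linear_image[OF linK injK])
  have KJS: "K ` J ` S = S" by (simp add: image_image KJ)
  have "J ` S \<subseteq> closure (inside (J ` S))" "J ` S \<subseteq> closure (outside (J ` S))"
    using jordan unfolding frontier_def by blast+
  from this[THEN image_mono[where f = K]] have "S \<subseteq> closure A" "S \<subseteq> closure B"
    by (simp_all add: A_def B_def cl KJS)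
  moreover have "inside S = A" by (rule inside_unique[OF A(1,2) B unB AB])
  ultimately show ?thesis
    using A B AB by (intro that[of B]) (simp_all add: S_def[symmetric])
qed

section \<open>Edges of a simple closed polyline and their two sides\<close>

lemma polyline_ends: 
  "xs \<noteq> [] \<Longrightarrow> pathstart (polyline xs) = hd xs" "xs \<noteq> [] \<Longrightarrow> pathfinish (polyline xs) = last xs"
  by (induction xs rule: polyline.induct) simp_all

text \<open>Each join meets the next piece only in the common vertex, so it adds a closed set that
  misses the open edge. The claims about \<open>hd\<close> and \<open>last\<close> concern the
  points where further segments are attached: the induction uses the first, the closing segment of a
  polygon both.\<close>

lemma arc_polyline_edge:
  assumes "arc (polyline xs)" "(a, b) \<in> set (zip xs (tl xs))"
  shows "a \<noteq> b \<and> hd xs \<notin> open_segment a b \<and> last xs \<notin> open_segment a b \<and>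
    (\<exists>T. closed T \<and> path_image (polyline xs) = closed_segment a b \<union> T \<and> T \<inter> open_segment a b = {})"
  using assms
proof (induction xs rule: polyline.induct)
  case (3 u v)
  then have "a = u" "b = v" by auto
  moreover have "u \<noteq> v" using arc_distinct_ends[OF 3(1)] by simp
  ultimately show ?case by (auto intro!: exI[of _ "{}"] simp: open_segment_def)
next
  case (4 u v w xs)
  let ?R = "polyline (v # w # xs)"
  have R: "arc (linepath u v)" "arc ?R" "closed_segment u v \<inter> path_image ?R \<subseteq> {v}"
    using 4(2) arc_join_eq[of "linepath u v" ?R] by (auto simp: polyline_ends)
  have uv: "u \<noteq> v" using R(1) arc_distinct_ends by fastforce
  have img: "path_image (polyline (u # v # w # xs)) = closed_segment u v \<union> path_image ?R"
    by (simp add: path_image_join polyline_ends)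
  have last_R: "last (u # v # w # xs) \<in> path_image ?R"
    using pathfinish_in_path_image[of ?R] by (simp add: polyline_ends)
  have closed_R: "closed (path_image ?R)" by (rule closed_arc_image[OF R(2)])
  consider "a = u" "b = v" | "(a, b) \<in> set (zip (v # w # xs) (tl (v # w # xs)))"
    using 4(3) by auto
  then show ?case
  proof cases
    case 1
    have ends: "u \<notin> open_segment u v" "v \<notin> open_segment u v" by (auto simp: open_segment_def)
    have disj: "path_image ?R \<inter> open_segment u v = {}"
      using R(3) ends segment_open_subset_closed[of u v] by blast
    then show ?thesis
      unfolding 1 img using uv ends last_R closed_R by auto
  next
    case 2
    then obtain T where T: "a \<noteq> b" "v \<notin> open_segment a b" "last (v # w # xs) \<notin> open_segment a b" "closed T"
      "path_image ?R = closed_segment a b \<union> T" "T \<inter> open_segment a b = {}"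
      using 4(1)[OF R(2)] by auto
    have "open_segment a b \<subseteq> path_image ?R"
      using T(5) segment_open_subset_closed[of a b] by blast
    then have disj: "closed_segment u v \<inter> open_segment a b = {}"
      using R(3) T(2) by blast
    then have "u \<notin> open_segment a b" by auto
    then show ?thesis
      unfolding img using T disj
      by (intro conjI exI[of _ "closed_segment u v \<union> T"]) auto
  qed
qed auto

text \<open>Without its first edge the loop is an arc from v back to u. The first edge meets this
  arc in its endpoints only, and every other edge is an edge of the arc.\<close>

lemma polygon_edge:
  assumes P: "is_polygon P" and ab: "(a, b) \<in> edges P"
  shows "a \<noteq> b" "open_segment a b \<subseteq> path_image (bdry_path P)"
    "closed (path_image (bdry_path P) - open_segment a b)"
proof -
  obtain u v w xs where P_eq: "P = u # v # w # xs"
    using P by (auto simp: is_polygon_def numeral_3_eq_3 Suc_le_length_iff)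
  let ?R = "polyline (v # w # xs @ [u])"
  have bdry: "bdry_path P = linepath u v +++ ?R" by (simp add: bdry_path_def P_eq)
  have ends: "pathstart ?R = v" "pathfinish ?R = u" by (simp_all add: polyline_ends)
  have "simple_path (linepath u v +++ ?R)" using P by (simp add: is_polygon_def bdry)
  then have R: "arc (linepath u v)" "arc ?R" "closed_segment u v \<inter> path_image ?R \<subseteq> {u, v}"
    by (auto simp: simple_path_join_loop_eq ends)
  have uv: "u \<noteq> v" using R(1) arc_distinct_ends by fastforce
  have img: "path_image (bdry_path P) = closed_segment u v \<union> path_image ?R"
    by (simp add: bdry path_image_join ends)
  have "a \<noteq> b \<and> (\<exists>T. closed T \<and> path_image (bdry_path P) = closed_segment a b \<union> T \<and> T \<inter> open_segment a b = {})"
  proof -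
    \<comment> \<open>\<open>rotate1\<close> pairs the last vertex with u, so the edges other than
      (u, v) are the consecutive pairs of the polyline from v back to u.\<close>
    consider "a = u" "b = v" | "(a, b) \<in> set (zip (v # w # xs @ [u]) (tl (v # w # xs @ [u])))"
      using ab zip_append1[of "w # xs" "[u]" "xs @ [u]"] by (auto simp: edges_def P_eq)
    then show ?thesis
    proof cases
      case 1
      have "u \<notin> open_segment u v" "v \<notin> open_segment u v" by (auto simp: open_segment_def)
      then have "path_image ?R \<inter> open_segment u v = {}"
        using R(3) segment_open_subset_closed[of u v] by blast
      then show ?thesis
        unfolding 1 img using uv closed_arc_image[OF R(2)] by auto
    next
      case 2
      from arc_polyline_edge[OF R(2) 2]
      obtain T where T: "a \<noteq> b" "v \<notin> open_segment a b" "u \<notin> open_segment a b" "closed T"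
        "path_image ?R = closed_segment a b \<union> T" "T \<inter> open_segment a b = {}"
        by auto
      have "open_segment a b \<subseteq> path_image ?R"
        using T(5) segment_open_subset_closed[of a b] by blast
      then have disj: "closed_segment u v \<inter> open_segment a b = {}"
        using R(3) T(2,3) by blast
      then show ?thesis
        unfolding img using T by (intro conjI exI[of _ "closed_segment u v \<union> T"]) auto
    qed
  qed
  then obtain T where T: "a \<noteq> b" "closed T" "path_image (bdry_path P) = closed_segment a b \<union> T"
    "T \<inter> open_segment a b = {}" by blast
  show "a \<noteq> b" by (rule T)
  show "open_segment a b \<subseteq> path_image (bdry_path P)"
    using T(3) segment_open_subset_closed[of a b] by blast
  have "path_image (bdry_path P) - open_segment a b = {a, b} \<union> T"
    using T(3,4) by (auto simp: open_segment_def)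
  then show "closed (path_image (bdry_path P) - open_segment a b)"
    using T(2) by (simp add: closed_Un)
qed

text \<open>A thin strip on either side of a compact piece of the open edge avoids the boundary, so it
  lies entirely inside or entirely outside.\<close>

lemma edge_strip:
  fixes A B S :: "pt set"
  assumes AB: "open A" "open B" "A \<inter> B = {}" "A \<union> B = - S"
    and n: "norm n = 1" and orth: "n \<bullet> (snd e - fst e) = 0" and nondeg: "fst e \<noteq> snd e"
    and rest: "closed (S - open_segment (fst e) (snd e))"
    and c: "0 \<le> c" "c < edge_len e / 2"
  obtains \<delta> where "\<delta> > 0"
    "\<And>\<rho>. \<bar>\<rho>\<bar> = 1 \<Longrightarrow> (\<forall>s t. \<bar>s\<bar> \<le> c \<longrightarrow> 0 < t \<longrightarrow> t < \<delta> \<longrightarrow> edge_point e n s + t *\<^sub>R (\<rho> *\<^sub>R n) \<in> A) \<or>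
         (\<forall>s t. \<bar>s\<bar> \<le> c \<longrightarrow> 0 < t \<longrightarrow> t < \<delta> \<longrightarrow> edge_point e n s + t *\<^sub>R (\<rho> *\<^sub>R n) \<in> B)"
proof -
  note seg = open_segment_edge_point[OF n orth nondeg]
  have "compact (edge_point e n ` {-c..c})"
    by (intro compact_continuous_image continuous_edge_point) simp
  moreover have "edge_point e n ` {-c..c} \<inter> (S - open_segment (fst e) (snd e)) = {}"
    using c unfolding seg by auto
  ultimately obtain \<delta> where \<delta>: "\<delta> > 0"
    "\<And>x y. x \<in> edge_point e n ` {-c..c} \<Longrightarrow> y \<in> S - open_segment (fst e) (snd e) \<Longrightarrow> \<delta> \<le> dist x y"
    using separate_compact_closed[OF _ rest] by metis
  show ?thesis
  proof (rule that[OF \<delta>(1)])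
    fix \<rho> :: real assume \<rho>: "\<bar>\<rho>\<bar> = 1"
    let ?f = "\<lambda>(s, t). edge_point e n s + t *\<^sub>R (\<rho> *\<^sub>R n)"
    let ?Q = "?f ` ({-c..c} \<times> {0<..<\<delta>})"
    have conn: "connected ?Q"
    proof (rule connected_continuous_image)
      show "continuous_on ({-c..c} \<times> {0<..<\<delta>}) ?f"
        unfolding case_prod_beta edge_point_def by (intro continuous_intros)
      show "connected ({-c..c} \<times> {0<..<\<delta>})" by (intro connected_Times) auto
    qed
    have "?Q \<subseteq> - S"
    proof clarify
      fix s t assume st: "s \<in> {-c..c}" "t \<in> {0<..<\<delta>}" "edge_point e n s + t *\<^sub>R (\<rho> *\<^sub>R n) \<in> S"
      let ?y = "edge_point e n s + t *\<^sub>R (\<rho> *\<^sub>R n)"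
      have "dist (edge_point e n s) ?y < \<delta>" using st n \<rho> by (simp add: dist_norm abs_mult)
      then have "?y \<in> open_segment (fst e) (snd e)" using \<delta>(2)[of "edge_point e n s" ?y] st by force
      then obtain s' where "?y = edge_point e n s'" unfolding seg by blast
      then have "(edge_point e n s + t *\<^sub>R (\<rho> *\<^sub>R n)) \<bullet> n = edge_point e n s' \<bullet> n" by (simp only:)
      then have "t * \<rho> = 0" using n by (auto simp: edge_point_def inner_add_left)
      then show False using st \<rho> by auto
    qed
    then have "?Q \<subseteq> A \<union> B" using AB by simp
    then have "A \<inter> ?Q = {} \<or> B \<inter> ?Q = {}"
      using connectedD[OF conn AB(1,2)] AB(3) by blast
    then have "?Q \<subseteq> A \<or> ?Q \<subseteq> B" using \<open>?Q \<subseteq> A \<union> B\<close> by blast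
    moreover have "edge_point e n s + t *\<^sub>R (\<rho> *\<^sub>R n) \<in> ?Q" if "\<bar>s\<bar> \<le> c" "0 < t" "t < \<delta>" for s t
      using that by (intro image_eqI[where x = "(s, t)"]) auto
    ultimately show "(\<forall>s t. \<bar>s\<bar> \<le> c \<longrightarrow> 0 < t \<longrightarrow> t < \<delta> \<longrightarrow> edge_point e n s + t *\<^sub>R (\<rho> *\<^sub>R n) \<in> A) \<or>
         (\<forall>s t. \<bar>s\<bar> \<le> c \<longrightarrow> 0 < t \<longrightarrow> t < \<delta> \<longrightarrow> edge_point e n s + t *\<^sub>R (\<rho> *\<^sub>R n) \<in> B)"
      by blast
  qed
qed

text \<open>Over a middle piece of the edge each side lies in A or in B. Both sides cannot lie in
  the same set, because the midpoint is a limit of points of the other one, so the sides are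
  opposite. Longer strips carry this from the midpoint to every point of the open edge.\<close>

lemma edge_sides:
  fixes A B S :: "pt set"
  assumes AB: "open A" "open B" "A \<inter> B = {}" "A \<union> B = - S"
    and cl: "S \<subseteq> closure A" "S \<subseteq> closure B"
    and n: "norm n = 1" and orth: "n \<bullet> (snd e - fst e) = 0" and nondeg: "fst e \<noteq> snd e"
    and seg_S: "open_segment (fst e) (snd e) \<subseteq> S"
    and rest: "closed (S - open_segment (fst e) (snd e))"
  obtains \<sigma> where "\<sigma> = 1 \<or> \<sigma> = (-1::real)"
    "\<And>s. \<bar>s\<bar> < edge_len e / 2 \<Longrightarrow> eventually (\<lambda>t. edge_point e n s + t *\<^sub>R (\<sigma> *\<^sub>R n) \<in> A) (at_right 0)"
    "\<And>s. \<bar>s\<bar> < edge_len e / 2 \<Longrightarrow> eventually (\<lambda>t. edge_point e n s - t *\<^sub>R (\<sigma> *\<^sub>R n) \<in> B) (at_right 0)"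
proof -
  let ?ev = "\<lambda>X \<rho> s. eventually (\<lambda>t. edge_point e n s + t *\<^sub>R (\<rho> *\<^sub>R n) \<in> X) (at_right (0::real))"
  note seg = open_segment_edge_point[OF n orth nondeg]
  have len: "edge_len e > 0" using nondeg by (simp add: edge_len_def)
  have evI: "?ev X \<rho> s" if "\<delta> > 0" "\<And>t. 0 < t \<Longrightarrow> t < \<delta> \<Longrightarrow> edge_point e n s + t *\<^sub>R (\<rho> *\<^sub>R n) \<in> X" for X \<rho> s \<delta>
    unfolding eventually_at_right_field using that by blast
  have not_both: "\<not> (?ev A \<rho> s \<and> ?ev B \<rho> s)" for \<rho> s
  proof
    assume "?ev A \<rho> s \<and> ?ev B \<rho> s"
    then have "eventually (\<lambda>t. edge_point e n s + t *\<^sub>R (\<rho> *\<^sub>R n) \<in> A \<and>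
        edge_point e n s + t *\<^sub>R (\<rho> *\<^sub>R n) \<in> B) (at_right 0)"
      by (simp add: eventually_conj_iff)
    then have "eventually (\<lambda>t. False) (at_right (0::real))"
      by (rule eventually_mono) (use AB(3) in blast)
    then show False by simp
  qed
  \<comment> \<open>The strip over [-|s|, |s|] contains short normals at 0 and at s, so both of them
    see the same set.\<close>
  have same: "?ev X \<rho> s" if X: "X = A \<or> X = B" and \<rho>: "\<bar>\<rho>\<bar> = 1" and ev0: "?ev X \<rho> 0" and s: "\<bar>s\<bar> < edge_len e / 2" for X \<rho> s
  proof -
    obtain \<delta> where \<delta>: "\<delta> > 0"
      "(\<forall>s' t. \<bar>s'\<bar> \<le> \<bar>s\<bar> \<longrightarrow> 0 < t \<longrightarrow> t < \<delta> \<longrightarrow> edge_point e n s' + t *\<^sub>R (\<rho> *\<^sub>R n) \<in> A) \<or>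
         (\<forall>s' t. \<bar>s'\<bar> \<le> \<bar>s\<bar> \<longrightarrow> 0 < t \<longrightarrow> t < \<delta> \<longrightarrow> edge_point e n s' + t *\<^sub>R (\<rho> *\<^sub>R n) \<in> B)"
      by (rule edge_strip[OF AB n orth nondeg rest abs_ge_zero s]) (use \<rho> in blast)
    from \<delta>(2) have "(?ev A \<rho> 0 \<and> ?ev A \<rho> s) \<or> (?ev B \<rho> 0 \<and> ?ev B \<rho> s)"
      using evI[OF \<delta>(1)] by (metis abs_ge_zero abs_zero order_refl)
    with X ev0 not_both show ?thesis by blast
  qed
  obtain \<delta> where \<delta>: "\<delta> > 0"
    "\<And>\<rho>. \<bar>\<rho>\<bar> = 1 \<Longrightarrow> (\<forall>s t. \<bar>s\<bar> \<le> edge_len e / 4 \<longrightarrow> 0 < t \<longrightarrow> t < \<delta> \<longrightarrow> edge_point e n s + t *\<^sub>R (\<rho> *\<^sub>R n) \<in> A) \<or>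
         (\<forall>s t. \<bar>s\<bar> \<le> edge_len e / 4 \<longrightarrow> 0 < t \<longrightarrow> t < \<delta> \<longrightarrow> edge_point e n s + t *\<^sub>R (\<rho> *\<^sub>R n) \<in> B)"
    by (rule edge_strip[OF AB n orth nondeg rest, of "edge_len e / 4"]) (use len in auto)
  \<comment> \<open>In coordinates along and across the edge, a point close to the midpoint lies on
    the edge or in one of the two strips. With both strips in Y nothing is left there for X.\<close>
  have not_twice: False
    if XY: "X \<inter> Y = {}" "X \<inter> S = {}" "S \<subseteq> closure X"
      and Y: "\<And>\<rho>. \<bar>\<rho>\<bar> = 1 \<Longrightarrow> \<forall>s t. \<bar>s\<bar> \<le> edge_len e / 4 \<longrightarrow> 0 < t \<longrightarrow> t < \<delta> \<longrightarrow> edge_point e n s + t *\<^sub>R (\<rho> *\<^sub>R n) \<in> Y"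
    for X Y
  proof -
    let ?m = "edge_point e n 0"
    have "?m \<in> open_segment (fst e) (snd e)" unfolding seg using len by (intro imageI) simp
    then have "?m \<in> closure X" using seg_S XY(3) by blast
    moreover define r where "r = min \<delta> (edge_len e / 4)"
    ultimately obtain y where y: "y \<in> X" "dist y ?m < r"
      using \<delta>(1) len unfolding closure_approachable by (metis min_less_iff_conj zero_less_divide_iff zero_less_numeral)
    define s where "s = (y - ?m) \<bullet> perp n"
    define t where "t = (y - ?m) \<bullet> n"
    have st: "\<bar>s\<bar> < r" "\<bar>t\<bar> < r"
      using Cauchy_Schwarz_ineq2[of "y - ?m" "perp n"] Cauchy_Schwarz_ineq2[of "y - ?m" n] n y(2)
      by (auto simp: s_def t_def dist_norm)
    have y_eq: "y = edge_point e n s + t *\<^sub>R n"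
      using unit_frame[OF n, of "y - ?m"] by (simp add: s_def t_def edge_point_def algebra_simps)
    show False
    proof (cases "t = 0")
      case True
      then have "y \<in> open_segment (fst e) (snd e)"
        unfolding seg y_eq using st len by (intro image_eqI[where x = s]) (auto simp: r_def)
      then show False using y(1) seg_S XY(2) by blast
    next
      case False
      have "edge_point e n s + \<bar>t\<bar> *\<^sub>R (sgn t *\<^sub>R n) \<in> Y"
        using Y[of "sgn t"] st False by (auto simp: r_def abs_sgn_eq)
      then have "y \<in> Y" by (simp add: y_eq abs_mult_sgn)
      then show False using y(1) XY(1) by blast
    qed
  qed
  let ?in = "\<lambda>X \<rho>. \<forall>s t. \<bar>s\<bar> \<le> edge_len e / 4 \<longrightarrow> 0 < t \<longrightarrow> t < \<delta> \<longrightarrow> edge_point e n s + t *\<^sub>R (\<rho> *\<^sub>R n) \<in> X"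
  have disj: "A \<inter> S = {}" "B \<inter> S = {}" using AB(4) by blast+
  have unit_cases: "\<rho> = 1 \<or> \<rho> = -1" if "\<bar>\<rho>\<bar> = 1" for \<rho> :: real using that by arith
  have "\<not> (?in A 1 \<and> ?in A (-1))"
    using not_twice[of B A] AB(3) disj(2) cl(2) unit_cases by blast
  moreover have "\<not> (?in B 1 \<and> ?in B (-1))"
    using not_twice[of A B] AB(3) disj(1) cl(1) unit_cases by blast
  moreover have "?in A 1 \<or> ?in B 1" by (rule \<delta>(2)) simp
  moreover have "?in A (-1) \<or> ?in B (-1)" by (rule \<delta>(2)) simp
  ultimately consider "?in A 1 \<and> ?in B (-1)" | "?in A (-1) \<and> ?in B 1" by blast
  then have "\<exists>\<sigma>. (\<sigma> = 1 \<or> \<sigma> = -1) \<and> ?in A \<sigma> \<and> ?in B (- \<sigma>)"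
  proof cases
    case 1
    then show ?thesis by blast
  next
    case 2
    then have "?in A (-1) \<and> ?in B (- (-1))" by (simp only: minus_minus)
    then show ?thesis by blast
  qed
  then obtain \<sigma> where \<sigma>: "\<sigma> = 1 \<or> \<sigma> = (-1::real)" "?in A \<sigma>" "?in B (- \<sigma>)"
    by blast
  have at_mid: "?ev X \<rho> 0" if "?in X \<rho>" for X \<rho>
    using that len by (intro evI[OF \<delta>(1)]) simp
  show ?thesis
  proof (rule that[OF \<sigma>(1)])
    fix s assume s: "\<bar>s\<bar> < edge_len e / 2"
    show "?ev A \<sigma> s"
      using \<sigma>(1) by (intro same[OF _ _ at_mid[OF \<sigma>(2)] s]) auto
    have "?ev B (- \<sigma>) s"
      using \<sigma>(1) by (intro same[OF _ _ at_mid[OF \<sigma>(3)] s]) auto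
    then show "eventually (\<lambda>t. edge_point e n s - t *\<^sub>R (\<sigma> *\<^sub>R n) \<in> B) (at_right 0)"
      by simp
  qed
qed

lemma polygon_elem:
  assumes P: "is_polygon P"
  shows "bounded_open_set (elem P)" "elem P \<noteq> {}"
    and polygon_element_edge: "e \<in> edges P \<Longrightarrow> norm n = 1 \<Longrightarrow> n \<bullet> (snd e - fst e) = 0 \<Longrightarrow>
      \<exists>\<sigma>. element_edge (elem P) e n \<sigma>"
proof -
  obtain u v w xs where P_eq: "P = u # v # w # xs"
    using P by (auto simp: is_polygon_def numeral_3_eq_3 Suc_le_length_iff)
  have "simple_path (bdry_path P)" "pathfinish (bdry_path P) = pathstart (bdry_path P)"
    using P polyline_ends[of "P @ [hd P]"] by (simp_all add: is_polygon_def bdry_path_def P_eq)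
  then obtain B where op: "open (elem P)" "elem P \<noteq> {}" "bounded (elem P)" "open B"
    and AB: "elem P \<inter> B = {}" "elem P \<union> B = - path_image (bdry_path P)"
    and cl: "path_image (bdry_path P) \<subseteq> closure (elem P)" "path_image (bdry_path P) \<subseteq> closure B"
    unfolding elem_def by (rule Jordan_inside_pt)
  show bo: "bounded_open_set (elem P)" by unfold_locales (rule op)+
  show "elem P \<noteq> {}" by (rule op)
  \<comment> \<open>B is open and therefore misses the closure of the element too, which leaves
    exactly the boundary path as frontier.\<close>
  have "closure (elem P) \<inter> B = {}" using AB(1) op(4) open_Int_closure_eq_empty[of B "elem P"] by blast
  then have fr: "frontier (elem P) = path_image (bdry_path P)"
    using AB cl(1) closure_subset[of "elem P"] op(1) by (auto simp: frontier_def interior_open)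
  assume e: "e \<in> edges P" and n: "norm n = 1" "n \<bullet> (snd e - fst e) = 0"
  note edge = polygon_edge[OF P, of "fst e" "snd e", simplified, OF e]
  obtain \<sigma> where \<sigma>: "\<sigma> = 1 \<or> \<sigma> = (-1::real)"
    "\<And>s. \<bar>s\<bar> < edge_len e / 2 \<Longrightarrow> eventually (\<lambda>t. edge_point e n s + t *\<^sub>R (\<sigma> *\<^sub>R n) \<in> elem P) (at_right 0)"
    "\<And>s. \<bar>s\<bar> < edge_len e / 2 \<Longrightarrow> eventually (\<lambda>t. edge_point e n s - t *\<^sub>R (\<sigma> *\<^sub>R n) \<in> B) (at_right 0)"
    using edge_sides[OF op(1,4) AB cl n edge] by blast
  have outer: "eventually (\<lambda>t. edge_point e n s - t *\<^sub>R (\<sigma> *\<^sub>R n) \<notin> elem P) (at_right 0)"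
    if "\<bar>s\<bar> < edge_len e / 2" for s
    by (rule eventually_mono[OF \<sigma>(3)[OF that]]) (use AB(1) in blast)
  interpret bounded_open_set "elem P" by (rule bo)
  show "\<exists>\<sigma>. element_edge (elem P) e n \<sigma>"
    by (rule exI[of _ \<sigma>], unfold_locales) (use edge n \<sigma> outer fr in auto)
qed

section \<open>Degrees of freedom and the forms\<close>

text \<open>The properties that make the degrees of freedom additive. Fields in
  \<open>Vh_loc\<close> and polynomial fields both have them, and they pass to differences, hence to
  w - \<pi>w.\<close>

definition has_traces :: "(pt set \<Rightarrow> pt) \<Rightarrow> polygon \<Rightarrow> (pt \<Rightarrow> pt) \<Rightarrow> bool" where
  "has_traces nrm P v \<longleftrightarrow> square_integrable (elem P) v \<and> (\<exists>d. weak_div (elem P) v d) \<and>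
     (\<forall>e\<in>edges P. \<exists>g. normal_trace (elem P) e (edge_normal nrm e) v g)"

lemma Vh_loc_has_traces: "v \<in> Vh_loc k nrm P \<Longrightarrow> has_traces nrm P v"
  unfolding Vh_loc_def has_traces_def Hdiv_def by blast

lemma continuous_on_perp [continuous_intros]:
  fixes f :: "pt \<Rightarrow> pt"
  assumes "continuous_on A f" shows "continuous_on A (\<lambda>x. perp (f x))"
proof (rule continuous_on_vecI)
  have "continuous_on A (\<lambda>x. - f x $ 2)" "continuous_on A (\<lambda>x. f x $ 1)"
    by (intro continuous_intros assms)+
  then show "continuous_on A (\<lambda>x. perp (f x) $ i)" for i
    using exhaust_2[of i] by auto
qed

lemma continuous_on_scaled: "continuous_on A (scaled P)"
  unfolding scaled_def by (intro continuous_intros)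

lemma monom2_scaled_C1: "(\<lambda>x. monom2 \<alpha> (scaled P x)) \<in> C1"
proof -
  have "(\<lambda>x. ((1 / diam P) * (x $ 1 - barycenter P $ 1)) ^ fst \<alpha> * 
      ((1 / diam P) * (x $ 2 - barycenter P $ 2)) ^ snd \<alpha>) \<in> C1"
    by (intro C1_mult C1_power C1_diff C1_component C1_const)
  then show ?thesis by (simp add: monom2_def scaled_def)
qed

locale polygon_with_normals =
  fixes P :: polygon and nrm :: "pt set \<Rightarrow> pt"
  assumes polygon: "is_polygon P"
    and normals: "\<And>e. e \<in> edges P \<Longrightarrow> norm (edge_normal nrm e) = 1"
      "\<And>e. e \<in> edges P \<Longrightarrow> edge_normal nrm e \<bullet> (snd e - fst e) = 0"
begin

sublocale bounded_open_set "elem P"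
  by (rule polygon_elem(1)[OF polygon])

lemma element_edgeE:
  assumes "e \<in> edges P"
  obtains \<sigma> where "element_edge (elem P) e (edge_normal nrm e) \<sigma>"
  using polygon_element_edge[OF polygon assms normals[OF assms]] by blast

lemma vPolys_has_traces:
  assumes q: "q \<in> vPolys l" shows "has_traces nrm P q"
proof -
  have traces: "(\<exists>d. weak_div (elem P) q d) \<and> (\<exists>g. normal_trace (elem P) e (edge_normal nrm e) q g)"
    if e: "e \<in> edges P" for e
  proof -
    obtain \<sigma> where "element_edge (elem P) e (edge_normal nrm e) \<sigma>" using e by (rule element_edgeE)
    then interpret element_edge "elem P" e "edge_normal nrm e" \<sigma> .
    show ?thesis using normal_trace_C1_field[OF vPolys_C1[OF q]] by blast
  qed
  \<comment> \<open>The weak divergence comes out of the argument at an edge, so one edge has to be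
    exhibited.\<close>
  obtain u v w xs where "P = u # v # w # xs"
    using polygon by (auto simp: is_polygon_def numeral_3_eq_3 Suc_le_length_iff)
  then have "(u, v) \<in> edges P" by (simp add: edges_def)
  then show ?thesis
    using traces vPolys_square_integrable[OF q] unfolding has_traces_def by blast
qed

lemma has_traces_diff:
  assumes v: "has_traces nrm P v" and w: "has_traces nrm P w"
  shows "has_traces nrm P (\<lambda>x. v x - w x)"
proof -
  obtain d d' where d: "weak_div (elem P) v d" "weak_div (elem P) w d'"
    using v w by (auto simp: has_traces_def)
  have sq: "square_integrable (elem P) v" "square_integrable (elem P) w"
    using v w by (auto simp: has_traces_def)
  show ?thesis
    unfolding has_traces_def
  proof (intro conjI ballI)
    show "square_integrable (elem P) (\<lambda>x. v x - w x)" by (rule square_integrable_diff[OF sq])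
    show "\<exists>d. weak_div (elem P) (\<lambda>x. v x - w x) d" using weak_div_diff[OF sq d] by blast
    fix e assume e: "e \<in> edges P"
    obtain g g' where "normal_trace (elem P) e (edge_normal nrm e) v g"
        "normal_trace (elem P) e (edge_normal nrm e) w g'"
      using v w e unfolding has_traces_def by blast
    from normal_trace_diff[OF sq(1) d(1) this(1) sq(2) d(2) this(2) continuous_edge_point]
    show "\<exists>g. normal_trace (elem P) e (edge_normal nrm e) (\<lambda>x. v x - w x) g" by blast
  qed
qed

text \<open>The trace of the difference is chosen independently of the traces of v and w, but by
  \<open>normal_trace_moment_unique\<close> it has the moments of their difference. The other two
  kinds of degrees of freedom are integrals against continuous fields.\<close>

lemma dof_diff:
  assumes v: "has_traces nrm P v" and w: "has_traces nrm P w" and i: "i \<in> dof_index k P"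
  shows "dof nrm P (\<lambda>x. v x - w x) i = dof nrm P v i - dof nrm P w i"
proof (cases i)
  case (Edge_Dof e j)
  with i have e: "e \<in> edges P" by (auto simp: dof_index_def)
  let ?n = "edge_normal nrm e"
  obtain \<sigma> where "element_edge (elem P) e ?n \<sigma>" using e by (rule element_edgeE)
  then interpret element_edge "elem P" e ?n \<sigma> .
  obtain d d' where d: "weak_div (elem P) v d" "weak_div (elem P) w d'"
    using v w by (auto simp: has_traces_def)
  have sq: "square_integrable (elem P) v" "square_integrable (elem P) w"
    using v w by (auto simp: has_traces_def)
  have nt: "normal_trace (elem P) e ?n u (ntrace (elem P) e ?n u)" if "has_traces nrm P u" for u
    using that e normal_trace_ntrace unfolding has_traces_def by blast
  have "(LINT s:edge_interval e|lebesgue. ntrace (elem P) e ?n (\<lambda>x. v x - w x) s * (s / edge_len e) ^ j) =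
    (LINT s:edge_interval e|lebesgue. (ntrace (elem P) e ?n v s - ntrace (elem P) e ?n w s) * (s / edge_len e) ^ j)"
    by (rule normal_trace_moment_unique[OF nt[OF has_traces_diff[OF v w]]
        normal_trace_diff[OF sq(1) d(1) nt[OF v] sq(2) d(2) nt[OF w] continuous_edge_point]])
  also have "\<dots> = (LINT s:edge_interval e|lebesgue. ntrace (elem P) e ?n v s * (s / edge_len e) ^ j) -
      (LINT s:edge_interval e|lebesgue. ntrace (elem P) e ?n w s * (s / edge_len e) ^ j)"
  proof -
    have "set_integrable lebesgue (edge_interval e) (\<lambda>s. ntrace (elem P) e ?n u s * (s / edge_len e) ^ j)"
      if "has_traces nrm P u" for u
    proof (rule set_integrable_mult_continuous)
      show "set_integrable lebesgue (edge_interval e) (ntrace (elem P) e ?n u)"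
        using nt[OF that] by (simp add: normal_trace_def)
      show "continuous_on UNIV (\<lambda>s. (s / edge_len e) ^ j)"
        unfolding divide_inverse by (intro continuous_intros)
    qed
    then show ?thesis unfolding left_diff_distrib using v w by (intro set_integral_diff(2)) auto
  qed
  finally show ?thesis by (simp add: Edge_Dof right_diff_distrib)
next
  case (Grad_Dof \<alpha>)
  let ?m = "\<lambda>y. monom2 \<alpha> (scaled P y)"
  have "square_integrable (elem P) (grad ?m)"
    by (intro square_integrable_continuous C1D(2) monom2_scaled_C1)
  then have "integrable (lebesgue_on (elem P)) (\<lambda>x. v x \<bullet> grad ?m x)"
    "integrable (lebesgue_on (elem P)) (\<lambda>x. w x \<bullet> grad ?m x)"
    using v w by (auto simp: has_traces_def intro: square_integrable_inner)
  then show ?thesis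
    by (simp add: Grad_Dof set_lint_eq inner_diff_left right_diff_distrib)
next
  case (Perp_Dof \<alpha>)
  let ?r = "\<lambda>x. monom2 \<alpha> (scaled P x) *\<^sub>R perp (scaled P x)"
  have r: "square_integrable (elem P) ?r"
    by (intro square_integrable_continuous continuous_intros C1D(3) monom2_scaled_C1 continuous_on_scaled)
  have "square_integrable (elem P) v" "square_integrable (elem P) w"
    using v w by (auto simp: has_traces_def)
  from this[THEN square_integrable_inner, OF r] show ?thesis
    by (simp add: Perp_Dof set_lint_eq inner_diff_left algebra_simps)
qed

end

section \<open>Estimates of the local forms and of their sum\<close>

lemma norm_eq_L2_set: "norm x = L2_set (\<lambda>i. x $ i) UNIV" for x :: pt
  by (simp add: norm_vec_def L2_set_def)

lemma powr_minus_2_mult_square: "0 \<le> x \<Longrightarrow> x powr (q - 2) * x\<^sup>2 = x powr q" for x q :: real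
  using powr_add[of x "q - 2" 2] by simp

lemma s_loc_self:
  "s_loc p k nrm P u u = (diam P)\<^sup>2 * L2_set (dof nrm P u) (dof_index k P) powr conj_exp p"
proof -
  have "(\<Sum>i\<in>dof_index k P. dof nrm P u i * dof nrm P u i) = (L2_set (dof nrm P u) (dof_index k P))\<^sup>2"
    by (simp add: L2_set_def power2_eq_square sum_nonneg)
  then show ?thesis
    by (simp add: s_loc_def mult.assoc powr_minus_2_mult_square L2_set_nonneg)
qed

lemma a_loc_self:
  "a_loc p P u u = (LINT x:elem P|lebesgue. norm (u x) powr conj_exp p)"
  unfolding a_loc_def power2_norm_eq_inner[symmetric] by (simp add: powr_minus_2_mult_square)

text \<open>The booleans label the consistency and the stabilisation term of an element, so that
  Hoelder's inequality is applied once, to a single finite sum.\<close>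

lemma sum_Times_bool:
  fixes f :: "'a \<times> bool \<Rightarrow> 'b::comm_monoid_add"
  shows "(\<Sum>x\<in>M \<times> UNIV. f x) = (\<Sum>P\<in>M. f (P, True) + f (P, False))"
proof -
  have "(\<Sum>x\<in>M \<times> UNIV. f x) = (\<Sum>P\<in>M. \<Sum>b\<in>UNIV. f (P, b))"
    by (simp add: sum.cartesian_product)
  then show ?thesis by (simp add: UNIV_bool add.commute)
qed

text \<open>q stands for the conjugate exponent. The exponents a, b, c belong to the growth factor,
  the difference and the test field; as q * b = min q 2 - 1 and q * c = 1, they produce the powers
  of the theorem when applied to q-th powers.\<close>

context
  fixes q a b c K :: real
  assumes q: "1 < q"
  defines "a \<equiv> (q - min q 2) / q" and "b \<equiv> (min q 2 - 1) / q" and "c \<equiv> 1 / q"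
    and "K \<equiv> 1 + max 1 (q - 2)"
begin

lemma exponents: "0 \<le> a" "0 < b" "0 < c" "a + b + c = 1" "0 < K"
proof -
  have "a + b + c = ((q - min q 2) + (min q 2 - 1) + 1) / q"
    unfolding a_def b_def c_def by (simp only: add_divide_distrib)
  then show "a + b + c = 1" using q by simp
qed (use q in \<open>auto simp: a_def b_def c_def K_def\<close>)

text \<open>The form needed for Hoelder's inequality: integration or summation turns these q-th
  powers into diagonal values of the local forms.\<close>

lemma power_map_diff_le_powers:
  fixes f g h :: "'i \<Rightarrow> real"
  shows "\<bar>L2_set f I powr (q - 2) * (\<Sum>i\<in>I. f i * h i) - L2_set g I powr (q - 2) * (\<Sum>i\<in>I. g i * h i)\<bar>
    \<le> K * (rpow (L2_set f I powr q + L2_set g I powr q) a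
        * (L2_set (\<lambda>i. f i - g i) I powr q) powr b * (L2_set h I powr q) powr c)"
proof -
  have "q * b = min q 2 - 1" "q * c = 1" using q by (simp_all add: b_def c_def)
  then show ?thesis
    using power_map_diff_le[OF q, of f I h g]
    by (simp add: powr_powr K_def a_def L2_set_nonneg mult.assoc)
qed

lemma a_loc_diff_le:
  fixes u v w :: "pt \<Rightarrow> pt"
  assumes p: "conj_exp p = q" and E: "bounded_open_set (elem P)"
    and cont: "continuous_on UNIV u" "continuous_on UNIV v" "continuous_on UNIV w"
  shows "\<bar>a_loc p P u w - a_loc p P v w\<bar> \<le> K * (rpow (a_loc p P u u + a_loc p P v v) a
    * a_loc p P (\<lambda>x. u x - v x) (\<lambda>x. u x - v x) powr b * a_loc p P w w powr c)"
proof -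
  interpret bounded_open_set "elem P" by (rule E)
  have int_q: "integrable (lebesgue_on (elem P)) (\<lambda>x. norm (y x) powr q)"
    if y: "continuous_on UNIV y" for y :: "pt \<Rightarrow> pt"
  proof -
    have [measurable]: "y \<in> borel_measurable (lebesgue_on (elem P))" by (rule continuous_measurable[OF y])
    obtain B where "\<And>x. x \<in> elem P \<Longrightarrow> norm (y x) \<le> B" using continuous_bound[OF y] by metis
    then show ?thesis
      using q by (intro integrable_bounded_measurable[where B = "B powr q"]) (auto intro!: powr_mono2)
  qed
  \<comment> \<open>For q < 2 the factor |y|^(q - 2) is unbounded near zeros of y, so integrability
    is taken from the Cauchy-Schwarz bound |y|^(q - 1) |w|.\<close>
  have int_A: "integrable (lebesgue_on (elem P)) (\<lambda>x. norm (y x) powr (q - 2) * (y x \<bullet> w x))"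
    if y: "continuous_on UNIV y" for y :: "pt \<Rightarrow> pt"
  proof -
    have [measurable]: "y \<in> borel_measurable (lebesgue_on (elem P))" "w \<in> borel_measurable (lebesgue_on (elem P))"
      by (rule continuous_measurable[OF y] continuous_measurable[OF cont(3)])+
    obtain B where B: "\<And>x. x \<in> elem P \<Longrightarrow> norm (y x) \<le> B" using continuous_bound[OF y] by metis
    obtain C where C: "\<And>x. x \<in> elem P \<Longrightarrow> norm (w x) \<le> C" using continuous_bound[OF cont(3)] by metis
    show ?thesis
    proof (rule integrable_bounded_measurable[where B = "B powr (q - 1) * C"])
      fix x assume x: "x \<in> elem P"
      have "norm (norm (y x) powr (q - 2) * (y x \<bullet> w x)) \<le> norm (y x) powr (q - 2) * (norm (y x) * norm (w x))"
        using Cauchy_Schwarz_ineq2[of "y x" "w x"] by (simp add: abs_mult mult_left_mono)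
      also have "\<dots> = norm (y x) powr (q - 1) * norm (w x)"
        using powr_mult_base[of "norm (y x)" "q - 2"] by (simp add: mult_ac)
      also have "\<dots> \<le> B powr (q - 1) * C"
        using q B[OF x] C[OF x] by (intro mult_mono powr_mono2) auto
      finally show "norm (norm (y x) powr (q - 2) * (y x \<bullet> w x)) \<le> B powr (q - 1) * C" .
    qed measurable
  qed
  define X where "X x = norm (u x) powr q + norm (v x) powr q" for x
  define Y where "Y x = norm (u x - v x) powr q" for x
  define Z where "Z x = norm (w x) powr q" for x
  have int: "integrable (lebesgue_on (elem P)) X" "integrable (lebesgue_on (elem P)) Y" "integrable (lebesgue_on (elem P)) Z"
    unfolding X_def Y_def Z_def by (intro Bochner_Integration.integrable_add int_q cont continuous_intros)+
  note H = rpow_Hoelder[OF exponents(1-4) int]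
  have pointwise: "\<bar>norm (u x) powr (q - 2) * (u x \<bullet> w x) - norm (v x) powr (q - 2) * (v x \<bullet> w x)\<bar>
      \<le> K * (rpow (X x) a * Y x powr b * Z x powr c)" for x
    using power_map_diff_le_powers[of "\<lambda>i. u x $ i" UNIV "\<lambda>i. w x $ i" "\<lambda>i. v x $ i"]
    by (simp add: norm_eq_L2_set X_def Y_def Z_def inner_vec_def)
  have "\<bar>a_loc p P u w - a_loc p P v w\<bar> =
      \<bar>\<integral>x. norm (u x) powr (q - 2) * (u x \<bullet> w x) - norm (v x) powr (q - 2) * (v x \<bullet> w x) \<partial>lebesgue_on (elem P)\<bar>"
    using int_A cont by (simp add: a_loc_def p set_lint_eq)
  also have "\<dots> \<le> (\<integral>x. \<bar>norm (u x) powr (q - 2) * (u x \<bullet> w x) - norm (v x) powr (q - 2) * (v x \<bullet> w x)\<bar> \<partial>lebesgue_on (elem P))"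
    by (rule integral_abs_bound)
  also have "\<dots> \<le> (\<integral>x. K * (rpow (X x) a * Y x powr b * Z x powr c) \<partial>lebesgue_on (elem P))"
    using int_A cont H(1)
    by (intro integral_mono pointwise integrable_abs Bochner_Integration.integrable_diff integrable_mult_right)
      (auto simp: X_def Y_def Z_def)
  also have "\<dots> = K * (\<integral>x. rpow (X x) a * Y x powr b * Z x powr c \<partial>lebesgue_on (elem P))"
    by simp
  also have "\<dots> \<le> K * (rpow (\<integral>x. X x \<partial>lebesgue_on (elem P)) a *
      (\<integral>x. Y x \<partial>lebesgue_on (elem P)) powr b * (\<integral>x. Z x \<partial>lebesgue_on (elem P)) powr c)"
    by (intro mult_left_mono H(2)) (use exponents in \<open>auto simp: X_def Y_def Z_def\<close>)
  also have "(\<integral>x. X x \<partial>lebesgue_on (elem P)) = a_loc p P u u + a_loc p P v v"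
    using int_q cont by (simp add: a_loc_self p set_lint_eq X_def)
  also have "(\<integral>x. Y x \<partial>lebesgue_on (elem P)) = a_loc p P (\<lambda>x. u x - v x) (\<lambda>x. u x - v x)"
    by (simp add: a_loc_self p set_lint_eq Y_def)
  also have "(\<integral>x. Z x \<partial>lebesgue_on (elem P)) = a_loc p P w w"
    by (simp add: a_loc_self p set_lint_eq Z_def)
  finally show ?thesis .
qed

text \<open>The field y enters only through its degrees of freedom, so additivity is asked on the
  index set alone, which is the form that \<open>dof_diff\<close> provides.\<close>

lemma s_loc_diff_le:
  assumes p: "conj_exp p = q"
    and diff: "\<And>i. i \<in> dof_index k P \<Longrightarrow> dof nrm P y i = dof nrm P u i - dof nrm P v i"
  shows "\<bar>s_loc p k nrm P u w - s_loc p k nrm P v w\<bar> \<le> K * (rpow (s_loc p k nrm P u u + s_loc p k nrm P v v) a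
    * s_loc p k nrm P y y powr b * s_loc p k nrm P w w powr c)"
proof (cases "diam P = 0")
  case True
  then show ?thesis using exponents by (simp add: s_loc_def)
next
  case False
  define D where "D = (diam P)\<^sup>2"
  have D: "D > 0" using False by (simp add: D_def)
  let ?L = "\<lambda>u. L2_set (dof nrm P u) (dof_index k P)"
  have y: "?L y = L2_set (\<lambda>i. dof nrm P u i - dof nrm P v i) (dof_index k P)"
    using diff by (intro L2_set_cong) auto
  \<comment> \<open>The weight is distributed over the three factors; this costs nothing because the
    exponents add up to 1.\<close>
  have Dabc: "D = rpow D a * D powr b * D powr c"
    using D exponents(4) by (simp add: rpow_eq_powr flip: powr_add)
  have "\<bar>s_loc p k nrm P u w - s_loc p k nrm P v w\<bar> =
      D * \<bar>?L u powr (q - 2) * (\<Sum>i\<in>dof_index k P. dof nrm P u i * dof nrm P w i) -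
           ?L v powr (q - 2) * (\<Sum>i\<in>dof_index k P. dof nrm P v i * dof nrm P w i)\<bar>"
    using D by (simp add: s_loc_def p D_def mult.assoc abs_mult flip: right_diff_distrib)
  also have "\<dots> \<le> D * (K * (rpow (?L u powr q + ?L v powr q) a * (?L y powr q) powr b * (?L w powr q) powr c))"
    unfolding y using D by (intro mult_left_mono power_map_diff_le_powers) simp
  also have "\<dots> = K * (rpow (D * (?L u powr q + ?L v powr q)) a * (D * ?L y powr q) powr b * (D * ?L w powr q) powr c)"
    using D by (subst Dabc) (simp add: rpow_mult powr_mult L2_set_nonneg)
  finally show ?thesis
    by (simp add: s_loc_self p D_def distrib_left)
qed

lemma a_h_diff_le:
  fixes k :: nat
  assumes p: "conj_exp p = q" and "finite M"
    and poly: "\<And>P. P \<in> M \<Longrightarrow> polygon_with_normals P nrm"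
    and tr: "\<And>P. P \<in> M \<Longrightarrow> has_traces nrm P w" "\<And>P. P \<in> M \<Longrightarrow> has_traces nrm P z"
      "\<And>P. P \<in> M \<Longrightarrow> has_traces nrm P v"
  shows "\<bar>a_h p k nrm M w v - a_h p k nrm M z v\<bar> \<le> K * (rpow (a_h p k nrm M w w + a_h p k nrm M z z) a
    * a_h p k nrm M (\<lambda>x. w x - z x) (\<lambda>x. w x - z x) powr b * a_h p k nrm M v v powr c)"
proof -
  define A where "A u u' P = a_loc p P (proj k P u) (proj k P u')" for u u' P
  define R where "R u P x = u x - proj k P u x" for u :: "pt \<Rightarrow> pt" and P x
  define S where "S u u' P = s_loc p k nrm P (R u P) (R u' P)" for u u' P
  define y where "y x = w x - z x" for x
  have a_h_eq: "a_h p k nrm M u u' = (\<Sum>P\<in>M. A u u' P + S u u' P)" for u u'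
    by (simp add: a_h_def A_def S_def R_def[abs_def])
  have nonneg: "0 \<le> A u u P" "0 \<le> S u u P" for u P
    by (auto simp: A_def S_def a_loc_self s_loc_self set_lebesgue_integral_def
        intro!: Bochner_Integration.integral_nonneg)
  \<comment> \<open>The label True marks consistency terms, False stabilisation terms.\<close>
  define X where "X P' = (case P' of (P, True) \<Rightarrow> A w w P + A z z P | (P, False) \<Rightarrow> S w w P + S z z P)" for P'
  define Y where "Y P' = (case P' of (P, True) \<Rightarrow> A y y P | (P, False) \<Rightarrow> S y y P)" for P'
  define Z where "Z P' = (case P' of (P, True) \<Rightarrow> A v v P | (P, False) \<Rightarrow> S v v P)" for P'
  have XYZ: "0 \<le> X P'" "0 \<le> Y P'" "0 \<le> Z P'" for P'
    by (auto simp: X_def Y_def Z_def nonneg split: prod.split bool.split)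
  define H where "H P' = rpow (X P') a * Y P' powr b * Z P' powr c" for P'
  have loc: "\<bar>A w v P - A z v P\<bar> \<le> K * H (P, True)" "\<bar>S w v P - S z v P\<bar> \<le> K * H (P, False)" if "P \<in> M" for P
  proof -
    interpret polygon_with_normals P nrm by (rule poly[OF that])
    have ne: "elem P \<noteq> {}" by (rule polygon_elem(2)[OF polygon])
    note t = tr(1)[OF that] tr(2)[OF that] tr(3)[OF that]
    have sq: "square_integrable (elem P) w" "square_integrable (elem P) z" "square_integrable (elem P) v"
      using t by (auto simp: has_traces_def)
    note pr = sq[THEN proj_vPolys[OF bounded_open_set_axioms ne, of _ k]]
    have proj_y: "proj k P y = (\<lambda>x. proj k P w x - proj k P z x)"
      unfolding y_def[abs_def] using proj_diff[OF bounded_open_set_axioms ne sq(1,2)] by blast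
    show "\<bar>A w v P - A z v P\<bar> \<le> K * H (P, True)"
      using a_loc_diff_le[OF p bounded_open_set_axioms pr[THEN vPolys_continuous]]
      by (simp add: A_def H_def X_def Y_def Z_def proj_y)
    have Ry: "R y P = (\<lambda>x. R w P x - R z P x)"
      by (simp add: R_def fun_eq_iff proj_y y_def)
    have Rt: "has_traces nrm P (R u P)" if "has_traces nrm P u" for u
    proof -
      have "proj k P u \<in> vPolys (int k)"
        using that by (intro proj_vPolys bounded_open_set_axioms ne) (simp add: has_traces_def)
      then show ?thesis unfolding R_def by (intro has_traces_diff that vPolys_has_traces)
    qed
    have "dof nrm P (R y P) i = dof nrm P (R w P) i - dof nrm P (R z P) i" if "i \<in> dof_index k P" for i
      unfolding Ry by (rule dof_diff[OF Rt[OF t(1)] Rt[OF t(2)] that])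
    from s_loc_diff_le[OF p this, where w = "R v P"]
    show "\<bar>S w v P - S z v P\<bar> \<le> K * H (P, False)"
      by (simp add: S_def H_def X_def Y_def Z_def)
  qed
  have "a_h p k nrm M w v - a_h p k nrm M z v = (\<Sum>P\<in>M. (A w v P - A z v P) + (S w v P - S z v P))"
    by (simp add: a_h_eq flip: sum_subtractf) (simp add: algebra_simps)
  then have "\<bar>a_h p k nrm M w v - a_h p k nrm M z v\<bar> \<le> (\<Sum>P\<in>M. \<bar>(A w v P - A z v P) + (S w v P - S z v P)\<bar>)"
    by (simp only: sum_abs)
  also have "\<dots> \<le> (\<Sum>P\<in>M. K * (H (P, True) + H (P, False)))"
  proof (rule sum_mono)
    fix P assume "P \<in> M"
    from loc[OF this] show "\<bar>(A w v P - A z v P) + (S w v P - S z v P)\<bar> \<le> K * (H (P, True) + H (P, False))"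
      unfolding distrib_left by linarith
  qed
  also have "\<dots> = K * (\<Sum>P'\<in>M \<times> UNIV. H P')"
    by (simp add: sum_Times_bool sum_distrib_left)
  also have "\<dots> \<le> K * (rpow (\<Sum>P'\<in>M \<times> UNIV. X P') a * (\<Sum>P'\<in>M \<times> UNIV. Y P') powr b * (\<Sum>P'\<in>M \<times> UNIV. Z P') powr c)"
    unfolding H_def using exponents \<open>finite M\<close>
    by (intro mult_left_mono rpow_Hoelder_sum XYZ) auto
  also have "(\<Sum>P'\<in>M \<times> UNIV. X P') = a_h p k nrm M w w + a_h p k nrm M z z"
    by (simp add: sum_Times_bool X_def a_h_eq flip: sum.distrib) (simp add: algebra_simps)
  also have "(\<Sum>P'\<in>M \<times> UNIV. Y P') = a_h p k nrm M y y"
    by (simp add: sum_Times_bool Y_def a_h_eq)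
  also have "(\<Sum>P'\<in>M \<times> UNIV. Z P') = a_h p k nrm M v v"
    by (simp add: sum_Times_bool Z_def a_h_eq)
  finally show ?thesis by (simp add: y_def[abs_def])
qed

lemma a_h_self_le_norm_h:
  assumes p: "conj_exp p = q"
  shows "0 \<le> a_h p k nrm M u u" "a_h p k nrm M u u \<le> norm_h p k nrm M u powr q"
proof -
  let ?D = "\<Sum>P\<in>M. diam P powr q * Lq_norm q (elem P) (divg (elem P) u) powr q"
  show nonneg: "0 \<le> a_h p k nrm M u u"
    by (auto simp: a_h_def a_loc_self s_loc_self set_lebesgue_integral_def
        intro!: sum_nonneg add_nonneg_nonneg Bochner_Integration.integral_nonneg)
  have "0 \<le> ?D" by (auto intro!: sum_nonneg)
  then show "a_h p k nrm M u u \<le> norm_h p k nrm M u powr q"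
    using nonneg q by (simp add: norm_h_def p powr_powr)
qed

lemma a_h_diff_le_norm_h:
  fixes k :: nat
  assumes p: "conj_exp p = q" and "finite M"
    and poly: "\<And>P. P \<in> M \<Longrightarrow> polygon_with_normals P nrm"
    and tr: "\<And>P. P \<in> M \<Longrightarrow> has_traces nrm P w" "\<And>P. P \<in> M \<Longrightarrow> has_traces nrm P z"
      "\<And>P. P \<in> M \<Longrightarrow> has_traces nrm P v"
  shows "\<bar>a_h p k nrm M w v - a_h p k nrm M z v\<bar> \<le>
    K * rpow (norm_h p k nrm M w powr q + norm_h p k nrm M z powr q) a
      * norm_h p k nrm M (\<lambda>x. w x - z x) powr (min q 2 - 1) * norm_h p k nrm M v"
proof -
  note le = a_h_self_le_norm_h[OF p]
  have exps: "q * b = min q 2 - 1" "q * c = 1" using q by (simp_all add: b_def c_def)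
  have norm_nonneg: "0 \<le> norm_h p k nrm M v" by (simp add: norm_h_def)
  have "\<bar>a_h p k nrm M w v - a_h p k nrm M z v\<bar> \<le> K * (rpow (a_h p k nrm M w w + a_h p k nrm M z z) a
    * a_h p k nrm M (\<lambda>x. w x - z x) (\<lambda>x. w x - z x) powr b * a_h p k nrm M v v powr c)"
    by (rule a_h_diff_le[OF p \<open>finite M\<close> poly tr])
  also have "\<dots> \<le> K * (rpow (norm_h p k nrm M w powr q + norm_h p k nrm M z powr q) a
    * (norm_h p k nrm M (\<lambda>x. w x - z x) powr q) powr b * (norm_h p k nrm M v powr q) powr c)"
    using exponents le
    by (intro mult_left_mono mult_mono rpow_mono powr_mono2 add_mono mult_nonneg_nonneg add_nonneg_nonneg) auto
  also have "\<dots> = K * rpow (norm_h p k nrm M w powr q + norm_h p k nrm M z powr q) a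
      * norm_h p k nrm M (\<lambda>x. w x - z x) powr (min q 2 - 1) * norm_h p k nrm M v"
    using norm_nonneg by (simp add: powr_powr exps mult.assoc)
  finally show ?thesis .
qed

end

theorem lemma26:
  fixes p :: real
  assumes "1 < p"
  shows "\<exists>C>0. \<forall>(k::nat) \<Omega> M \<rho> nrm.
    polygonal_domain \<Omega> \<longrightarrow> is_mesh \<Omega> M \<longrightarrow> \<rho> > 0 \<longrightarrow> mesh_regular \<rho> M \<longrightarrow> edge_normals M nrm \<longrightarrow>
    (\<forall>v\<in>Vh k nrm \<Omega> M. \<forall>w\<in>Vh k nrm \<Omega> M. \<forall>z\<in>Vh k nrm \<Omega> M.
      let p' = conj_exp p; pm = min p' 2 in
      \<bar>a_h p k nrm M w v - a_h p k nrm M z v\<bar>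
        \<le> C * rpow (norm_h p k nrm M w powr p' + norm_h p k nrm M z powr p') ((p' - pm) / p')
            * norm_h p k nrm M (\<lambda>x. w x - z x) powr (pm - 1)
            * norm_h p k nrm M v)"
proof -
  have q: "1 < conj_exp p" using assms by (simp add: conj_exp_def field_simps)
  show ?thesis
    unfolding Let_def
  \<comment> \<open>The witness is \<open>K\<close> at q = \<open>conj_exp p\<close>: it is 2 for q
    \<le> 3 and q - 1 beyond, and it is fixed before the degree, the domain and the mesh.\<close>
  proof (intro exI[of _ "1 + max 1 (conj_exp p - 2)"] conjI allI impI ballI)
    show "0 < 1 + max 1 (conj_exp p - 2)" by simp
    fix k \<Omega> M \<rho> nrm v w z
    assume M: "is_mesh \<Omega> M" and nrm: "edge_normals M nrm"
      and V: "v \<in> Vh k nrm \<Omega> M" "w \<in> Vh k nrm \<Omega> M" "z \<in> Vh k nrm \<Omega> M"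
    have tr: "has_traces nrm P u" if "P \<in> M" "u \<in> Vh k nrm \<Omega> M" for P u
      using that by (intro Vh_loc_has_traces[of _ k]) (auto simp: Vh_def)
    have poly: "polygon_with_normals P nrm" if "P \<in> M" for P
    proof
      show "is_polygon P" using M that by (simp add: is_mesh_def)
      fix e assume "e \<in> edges P"
      with nrm that show "norm (edge_normal nrm e) = 1" "edge_normal nrm e \<bullet> (snd e - fst e) = 0"
        unfolding edge_normals_def edge_normal_def by (auto split: prod.splits)
    qed
    have "finite M" using M by (simp add: is_mesh_def)
    from a_h_diff_le_norm_h[OF q refl this poly tr tr tr] V
    show "\<bar>a_h p k nrm M w v - a_h p k nrm M z v\<bar>
      \<le> (1 + max 1 (conj_exp p - 2)) * rpow (norm_h p k nrm M w powr conj_exp p + norm_h p k nrm M z powr conj_exp p)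
          ((conj_exp p - min (conj_exp p) 2) / conj_exp p)
        * norm_h p k nrm M (\<lambda>x. w x - z x) powr (min (conj_exp p) 2 - 1) * norm_h p k nrm M v"
      by blast
  qed
qed

end
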